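(* Let $[E,P]\in\mathcal{M}_{1,1}$ be a general pointed complex elliptic curve. Then the number $N_4$ of pencils $\ell\in G^1_4(E)$ (equivalently, degree $4$ covers $f:E\to\mathbb{P}^1$ up to automorphisms of $\mathbb{P}^1$) such that $a_1^\ell(P)\ge3$ and there exist distinct points $P_1,P_2,P_3\in E\setminus\{P\}$ with $a_1^\ell(P_i)\ge3$ for $i=1,2,3$ is equal to $16$.
   Context: For a pencil $\ell$ on $E$ and a point $Q\in E$, $a^\ell(Q)=(a_0^\ell(Q)<a_1^\ell(Q))$ is the vanishing sequence of $\ell$ at $Q$, i.e. the orders of vanishing at $Q$ of sections of $\ell$. Such a pencil corresponds to a degree $4$ cover triply ramified at $P,P_1,P_2,P_3$ and with no further ramification points. *)

theory Defs
  imports "HOL-Complex_Analysis.Complex_Analysis"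
begin

text \<open>The complex torus E = C / (Z + Z tau), Im tau > 0, with marked point P = class of 0.\<close>

definition lattice :: "complex \<Rightarrow> complex set" where
  "lattice \<tau> = {of_int m + of_int n * \<tau> | m n. True}"

definition fund_par :: "complex \<Rightarrow> complex set" where
  "fund_par \<tau> = {complex_of_real s + complex_of_real t * \<tau> | s t. 0 \<le> s \<and> s < 1 \<and> 0 \<le> t \<and> t < 1}"

text \<open>Elliptic (doubly periodic meromorphic) functions; values at isolated points are irrelevant.\<close>
definition elliptic_fun :: "complex \<Rightarrow> (complex \<Rightarrow> complex) \<Rightarrow> bool" where
  "elliptic_fun \<tau> f \<longleftrightarrow> f meromorphic_on UNIV \<and>
     (\<forall>z. eventually (\<lambda>w. f (w + 1) = f w \<and> f (w + \<tau>) = f w) (at z))"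

definition ell_degree :: "complex \<Rightarrow> (complex \<Rightarrow> complex) \<Rightarrow> nat" where
  "ell_degree \<tau> f = (\<Sum>z\<in>{z\<in>fund_par \<tau>. is_pole f z}. nat (- zorder f z))"

text \<open>Ramification index of f at z (= a_1 of the associated base-point-free pencil at z).\<close>
definition ram_index :: "(complex \<Rightarrow> complex) \<Rightarrow> complex \<Rightarrow> nat" where
  "ram_index f z = (if is_pole f z then nat (- zorder f z)
                    else nat (zorder (\<lambda>w. f w - remove_sings f z) z))"

definition good_cover :: "complex \<Rightarrow> (complex \<Rightarrow> complex) \<Rightarrow> bool" where
  "good_cover \<tau> f \<longleftrightarrow> elliptic_fun \<tau> f \<and> ell_degree \<tau> f = 4 \<and> ram_index f 0 \<ge> 3 \<and>
     (\<exists>p1 p2 p3. p1 \<notin> lattice \<tau> \<and> p2 \<notin> lattice \<tau> \<and> p3 \<notin> lattice \<tau> \<and>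
        p1 - p2 \<notin> lattice \<tau> \<and> p1 - p3 \<notin> lattice \<tau> \<and> p2 - p3 \<notin> lattice \<tau> \<and>
        ram_index f p1 \<ge> 3 \<and> ram_index f p2 \<ge> 3 \<and> ram_index f p3 \<ge> 3)"

definition moebius_equiv :: "(complex \<Rightarrow> complex) \<Rightarrow> (complex \<Rightarrow> complex) \<Rightarrow> bool" where
  "moebius_equiv f g \<longleftrightarrow> (\<exists>a b c d. a * d - b * c \<noteq> 0 \<and>
     (\<forall>z. eventually (\<lambda>w. g w = (a * f w + b) / (c * f w + d)) (at z)))"

definition N4 :: "complex \<Rightarrow> nat" where
  "N4 \<tau> = card {{g. good_cover \<tau> g \<and> moebius_equiv f g} | f. good_cover \<tau> f}"

text \<open>SL_2(Z)-equivalence of points of the upper half plane (same isomorphism class in M_{1,1}).\<close>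
definition sl2z_equiv :: "complex \<Rightarrow> complex \<Rightarrow> bool" where
  "sl2z_equiv \<tau> \<sigma> \<longleftrightarrow> (\<exists>a b c d :: int. a * d - b * c = 1 \<and>
     \<sigma> = (of_int a * \<tau> + of_int b) / (of_int c * \<tau> + of_int d))"

end

theory Submission
  imports Defs
begin

text \<open>Moving the value at 0 to infinity, a good cover has polar divisor \<open>3 \<cdot> 0 + a\<close>, so up to
  Moebius maps it is \<open>f = y / 6 + b x - k / 2 \<cdot> (y + e') / (x - e)\<close> with \<open>(x, y) = (wp, wp')\<close> and
  \<open>(e, e') = (wp a, wp' a)\<close>. The condition on \<open>P\<^sub>1, P\<^sub>2, P\<^sub>3\<close> says that all zeros of \<open>f'\<close> are
  double. Then all orders of \<open>f'\<close> or of \<open>f' \<cdot> (wp - e\<^sub>i)\<close> for one half-period value \<open>e\<^sub>i\<close> are even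
  and this function is the square of an elliptic function with poles only at 0 and \<open>a\<close>. Comparing coefficients
  gives one explicit system in \<open>(e, e', b, k)\<close> for each of the four cases. Each system has 4 solutions,
  unless \<open>g2 = 0\<close> or the \<open>e\<^sub>i\<close> are proportional to \<open>7, -2, -5\<close>. These two exceptions fix
  \<open>(g2, g3)\<close> up to scaling, so each concerns a single \<open>SL\<^sub>2(Z)\<close>-orbit.\<close>

subsection \<open>Discrete exceptional sets\<close>

text \<open>A square root of an elliptic function with even orders is multiplied by signs under the
  periods 1 and \<tau>. The three nontrivial sign pairs are exactly those of square roots of
  \<open>wp\<close> minus a half-period value, so multiplying by one of these repairs the
  periodicity; hence four cases. In each case \<open>e\<close> solves a quadratic equation and each
  root carries two solutions differing by signs, which gives 4. The exceptions are degenerations of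
  this count: for \<open>g2 = 0\<close> the first quadratic drops degree and leaves only
  \<open>k = 0\<close>; for the ratios 7, -2, -5 a root \<open>e\<close> is another half-period
  value, so the two signs of \<open>e'\<close> coincide. The summand \<open>y / 6\<close> is scaled
  so that the derivative is monic in \<open>x\<close>, and \<open>k\<close> is the residue at 0.
  Values at isolated points being irrelevant, identities are only available off a discrete set. They
  are combined in the filter \<open>cosparse UNIV\<close>; genuine values are recovered as limits or
  orders.\<close>

lemma cosparse_UNIV_iff:
  "eventually P (cosparse UNIV) \<longleftrightarrow> (\<forall>z::complex. eventually P (at z))"
  by (subst eventually_cosparse_open_eq) auto

lemma eventually_at_shift:
  fixes P :: "complex \<Rightarrow> bool"
  shows "eventually (\<lambda>w. P (w + c)) (at z) \<longleftrightarrow> eventually P (at (z + c))"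
proof -
  have "at (z + c) = filtermap (\<lambda>x. x - (-c)) (at z)"
    by (subst filtermap_at_shift) simp
  then show ?thesis by (simp add: eventually_filtermap)
qed

lemma cosparse_shift:
  fixes P :: "complex \<Rightarrow> bool"
  assumes "eventually P (cosparse UNIV)"
  shows "eventually (\<lambda>w. P (w + c)) (cosparse UNIV)"
  using assms unfolding cosparse_UNIV_iff eventually_at_shift by blast

lemma cosparse_at: "eventually P (cosparse UNIV) \<Longrightarrow> eventually P (at (z::complex))"
  by (simp add: cosparse_UNIV_iff)

lemma cosparse_frequently: "eventually P (cosparse UNIV) \<Longrightarrow> frequently P (at (z::complex))"
  by (intro eventually_frequently cosparse_at) auto

text \<open>The identity theorem in filter form, by connectedness of the plane: no third behaviour
  is possible for a meromorphic function.\<close>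

lemma cosparse_mero_cases:
  assumes "f meromorphic_on UNIV"
  shows "eventually (\<lambda>z. f z = c) (cosparse UNIV) \<or> eventually (\<lambda>z. f z \<noteq> c) (cosparse UNIV)"
  by (rule meromorphic_imp_constant_or_avoid[OF assms]) auto

lemma cosparse_UNIV_nonbot: "cosparse (UNIV :: complex set) \<noteq> bot"
proof
  assume "cosparse (UNIV :: complex set) = bot"
  then have "eventually (\<lambda>z::complex. False) (cosparse UNIV)" by simp
  then have "eventually (\<lambda>z::complex. False) (at 0)" by (rule cosparse_at)
  then show False by simp
qed

lemma cosparse_ex: "eventually P (cosparse (UNIV::complex set)) \<Longrightarrow> \<exists>z. P z"
  using eventually_happens cosparse_UNIV_nonbot by blast

lemma cosparse_mero_eq:
  assumes "f meromorphic_on UNIV" "g meromorphic_on UNIV"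
    and "frequently (\<lambda>w. f w = g w) (at z)"
  shows "eventually (\<lambda>z. f z = g z) (cosparse UNIV)"
proof -
  have m: "(\<lambda>z. f z - g z) meromorphic_on UNIV" by (intro meromorphic_intros assms)
  have "\<not> eventually (\<lambda>z. f z - g z \<noteq> 0) (cosparse UNIV)"
    using assms(3) by (auto dest!: cosparse_at[where z=z] simp: frequently_def)
  then show ?thesis using cosparse_mero_cases[OF m, of 0] by auto
qed

lemma mero_at: "f meromorphic_on UNIV \<Longrightarrow> f meromorphic_on {z}"
  by (rule meromorphic_on_subset) auto

lemma mero_iso: "f meromorphic_on UNIV \<Longrightarrow> isolated_singularity_at f z"
  by (simp add: meromorphic_on_isolated_singularity mero_at)

lemma mero_ness: "f meromorphic_on UNIV \<Longrightarrow> not_essential f z"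
  by (simp add: meromorphic_on_not_essential mero_at)

lemma holo_mero: "f holomorphic_on UNIV \<Longrightarrow> f meromorphic_on UNIV"
  by (simp add: analytic_on_imp_meromorphic_on analytic_on_open)

lemma analytic_cosparse:
  assumes "f meromorphic_on UNIV"
  shows "eventually (\<lambda>z. f analytic_on {z}) (cosparse UNIV)"
  using meromorphic_on_imp_analytic_cosparse[OF assms] by simp

text \<open>The non-vanishing assumption excludes the zero function, for which \<open>zorder\<close>
  carries no information.\<close>

lemma mero_pole_iff:
  assumes "f meromorphic_on UNIV" "eventually (\<lambda>z. f z \<noteq> 0) (cosparse UNIV)"
  shows "is_pole f z \<longleftrightarrow> zorder f z < 0"
  using isolated_pole_imp_neg_zorder[OF mero_iso[OF assms(1)]]
    zorder_neg_imp_is_pole[OF mero_at[OF assms(1)] cosparse_at[OF assms(2)]] by blast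

subsection \<open>The \<open>q\<close>-Pochhammer function\<close>

text \<open>The coefficients are those of Euler's expansion of the product of all \<open>1 - q\<^sup>n w\<close>, \<open>n \<ge> 0\<close>;
  they come from the functional equation \<open>Q(w) = (1 - w) Q(q w)\<close>.\<close>

fun qcoeff :: "complex \<Rightarrow> nat \<Rightarrow> complex" where
  "qcoeff q 0 = 1"
| "qcoeff q (Suc n) = - (q ^ n / (1 - q ^ Suc n)) * qcoeff q n"

definition qpoch :: "complex \<Rightarrow> complex \<Rightarrow> complex" where
  "qpoch q w = (\<Sum>n. qcoeff q n * w ^ n)"

lemma qcoeff_summable:
  assumes "norm q < 1"
  shows "summable (\<lambda>n. qcoeff q n * w ^ n)"
proof -
  \<comment> \<open>The ratio of consecutive terms tends to 0 for every \<open>w\<close>, so the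
    radius of convergence is infinite.\<close>
  have "(\<lambda>n. q ^ n) \<longlonglongrightarrow> 0" using assms by (rule LIMSEQ_power_zero)
  moreover have "(\<lambda>n. q ^ Suc n) \<longlonglongrightarrow> 0" by (rule LIMSEQ_Suc) fact
  ultimately have "(\<lambda>n. norm (q ^ n / (1 - q ^ Suc n) * w)) \<longlonglongrightarrow> norm (0 / (1 - 0) * w)"
    using assms by (intro tendsto_intros) (auto simp del: power_Suc)
  then have "eventually (\<lambda>n. norm (q ^ n / (1 - q ^ Suc n) * w) < 1/2) sequentially"
    by (intro order_tendstoD) auto
  then obtain N where N: "\<And>n. n \<ge> N \<Longrightarrow> norm (q ^ n / (1 - q ^ Suc n) * w) < 1/2"
    by (auto simp: eventually_sequentially)
  show ?thesis
  proof (rule summable_ratio_test[where c = "1/2" and N = N])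
    fix n assume "n \<ge> N"
    have "norm (qcoeff q (Suc n) * w ^ Suc n) =
        norm (q ^ n / (1 - q ^ Suc n) * w) * norm (qcoeff q n * w ^ n)"
      by (simp add: norm_mult norm_divide norm_power)
    also have "\<dots> \<le> 1/2 * norm (qcoeff q n * w ^ n)"
      using N[OF \<open>n \<ge> N\<close>] by (intro mult_right_mono) auto
    finally show "norm (qcoeff q (Suc n) * w ^ Suc n) \<le> 1/2 * norm (qcoeff q n * w ^ n)" .
  qed auto
qed

lemma qpoch_holo:
  assumes "norm q < 1"
  shows "qpoch q holomorphic_on A"
proof -
  have "(qpoch q has_field_derivative (\<Sum>n. diffs (qcoeff q) n * x ^ n)) (at x)" for x
    unfolding qpoch_def
    by (rule termdiffs_strong_converges_everywhere) (rule qcoeff_summable[OF assms])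
  then have "qpoch q holomorphic_on UNIV" by (auto simp: holomorphic_on_open)
  then show ?thesis by (rule holomorphic_on_subset) auto
qed

lemma qpoch_0 [simp]: "qpoch q 0 = 1"
  using powser_zero[of "qcoeff q"] by (simp add: qpoch_def)

lemma norm_power_ne_1:
  assumes "norm (q::complex) < 1"
  shows "q ^ Suc n \<noteq> 1"
proof
  assume "q ^ Suc n = 1"
  then have "norm q ^ Suc n = 1" by (metis norm_one norm_power)
  moreover have "norm q ^ Suc n \<le> norm q" using assms power_decreasing[of 1 "Suc n" "norm q"] by simp
  ultimately show False using assms by simp
qed

text \<open>Replacing \<open>w\<close> by \<open>q * w\<close> multiplies the n-th coefficient by
  \<open>q ^ n\<close>, so the difference of both series has the factors \<open>1 - q ^ n\<close>,
  which cancel the denominators of \<open>qcoeff\<close> and shift the index by one.\<close>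

lemma qpoch_rec:
  assumes "norm q < 1"
  shows "qpoch q w = (1 - w) * qpoch q (q * w)"
proof -
  let ?f = "\<lambda>n. qcoeff q n * w ^ n - qcoeff q n * (q * w) ^ n"
  note s = qcoeff_summable[OF assms, of w] qcoeff_summable[OF assms, of "q * w"]
  have step: "?f (Suc n) = - w * (qcoeff q n * (q * w) ^ n)" for n
  proof -
    have "q ^ Suc n \<noteq> 1" by (rule norm_power_ne_1[OF assms])
    then have e: "1 - q ^ Suc n \<noteq> 0" by (simp del: power_Suc)
    have "?f (Suc n) = qcoeff q (Suc n) * (1 - q ^ Suc n) * w ^ Suc n"
      by (simp only: power_mult_distrib) (simp add: algebra_simps del: qcoeff.simps)
    also have "qcoeff q (Suc n) * (1 - q ^ Suc n) = - (q ^ n) * qcoeff q n"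
      using e by (simp del: power_Suc add: field_simps)
    finally show ?thesis by (simp add: power_mult_distrib)
  qed
  have "(\<lambda>n. ?f (Suc n)) sums (- w * qpoch q (q * w))"
    unfolding step qpoch_def by (intro sums_mult summable_sums s)
  then have "- w * qpoch q (q * w) = (\<Sum>n. ?f (Suc n))" by (rule sums_unique)
  also have "\<dots> = suminf ?f - ?f 0"
    by (rule suminf_split_head) (intro summable_diff s)
  also have "\<dots> = suminf ?f" by simp
  also have "\<dots> = qpoch q w - qpoch q (q * w)"
    unfolding qpoch_def by (rule suminf_diff[OF s, symmetric])
  finally show ?thesis by (simp add: algebra_simps)
qed

text \<open>If no factor \<open>1 - q ^ n * w\<close> vanished, the functional equation would carry
  the zero along the sequence \<open>q ^ n * w\<close>, which tends to 0, contradicting continuity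
  and the value 1 at 0.\<close>

lemma qpoch_eq_0:
  assumes "norm q < 1" "qpoch q w = 0"
  shows "\<exists>n. q ^ n * w = 1"
proof (rule ccontr)
  assume "\<nexists>n. q ^ n * w = 1"
  then have n: "1 - q ^ n * w \<noteq> 0" for n by auto
  have "qpoch q (q ^ n * w) = 0" for n
  proof (induction n)
    case (Suc n)
    then show ?case using qpoch_rec[OF assms(1), of "q ^ n * w"] n[of n] by (simp add: mult.assoc)
  qed (use assms in simp)
  moreover have "(\<lambda>n. qpoch q (q ^ n * w)) \<longlonglongrightarrow> qpoch q (0 * w)"
  proof (rule isCont_tendsto_compose[where g = "qpoch q"])
    show "isCont (qpoch q) (0 * w)"
      using holomorphic_on_imp_continuous_on[OF qpoch_holo[OF assms(1), of UNIV]]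
      by (simp add: continuous_on_eq_continuous_at)
    show "(\<lambda>n. q ^ n * w) \<longlonglongrightarrow> 0 * w"
      by (intro tendsto_intros LIMSEQ_power_zero assms)
  qed
  ultimately show False by (simp add: LIMSEQ_const_iff)
qed

subsection \<open>The theta function of the lattice\<close>

lemma lattice_iff: "z \<in> lattice \<tau> \<longleftrightarrow> (\<exists>m n. z = of_int m + of_int n * \<tau>)"
  by (auto simp: lattice_def)

lemma lattice_0 [simp]: "0 \<in> lattice \<tau>"
  unfolding lattice_iff by (rule exI[of _ 0], rule exI[of _ 0]) simp

lemma lattice_1 [simp]: "1 \<in> lattice \<tau>"
  unfolding lattice_iff by (rule exI[of _ 1], rule exI[of _ 0]) simp

lemma lattice_tau [simp]: "\<tau> \<in> lattice \<tau>"
  unfolding lattice_iff by (rule exI[of _ 0], rule exI[of _ 1]) simp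

lemma lattice_add: "a \<in> lattice \<tau> \<Longrightarrow> b \<in> lattice \<tau> \<Longrightarrow> a + b \<in> lattice \<tau>"
proof -
  assume "a \<in> lattice \<tau>" "b \<in> lattice \<tau>"
  then obtain m n m' n' where "a = of_int m + of_int n * \<tau>" "b = of_int m' + of_int n' * \<tau>"
    unfolding lattice_iff by blast
  then have "a + b = of_int (m + m') + of_int (n + n') * \<tau>" by (simp add: algebra_simps)
  then show ?thesis unfolding lattice_iff by blast
qed

lemma lattice_uminus: "a \<in> lattice \<tau> \<Longrightarrow> - a \<in> lattice \<tau>"
proof -
  assume "a \<in> lattice \<tau>"
  then obtain m n where "a = of_int m + of_int n * \<tau>"
    unfolding lattice_iff by blast
  then have "- a = of_int (- m) + of_int (- n) * \<tau>" by (simp add: algebra_simps)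
  then show ?thesis unfolding lattice_iff by blast
qed

lemma lattice_uminus_iff [simp]: "(- a) \<in> lattice \<tau> \<longleftrightarrow> a \<in> lattice \<tau>"
  using lattice_uminus[of a \<tau>] lattice_uminus[of "- a" \<tau>] by auto

lemma lattice_diff: "a \<in> lattice \<tau> \<Longrightarrow> b \<in> lattice \<tau> \<Longrightarrow> a - b \<in> lattice \<tau>"
  using lattice_add[of a \<tau> "- b"] by simp

lemma lattice_add_iff: "b \<in> lattice \<tau> \<Longrightarrow> a + b \<in> lattice \<tau> \<longleftrightarrow> a \<in> lattice \<tau>"
  using lattice_add[of a \<tau> b] lattice_diff[of "a + b" \<tau> b] by auto

lemma lattice_diff_iff: "b \<in> lattice \<tau> \<Longrightarrow> a - b \<in> lattice \<tau> \<longleftrightarrow> a \<in> lattice \<tau>"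
  using lattice_add_iff[of "- b" \<tau> a] by simp

text \<open>Equivalences instead of implications, because the integer coefficients of a lattice
  point may be negative.\<close>

lemma lattice_induct [consumes 1]:
  assumes "l \<in> lattice \<tau>" "P 0"
    and "\<And>z. P z \<longleftrightarrow> P (z + 1)" "\<And>z. P z \<longleftrightarrow> P (z + \<tau>)"
  shows "P l"
proof -
  have a: "P (of_int m)" for m
  proof (induction m rule: int_induct[where k = 0])
    case (step2 i)
    then show ?case using assms(3)[of "of_int (i - 1)"] by simp
  qed (use assms(2) assms(3) in auto)
  have "P (of_int m + of_int n * \<tau>)" for m n
  proof (induction n rule: int_induct[where k = 0])
    case (step1 i)
    then show ?case using assms(4)[of "of_int m + of_int i * \<tau>"] by (simp add: algebra_simps)
  next
    case (step2 i)
    then show ?case using assms(4)[of "of_int m + of_int (i - 1) * \<tau>"] by (simp add: algebra_simps)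
  qed (use a in auto)
  then show ?thesis using assms(1) unfolding lattice_iff by blast
qed

locale half_plane =
  fixes \<tau> :: complex
  assumes Im_pos: "Im \<tau> > 0"
begin

abbreviation "\<Lambda> \<equiv> lattice \<tau>"

definition nome :: complex where "nome = exp (2 * pi * \<i> * \<tau>)"

definition expi :: "complex \<Rightarrow> complex" where "expi z = exp (2 * pi * \<i> * z)"

text \<open>The Jacobi theta function up to an exponential and a constant factor, written as an
  infinite product in \<open>expi z\<close>.\<close>

definition theta :: "complex \<Rightarrow> complex" where
  "theta z = qpoch nome (expi z) * qpoch nome (nome / expi z)"

lemma norm_nome: "norm nome < 1"
  using Im_pos by (simp add: nome_def)

lemma expi_nz [simp]: "expi z \<noteq> 0" by (simp add: expi_def)
lemma nome_nz [simp]: "nome \<noteq> 0" by (simp add: nome_def)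

lemma expi_add: "expi (a + b) = expi a * expi b"
  by (simp add: expi_def ring_distribs exp_add)

lemma expi_minus: "expi (- a) = inverse (expi a)"
  by (simp add: expi_def exp_minus)

lemma expi_diff: "expi (a - b) = expi a / expi b"
  by (simp add: expi_def right_diff_distrib exp_diff)

lemma expi_1 [simp]: "expi 1 = 1"
  by (simp add: expi_def)

lemma expi_0 [simp]: "expi 0 = 1"
  by (simp add: expi_def)

lemma expi_tau: "expi \<tau> = nome"
  by (simp add: expi_def nome_def)

lemma expi_eq_1_iff: "expi z = 1 \<longleftrightarrow> z \<in> \<int>"
proof -
  have "expi z = 1 \<longleftrightarrow> (\<exists>n::int. 2 * pi * \<i> * z = of_int (2 * n) * pi * \<i>)"
    unfolding expi_def exp_eq_1[of "2 * pi * \<i> * z"]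
    by (auto simp: complex_eq_iff)
  also have "\<dots> \<longleftrightarrow> (\<exists>n::int. z = of_int n)"
    by (intro ex_cong1) (auto simp: field_simps)
  finally show ?thesis by (auto simp: Ints_def)
qed

lemma expi_holo [holomorphic_intros]: "f holomorphic_on A \<Longrightarrow> (\<lambda>z. expi (f z)) holomorphic_on A"
  unfolding expi_def by (intro holomorphic_intros)

lemma qpoch_compose_holo [holomorphic_intros]:
  "f holomorphic_on A \<Longrightarrow> (\<lambda>z. qpoch nome (f z)) holomorphic_on A"
  using holomorphic_on_compose[OF _ qpoch_holo[OF norm_nome], of f A] by (simp add: o_def)

lemma theta_holo [holomorphic_intros]: "f holomorphic_on A \<Longrightarrow> (\<lambda>z. theta (f z)) holomorphic_on A"
  unfolding theta_def by (intro holomorphic_intros) auto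

lemma theta_holo' [simp]: "theta holomorphic_on A"
  using theta_holo[of "\<lambda>z. z" A] by auto

lemma theta_plus_1: "theta (z + 1) = theta z"
  by (simp add: theta_def expi_add)

text \<open>With \<open>x = expi z\<close>, the shift removes the factor \<open>1 - x\<close> from
  the first Pochhammer function and adds the factor \<open>1 - 1 / x\<close> to the second; their
  quotient is \<open>- 1 / x\<close>.\<close>

lemma theta_plus_tau: "theta (z + \<tau>) = - theta z / expi z"
proof (cases "expi z = 1")
  case True
  then show ?thesis
    using qpoch_rec[OF norm_nome, of 1]
    by (simp add: theta_def expi_add expi_tau)
next
  case False
  have 1: "theta (z + \<tau>) = qpoch nome (nome * expi z) * qpoch nome (inverse (expi z))"
    by (simp add: theta_def expi_add expi_tau field_simps)
  have 2: "qpoch nome (inverse (expi z)) = (1 - 1 / expi z) * qpoch nome (nome / expi z)"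
    using qpoch_rec[OF norm_nome, of "inverse (expi z)"] by (simp add: field_simps)
  have 3: "theta z = (1 - expi z) * qpoch nome (nome * expi z) * qpoch nome (nome / expi z)"
    unfolding theta_def by (subst qpoch_rec[OF norm_nome, of "expi z"]) simp
  show ?thesis unfolding 1 2 3 by (simp add: field_simps)
qed

lemma theta_uminus: "theta (- z) = - theta z / expi z"
proof -
  have a: "theta z = (1 - expi z) * qpoch nome (nome * expi z) * qpoch nome (nome / expi z)"
    unfolding theta_def by (subst qpoch_rec[OF norm_nome, of "expi z"]) simp
  have "theta (- z) = qpoch nome (inverse (expi z)) * qpoch nome (nome * expi z)"
    by (simp add: theta_def expi_minus field_simps)
  also have "qpoch nome (inverse (expi z)) = (1 - 1 / expi z) * qpoch nome (nome / expi z)"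
    using qpoch_rec[OF norm_nome, of "inverse (expi z)"] by (simp add: field_simps)
  finally show ?thesis unfolding a by (simp add: field_simps)
qed

text \<open>Only the shape of the factor matters: it has no zeros, so zeros of \<open>theta\<close>
  and their orders are invariant under the whole lattice.\<close>

lemma theta_shift:
  assumes "l \<in> \<Lambda>"
  shows "\<exists>\<alpha> \<beta>. \<forall>z. theta (z + l) = exp (\<alpha> * z + \<beta>) * theta z"
proof -
  have t: "theta (z + \<tau>) = exp (- (2 * pi * \<i>) * z + pi * \<i>) * theta z" for z
    unfolding theta_plus_tau expi_def by (subst exp_add) (simp add: exp_minus divide_inverse)
  show ?thesis
    using assms
  proof (induction l rule: lattice_induct)
    case 1
    show ?case by (rule exI[of _ 0], rule exI[of _ 0]) simp
  next
    case (2 l)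
    show ?case by (simp add: theta_plus_1 flip: add.assoc)
  next
    case (3 l)
    have e: "theta (z + (l + \<tau>)) = exp (- (2 * pi * \<i>) * (z + l) + pi * \<i>) * theta (z + l)" for z
      using t[of "z + l"] by (simp add: add.assoc)
    show ?case
    proof
      assume "\<exists>\<alpha> \<beta>. \<forall>z. theta (z + l) = exp (\<alpha> * z + \<beta>) * theta z"
      then obtain \<alpha> \<beta> where ab: "\<And>z. theta (z + l) = exp (\<alpha> * z + \<beta>) * theta z" by blast
      have "theta (z + (l + \<tau>)) = exp ((\<alpha> - 2 * pi * \<i>) * z + (\<beta> - 2 * pi * \<i> * l + pi * \<i>)) * theta z" for z
        unfolding e ab mult.assoc[symmetric] exp_add[symmetric] by (simp add: algebra_simps)
      then show "\<exists>\<alpha> \<beta>. \<forall>z. theta (z + (l + \<tau>)) = exp (\<alpha> * z + \<beta>) * theta z" by blast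
    next
      assume "\<exists>\<alpha> \<beta>. \<forall>z. theta (z + (l + \<tau>)) = exp (\<alpha> * z + \<beta>) * theta z"
      then obtain \<alpha> \<beta> where ab: "\<And>z. theta (z + (l + \<tau>)) = exp (\<alpha> * z + \<beta>) * theta z" by blast
      have "theta (z + l) = exp ((\<alpha> + 2 * pi * \<i>) * z + (\<beta> + 2 * pi * \<i> * l - pi * \<i>)) * theta z" for z
      proof -
        have "theta (z + l) = exp (- (- (2 * pi * \<i>) * (z + l) + pi * \<i>)) * theta (z + (l + \<tau>))"
          unfolding e mult.assoc[symmetric] exp_add[symmetric] by simp
        then show ?thesis unfolding ab by (simp add: algebra_simps flip: exp_add)
      qed
      then show "\<exists>\<alpha> \<beta>. \<forall>z. theta (z + l) = exp (\<alpha> * z + \<beta>) * theta z" by blast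
    qed
  qed
qed

lemma theta_0 [simp]: "theta 0 = 0"
  using qpoch_rec[OF norm_nome, of 1] by (simp add: theta_def)

lemma nome_power: "nome ^ n = expi (of_nat n * \<tau>)"
  by (simp add: nome_def expi_def flip: exp_of_nat_mult) (simp add: algebra_simps)

lemma theta_eq_0_iff: "theta z = 0 \<longleftrightarrow> z \<in> \<Lambda>"
proof
  assume "z \<in> \<Lambda>"
  then obtain \<alpha> \<beta> where "\<And>w. theta (w + z) = exp (\<alpha> * w + \<beta>) * theta w"
    using theta_shift by blast
  from this[of 0] show "theta z = 0" by simp
next
  assume "theta z = 0"
  then consider "qpoch nome (expi z) = 0" | "qpoch nome (nome / expi z) = 0"
    by (auto simp: theta_def)
  then obtain n :: int where "expi (of_int n * \<tau> + z) = 1"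
  proof cases
    case 1
    then obtain n where "nome ^ n * expi z = 1" using qpoch_eq_0[OF norm_nome] by blast
    then show ?thesis using that[of "int n"] by (simp add: nome_power expi_add)
  next
    case 2
    then obtain n where "nome ^ n * (nome / expi z) = 1" using qpoch_eq_0[OF norm_nome] by blast
    then have "nome ^ Suc n = expi z" by (simp add: field_simps)
    then have "expi (of_nat (Suc n) * \<tau>) = expi z" unfolding nome_power .
    moreover have "of_int (- int (Suc n)) * \<tau> + z = z - of_nat (Suc n) * \<tau>"
      by (simp add: algebra_simps)
    ultimately have "expi (of_int (- int (Suc n)) * \<tau> + z) = 1"
      by (simp only: expi_diff) simp
    then show ?thesis using that by blast
  qed
  then have "of_int n * \<tau> + z \<in> \<int>" by (simp add: expi_eq_1_iff)
  then obtain m where "of_int n * \<tau> + z = of_int m" by (auto simp: Ints_def)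
  then have "z = of_int m + of_int (- n) * \<tau>" by (simp add: algebra_simps)
  then show "z \<in> \<Lambda>" unfolding lattice_iff by blast
qed

text \<open>The factor \<open>1 - expi z\<close> splits off with its simple zero. The cofactor at 0
  is the square of \<open>qpoch nome nome\<close>, nonzero because no positive power of the nome is
  1.\<close>

lemma deriv_theta_0: "deriv theta 0 \<noteq> 0"
proof -
  let ?H = "\<lambda>z. qpoch nome (nome * expi z) * qpoch nome (nome / expi z)"
  have "?H holomorphic_on UNIV" by (intro holomorphic_intros) auto
  then obtain H' where "(?H has_field_derivative H') (at 0)"
    by (auto simp: holomorphic_on_open)
  moreover have "((\<lambda>z. 1 - expi z) has_field_derivative (- (2 * pi * \<i>))) (at 0)"
    unfolding expi_def by (auto intro!: derivative_eq_intros)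
  ultimately have "((\<lambda>z. (1 - expi z) * ?H z) has_field_derivative - (2 * pi * \<i>) * ?H 0) (at 0)"
    using DERIV_mult[of "\<lambda>z. 1 - expi z" "- (2 * pi * \<i>)" 0 UNIV ?H H'] by simp
  moreover have "(\<lambda>z. (1 - expi z) * ?H z) = theta"
    unfolding theta_def by (subst (3) qpoch_rec[OF norm_nome]) (simp add: mult.assoc)
  ultimately have d: "deriv theta 0 = - (2 * pi * \<i>) * (qpoch nome nome)\<^sup>2"
    by (simp add: DERIV_imp_deriv power2_eq_square)
  have "qpoch nome nome \<noteq> 0"
    using qpoch_eq_0[OF norm_nome, of nome] norm_power_ne_1[OF norm_nome] by (auto simp: mult.commute)
  then show ?thesis using d by simp
qed

lemma zorder_theta_0: "zorder theta 0 = 1"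
  by (rule zorder_zero_eqI[where S = UNIV]) (use deriv_theta_0 in auto)

lemma zorder_theta:
  "zorder theta z = (if z \<in> \<Lambda> then 1 else 0)"
proof (cases "z \<in> \<Lambda>")
  case True
  then obtain \<alpha> \<beta> where ab: "\<And>w. theta (w + z) = exp (\<alpha> * w + \<beta>) * theta w"
    using theta_shift by blast
  have "zorder theta z = zorder (\<lambda>w. theta (w + z)) 0" by (rule zorder_shift)
  also have "\<dots> = zorder (\<lambda>w. exp (\<alpha> * w + \<beta>) * theta w) 0" by (simp add: ab)
  also have "\<dots> = zorder (\<lambda>w. exp (\<alpha> * w + \<beta>)) 0 + zorder theta 0"
  proof (rule zorder_mult)
    have 1: "eventually (\<lambda>w. theta w \<noteq> 0) (at 0)"
    proof -
      have "theta holomorphic_on UNIV" by simp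
      moreover obtain w where "theta w \<noteq> 0"
      proof -
        have "(\<tau> / 2) \<notin> \<Lambda>"
        proof
          assume "\<tau> / 2 \<in> \<Lambda>"
          then obtain m n where "\<tau> / 2 = of_int m + of_int n * \<tau>" unfolding lattice_iff by blast
          then have "Im (\<tau> / 2) = Im (of_int m + of_int n * \<tau>)" by (rule arg_cong)
          then have "Im \<tau> * (1 - 2 * of_int n) = 0" by (simp add: algebra_simps)
          then have "(2 * of_int n :: real) = 1" using Im_pos by simp
          then have "of_int (2 * n) = (of_int 1 :: real)" by simp
          then have "2 * n = 1" by (simp only: of_int_eq_iff)
          then show False by presburger
        qed
        then show ?thesis using that theta_eq_0_iff by blast
      qed
      ultimately show ?thesis
        using non_zero_neighbour_alt[of theta UNIV 0 w] by (auto elim: eventually_mono)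
    qed
    then show "frequently (\<lambda>w. theta w \<noteq> 0) (at 0)" by (intro eventually_frequently) auto
    show "theta meromorphic_on {0}" by (intro mero_at holo_mero) simp
    show "(\<lambda>w. exp (\<alpha> * w + \<beta>)) meromorphic_on {0}"
      by (intro mero_at holo_mero holomorphic_intros)
    show "frequently (\<lambda>w. exp (\<alpha> * w + \<beta>) \<noteq> 0) (at 0)" by simp
  qed
  also have "zorder (\<lambda>w. exp (\<alpha> * w + \<beta>)) 0 = 0"
    by (rule zorder_zero_eqI[where S = UNIV]) (auto intro!: holomorphic_intros)
  finally show ?thesis using True by (simp add: zorder_theta_0)
next
  case False
  then have "theta z \<noteq> 0" by (simp add: theta_eq_0_iff)
  then have "zorder theta z = 0"
    by (intro zorder_zero_eqI[where S = UNIV]) auto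
  then show ?thesis using False by simp
qed

end

subsection \<open>Elliptic functions\<close>

lemma entire_eqI:
  assumes "f holomorphic_on UNIV" "g holomorphic_on UNIV"
    and "eventually (\<lambda>z. f z = g z) (cosparse UNIV)"
  shows "f z = g z"
proof (rule tendsto_unique)
  show "f \<midarrow>z\<rightarrow> f z"
    using holomorphic_on_imp_continuous_on[OF assms(1)] by (simp add: continuous_on_def)
  have "g \<midarrow>z\<rightarrow> g z"
    using holomorphic_on_imp_continuous_on[OF assms(2)] by (simp add: continuous_on_def)
  then show "f \<midarrow>z\<rightarrow> g z"
    by (rule Lim_transform_eventually)
       (use cosparse_at[OF assms(3), of z] in eventually_elim, simp)
qed simp

lemma entire_extension:
  assumes "f meromorphic_on UNIV" "\<And>z. \<not> is_pole f z"
  obtains g where "g holomorphic_on UNIV" "eventually (\<lambda>z. f z = g z) (cosparse UNIV)"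
proof
  have ev: "eventually (\<lambda>z. remove_sings f z = f z) (cosparse UNIV)"
    unfolding cosparse_UNIV_iff
    by (intro allI eventually_remove_sings_eq_at mero_iso assms)
  then show "eventually (\<lambda>z. f z = remove_sings f z) (cosparse UNIV)"
    by (auto elim: eventually_mono)
  have "\<not> is_pole (remove_sings f) z" for z
    using assms(2)[of z] is_pole_cong[OF cosparse_at[OF ev, of z] refl] by simp
  then have "remove_sings f analytic_on UNIV"
    by (intro nicely_meromorphic_without_singularities remove_sings_nicely_meromorphic assms) auto
  then show "remove_sings f holomorphic_on UNIV" by (simp add: analytic_on_open)
qed

text \<open>A punctured neighbourhood is open, so agreement there passes to derivatives at each of
  its points.\<close>

lemma mero_deriv_cong:
  fixes f g :: "complex \<Rightarrow> complex"
  assumes "eventually (\<lambda>z. f z = g z) (cosparse UNIV)"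
  shows "eventually (\<lambda>z. deriv f z = deriv g z) (cosparse UNIV)"
  unfolding cosparse_UNIV_iff
proof
  fix z
  have "eventually (\<lambda>w. f w = g w) (at z)" by (rule cosparse_at[OF assms])
  then obtain S where S: "open S" "z \<in> S" "\<And>w. w \<in> S \<Longrightarrow> w \<noteq> z \<Longrightarrow> f w = g w"
    unfolding eventually_at_topological by blast
  have "deriv f w = deriv g w" if "w \<in> S - {z}" for w
  proof (rule deriv_cong_ev)
    show "eventually (\<lambda>v. f v = g v) (nhds w)"
      using S that by (intro eventually_mono[OF eventually_nhds_in_open[of "S - {z}"]]) auto
  qed simp
  then show "eventually (\<lambda>w. deriv f w = deriv g w) (at z)"
    unfolding eventually_at_topological using S by (intro exI[of _ S]) auto
qed

lemma deriv_shift: "deriv (\<lambda>z. f (z + c)) z = deriv f (z + c)"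
  by (simp add: deriv_def DERIV_shift)

context half_plane
begin

abbreviation "ell \<equiv> elliptic_fun \<tau>"

lemma ell_iff: "ell f \<longleftrightarrow> f meromorphic_on UNIV \<and>
    eventually (\<lambda>w. f (w + 1) = f w) (cosparse UNIV) \<and> eventually (\<lambda>w. f (w + \<tau>) = f w) (cosparse UNIV)"
  unfolding elliptic_fun_def cosparse_UNIV_iff by (auto simp: eventually_conj_iff)

lemma ell_mero: "ell f \<Longrightarrow> f meromorphic_on UNIV"
  by (simp add: ell_iff)

lemma ell_const [simp]: "ell (\<lambda>z. c)"
  by (simp add: ell_iff meromorphic_on_const)

lemma ell_binop:
  assumes "ell f" "ell g" "(\<lambda>z. h (f z) (g z)) meromorphic_on UNIV"
  shows "ell (\<lambda>z. h (f z) (g z))"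
proof -
  have "eventually (\<lambda>w. h (f (w + c)) (g (w + c)) = h (f w) (g w)) (cosparse UNIV)"
    if "eventually (\<lambda>w. f (w + c) = f w) (cosparse UNIV)"
       "eventually (\<lambda>w. g (w + c) = g w) (cosparse UNIV)" for c
    using that by eventually_elim simp
  then show ?thesis using assms unfolding ell_iff by blast
qed

lemma ell_add: "ell f \<Longrightarrow> ell g \<Longrightarrow> ell (\<lambda>z. f z + g z)"
  by (intro ell_binop[where h = "(+)"] meromorphic_intros ell_mero)
lemma ell_diff: "ell f \<Longrightarrow> ell g \<Longrightarrow> ell (\<lambda>z. f z - g z)"
  by (intro ell_binop[where h = "(-)"] meromorphic_intros ell_mero)
lemma ell_mult: "ell f \<Longrightarrow> ell g \<Longrightarrow> ell (\<lambda>z. f z * g z)"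
  by (intro ell_binop[where h = "(*)"] meromorphic_intros ell_mero)
lemma ell_divide: "ell f \<Longrightarrow> ell g \<Longrightarrow> ell (\<lambda>z. f z / g z)"
  by (intro ell_binop[where h = "(/)"] meromorphic_intros ell_mero)
lemma ell_power: "ell f \<Longrightarrow> ell (\<lambda>z. f z ^ n)"
  by (intro ell_binop[where h = "\<lambda>a b. a ^ n" and g = f] meromorphic_intros ell_mero)

lemmas ell_intros = ell_const ell_add ell_diff ell_mult ell_divide ell_power

lemma ell_cong:
  assumes "ell f" "eventually (\<lambda>z. f z = g z) (cosparse UNIV)"
  shows "ell g"
proof -
  have s: "eventually (\<lambda>z. f (z + c) = g (z + c)) (cosparse UNIV)" for c
    by (rule cosparse_shift[OF assms(2)])
  have "g meromorphic_on UNIV"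
    using ell_mero[OF assms(1)] meromorphic_on_cong'[OF assms(2) refl] by simp
  moreover have "eventually (\<lambda>w. g (w + c) = g w) (cosparse UNIV)"
    if "eventually (\<lambda>w. f (w + c) = f w) (cosparse UNIV)" for c
    using that s[of c] assms(2) by eventually_elim auto
  ultimately show ?thesis using assms(1) unfolding ell_iff by blast
qed

lemma ell_deriv: "ell f \<Longrightarrow> ell (deriv f)"
  unfolding ell_iff
proof (intro conjI)
  assume f: "f meromorphic_on UNIV \<and> (\<forall>\<^sub>\<approx>w. f (w + 1) = f w) \<and> (\<forall>\<^sub>\<approx>w. f (w + \<tau>) = f w)"
  then show "deriv f meromorphic_on UNIV" by (intro meromorphic_intros) auto
  show "\<forall>\<^sub>\<approx>w. deriv f (w + 1) = deriv f w" "\<forall>\<^sub>\<approx>w. deriv f (w + \<tau>) = deriv f w"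
    using f mero_deriv_cong[of "\<lambda>w. f (w + 1)" f] mero_deriv_cong[of "\<lambda>w. f (w + \<tau>)" f]
    by (auto simp: deriv_shift)
qed

lemma ell_periodic:
  assumes "ell f" "l \<in> \<Lambda>"
  shows "eventually (\<lambda>w. f (w + l) = f w) (cosparse UNIV)"
  using assms(2)
proof (induction l rule: lattice_induct)
  case (2 l)
  have "eventually (\<lambda>w. f (w + l + 1) = f (w + l)) (cosparse UNIV)"
    using assms(1) unfolding ell_iff by (intro cosparse_shift) auto
  then have e: "eventually (\<lambda>w. f (w + (l + 1)) = f (w + l)) (cosparse UNIV)"
    by (simp add: add.assoc)
  show ?case
  proof
    assume "eventually (\<lambda>w. f (w + l) = f w) (cosparse UNIV)"
    with e show "eventually (\<lambda>w. f (w + (l + 1)) = f w) (cosparse UNIV)"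
      by eventually_elim simp
  next
    assume "eventually (\<lambda>w. f (w + (l + 1)) = f w) (cosparse UNIV)"
    with e show "eventually (\<lambda>w. f (w + l) = f w) (cosparse UNIV)"
      by eventually_elim simp
  qed
next
  case (3 l)
  have "eventually (\<lambda>w. f (w + l + \<tau>) = f (w + l)) (cosparse UNIV)"
    using assms(1) unfolding ell_iff by (intro cosparse_shift) auto
  then have e: "eventually (\<lambda>w. f (w + (l + \<tau>)) = f (w + l)) (cosparse UNIV)"
    by (simp add: add.assoc)
  show ?case
  proof
    assume "eventually (\<lambda>w. f (w + l) = f w) (cosparse UNIV)"
    with e show "eventually (\<lambda>w. f (w + (l + \<tau>)) = f w) (cosparse UNIV)"
      by eventually_elim simp
  next
    assume "eventually (\<lambda>w. f (w + (l + \<tau>)) = f w) (cosparse UNIV)"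
    with e show "eventually (\<lambda>w. f (w + l) = f w) (cosparse UNIV)"
      by eventually_elim simp
  qed
qed simp

lemma ell_zorder_shift:
  assumes "ell f" "l \<in> \<Lambda>"
  shows "zorder f (z + l) = zorder f z"
proof -
  have "zorder f (z + l) = zorder (\<lambda>u. f (u + (z + l))) 0" by (rule zorder_shift)
  also have "\<dots> = zorder (\<lambda>u. f (u + z)) 0"
    using cosparse_at[OF cosparse_shift[OF ell_periodic[OF assms], of z], of 0]
    by (intro zorder_cong) (auto simp: add.assoc)
  also have "\<dots> = zorder f z" by (rule zorder_shift[symmetric])
  finally show ?thesis .
qed

lemma ell_pole_shift:
  assumes "ell f" "l \<in> \<Lambda>"
  shows "is_pole f (z + l) \<longleftrightarrow> is_pole f z"
proof -
  have "is_pole f (z + l) \<longleftrightarrow> is_pole (\<lambda>u. f (z + l + u)) 0" by (rule is_pole_shift_0)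
  also have "\<dots> \<longleftrightarrow> is_pole (\<lambda>u. f (z + u)) 0"
    using cosparse_at[OF cosparse_shift[OF ell_periodic[OF assms], of z], of 0]
    by (intro is_pole_cong) (auto simp: add_ac)
  also have "\<dots> \<longleftrightarrow> is_pole f z" by (rule is_pole_shift_0[symmetric])
  finally show ?thesis .
qed

text \<open>Compact, unlike \<open>fund_par\<close>: this gives boundedness for Liouville's theorem
  and finiteness of divisors.\<close>

definition fund_closure :: "complex set" where
  "fund_closure = (\<lambda>(s, t). complex_of_real s + complex_of_real t * \<tau>) ` ({0..1} \<times> {0..1})"

lemma compact_fund_closure: "compact fund_closure"
  unfolding fund_closure_def
  by (intro compact_continuous_image compact_Times)
     (auto simp: case_prod_unfold intro!: continuous_intros)

lemma fund_par_subset: "fund_par \<tau> \<subseteq> fund_closure"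
  unfolding fund_par_def fund_closure_def by force

lemma fund_par_0 [simp]: "0 \<in> fund_par \<tau>"
  unfolding fund_par_def by (intro CollectI exI[of _ 0]) auto

lemma fund_par_exists:
  obtains p where "p \<in> fund_par \<tau>" "z - p \<in> \<Lambda>"
proof
  define t where "t = Im z / Im \<tau>"
  define s where "s = Re z - t * Re \<tau>"
  define p where "p = complex_of_real (frac s) + complex_of_real (frac t) * \<tau>"
  have z: "z = complex_of_real s + complex_of_real t * \<tau>"
    using Im_pos by (simp add: complex_eq_iff s_def t_def)
  show "p \<in> fund_par \<tau>"
    unfolding fund_par_def p_def
    by (intro CollectI exI[of _ "frac s"] exI[of _ "frac t"]) (auto simp: frac_lt_1)
  have "z - p = of_int \<lfloor>s\<rfloor> + of_int \<lfloor>t\<rfloor> * \<tau>"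
    unfolding p_def frac_def by (subst z) (simp add: algebra_simps)
  then show "z - p \<in> \<Lambda>" unfolding lattice_iff by blast
qed

lemma fund_par_unique:
  assumes "p \<in> fund_par \<tau>" "p' \<in> fund_par \<tau>" "p - p' \<in> \<Lambda>"
  shows "p = p'"
proof -
  obtain s t s' t' where
    p: "p = complex_of_real s + complex_of_real t * \<tau>" "0 \<le> s" "s < 1" "0 \<le> t" "t < 1" and
    p': "p' = complex_of_real s' + complex_of_real t' * \<tau>" "0 \<le> s'" "s' < 1" "0 \<le> t'" "t' < 1"
    using assms unfolding fund_par_def by blast
  obtain m n where mn: "p - p' = of_int m + of_int n * \<tau>" using assms unfolding lattice_iff by blast
  have "Im (p - p') = Im (of_int m + of_int n * \<tau>)" using mn by (rule arg_cong)
  then have "(t - t' - of_int n) * Im \<tau> = 0" by (simp add: p p' algebra_simps)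
  then have t: "t - t' = of_int n" using Im_pos by simp
  have "Re (p - p') = Re (of_int m + of_int n * \<tau>)" using mn by (rule arg_cong)
  then have "(s - s' - of_int m) + (t - t' - of_int n) * Re \<tau> = 0" by (simp add: p p' algebra_simps)
  then have s: "s - s' = of_int m" using t by simp
  have "\<bar>of_int n :: real\<bar> < 1" "\<bar>of_int m :: real\<bar> < 1" using s t p p' by linarith+
  then have "n = 0" "m = 0" by linarith+
  then show ?thesis using s t by (simp add: p p')
qed

lemma entire_periodic_const:
  assumes "g holomorphic_on UNIV" "\<And>z. g (z + 1) = g z" "\<And>z. g (z + \<tau>) = g z"
  shows "\<exists>c. \<forall>z. g z = c"
proof -
  have per: "g (z + l) = g z" if "l \<in> \<Lambda>" for l z
    using that
  proof (induction l rule: lattice_induct)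
    case (2 l)
    then show ?case using assms(2)[of "z + l"] by (simp add: add.assoc)
  next
    case (3 l)
    then show ?case using assms(3)[of "z + l"] by (simp add: add.assoc)
  qed simp
  have "bounded (g ` fund_closure)"
    by (intro compact_imp_bounded compact_continuous_image compact_fund_closure
        holomorphic_on_imp_continuous_on holomorphic_on_subset[OF assms(1)]) auto
  moreover have "range g \<subseteq> g ` fund_closure"
  proof safe
    fix z
    obtain p where "p \<in> fund_par \<tau>" "z - p \<in> \<Lambda>" by (rule fund_par_exists)
    then show "g z \<in> g ` fund_closure" using per[of "z - p" p] fund_par_subset by auto
  qed
  ultimately have "bounded (range g)" by (rule bounded_subset)
  then have "g constant_on UNIV" by (rule Liouville_theorem[OF assms(1)])
  then show ?thesis by (auto simp: constant_on_def)
qed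

text \<open>The derivative is entire and doubly periodic, hence constant, so \<open>g\<close> is
  affine; the period 1 kills its slope. This stands in for residue arguments: it is what forces
  degree 0 of divisors and excludes a single simple pole.\<close>

lemma entire_quasi_periodic:
  assumes g: "g holomorphic_on UNIV" and 1: "\<And>z. g (z + 1) = g z" and t: "\<And>z. g (z + \<tau>) = g z + c"
  shows "c = 0 \<and> (\<exists>a. \<forall>z. g z = a)"
proof -
  have gd: "(g has_field_derivative deriv g z) (at z)" for z
    using g by (auto intro: holomorphic_derivI)
  have "deriv g (z + 1) = deriv g z" for z
    using deriv_shift[of g 1 z] by (simp add: 1)
  moreover have "deriv g (z + \<tau>) = deriv g z" for z
    using deriv_shift[of g \<tau> z] DERIV_imp_deriv[OF DERIV_add[OF gd[of z] DERIV_const[of c]]]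
    by (simp add: t)
  ultimately obtain a where a: "\<And>z. deriv g z = a"
    using entire_periodic_const[of "deriv g"] g by (auto intro: holomorphic_deriv)
  have "((\<lambda>z. g z - a * z) has_field_derivative 0) (at z)" for z
    using DERIV_diff[OF gd[of z] DERIV_cmult_Id[of a]] by (simp add: a)
  then have "\<exists>b. \<forall>z. g z - a * z = b"
    using has_field_derivative_zero_constant[of UNIV "\<lambda>z. g z - a * z"] by simp
  then obtain b where b: "\<And>z. g z - a * z = b" by blast
  then have b: "g z = a * z + b" for z by (metis add.commute diff_add_cancel)
  have "a = 0" using 1[of 0] b by simp
  then show ?thesis using b t[of 0] by simp
qed

lemma ell_no_pole_const:
  assumes "ell f" "\<And>z. \<not> is_pole f z"
  shows "\<exists>c. eventually (\<lambda>z. f z = c) (cosparse UNIV)"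
proof -
  obtain g where g: "g holomorphic_on UNIV" "eventually (\<lambda>z. f z = g z) (cosparse UNIV)"
    using entire_extension[OF ell_mero[OF assms(1)] assms(2)] .
  have "ell g" by (rule ell_cong[OF assms(1) g(2)])
  have per: "g (z + l) = g z" if "l \<in> \<Lambda>" for z l
  proof (rule entire_eqI[where f = "\<lambda>z. g (z + l)" and g = g])
    show "(\<lambda>z. g (z + l)) holomorphic_on UNIV"
      by (intro holomorphic_on_compose_gen[of "\<lambda>z. z + l" UNIV g UNIV, unfolded o_def]
          holomorphic_intros g) auto
  qed (use g ell_periodic[OF \<open>ell g\<close> that] in auto)
  then obtain c where "\<And>z. g z = c" using entire_periodic_const[of g] g(1) by auto
  then show ?thesis using g(2) by auto
qed

lemma ell_zero_set_finite:
  assumes "ell f" "eventually (\<lambda>z. f z \<noteq> 0) (cosparse UNIV)"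
  shows "finite {p \<in> fund_par \<tau>. zorder f p \<noteq> 0}"
proof -
  have z0: "zorder f z = 0" if "f analytic_on {z}" "f z \<noteq> 0" for z
    using that by (intro zorder_zero_eqI') auto
  have "eventually (\<lambda>z. zorder f z = 0) (cosparse UNIV)"
    using analytic_cosparse[OF ell_mero[OF assms(1)]] assms(2)
    by eventually_elim (rule z0)
  then have "{z. zorder f z \<noteq> 0} sparse_in UNIV" by (simp add: eventually_cosparse)
  then have "{z. zorder f z \<noteq> 0} sparse_in fund_closure" by (rule sparse_in_subset) auto
  then have "finite (fund_closure \<inter> {z. zorder f z \<noteq> 0})"
    by (rule sparse_in_compact_finite[OF _ compact_fund_closure])
  then show ?thesis by (rule rev_finite_subset) (use fund_par_subset in auto)
qed

lemma theta_nz_cosparse: "eventually (\<lambda>z. theta (z - p) \<noteq> 0) (cosparse UNIV)"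
proof -
  have "\<not> eventually (\<lambda>z. theta z = 0) (cosparse UNIV)"
  proof
    assume "eventually (\<lambda>z. theta z = 0) (cosparse UNIV)"
    then have "theta z = 0" for z
      using entire_eqI[of theta "\<lambda>_. 0" z] by simp
    then have "\<Lambda> = UNIV" using theta_eq_0_iff by auto
    then have "1 / 2 \<in> \<Lambda>" by simp
    moreover have "complex_of_real (1/2) + complex_of_real 0 * \<tau> \<in> fund_par \<tau>"
      unfolding fund_par_def by (intro CollectI exI[of _ "1/2"] exI[of _ 0]) auto
    ultimately show False using fund_par_unique[of "1/2" 0] by simp
  qed
  then have "eventually (\<lambda>z. theta z \<noteq> 0) (cosparse UNIV)"
    using cosparse_mero_cases[OF holo_mero[OF theta_holo'], of 0] by auto
  then show ?thesis using cosparse_shift[of "\<lambda>z. theta z \<noteq> 0" "- p"] by simp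
qed

lemma zorder_theta_shift: "zorder (\<lambda>z. theta (z - p)) z = (if z - p \<in> \<Lambda> then 1 else 0)"
proof -
  have "zorder (\<lambda>z. theta (z - p)) z = zorder (\<lambda>u. theta (u + (z - p))) 0"
    by (subst zorder_shift) (simp add: algebra_simps)
  also have "\<dots> = zorder theta (z - p)" by (rule zorder_shift[symmetric])
  finally show ?thesis by (simp add: zorder_theta)
qed

end

section \<open>Theta products and divisors of elliptic functions\<close>

context half_plane
begin

lemma theta_plus_tau_exp: "theta (z + \<tau>) = exp (- (2 * pi * \<i>) * z + pi * \<i>) * theta z"
  unfolding theta_plus_tau expi_def by (subst exp_add) (simp add: exp_minus divide_inverse)

text \<open>A function with prescribed orders modulo the lattice. It is quasi-periodic only, since
  nothing is assumed about the degree or the sum of the divisor.\<close>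

definition theta_prod :: "complex set \<Rightarrow> (complex \<Rightarrow> int) \<Rightarrow> complex \<Rightarrow> complex" where
  "theta_prod A m z = (\<Prod>p\<in>A. theta (z - p) powi m p)"

lemma theta_shift_mero: "(\<lambda>z. theta (z - p)) meromorphic_on UNIV"
  by (intro holo_mero holomorphic_intros)

lemma theta_prod_mero: "theta_prod A m meromorphic_on UNIV"
  unfolding theta_prod_def by (intro meromorphic_intros theta_shift_mero)

lemma theta_prod_nz:
  assumes "finite A"
  shows "eventually (\<lambda>z. theta_prod A m z \<noteq> 0) (cosparse UNIV)"
proof -
  have "eventually (\<lambda>z. \<forall>p\<in>A. theta (z - p) \<noteq> 0) (cosparse UNIV)"
    using assms by (intro eventually_ball_finite ballI theta_nz_cosparse)
  then show ?thesis by eventually_elim (auto simp: theta_prod_def assms)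
qed

lemma theta_prod_plus_1: "theta_prod A m (z + 1) = theta_prod A m z"
proof -
  have "theta (z + 1 - p) = theta (z - p)" for p
    using theta_plus_1[of "z - p"] by (simp add: algebra_simps)
  then show ?thesis by (simp add: theta_prod_def)
qed

text \<open>The part of the multiplier that depends on \<open>z\<close> sees only the degree of the
  divisor; in degree 0 the multiplier is a constant.\<close>

lemma theta_prod_plus_tau:
  assumes "finite A"
  shows "\<exists>b. \<forall>z. theta_prod A m (z + \<tau>) = exp (- (2 * pi * \<i>) * of_int (\<Sum>p\<in>A. m p) * z + b) * theta_prod A m z"
proof -
  have th: "theta (z + \<tau> - p) powi m p = exp (of_int (m p) * (- (2 * pi * \<i>) * (z - p) + pi * \<i>)) * theta (z - p) powi m p" for z p
  proof -
    have "theta (z + \<tau> - p) = exp (- (2 * pi * \<i>) * (z - p) + pi * \<i>) * theta (z - p)"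
      using theta_plus_tau_exp[of "z - p"] by (simp add: algebra_simps)
    then show ?thesis by (simp only: power_int_mult_distrib exp_power_int)
  qed
  define b where "b = (\<Sum>p\<in>A. of_int (m p) * (2 * pi * \<i> * p + pi * \<i>))"
  have "theta_prod A m (z + \<tau>) = exp (- (2 * pi * \<i>) * of_int (\<Sum>p\<in>A. m p) * z + b) * theta_prod A m z" for z
  proof -
    have "theta_prod A m (z + \<tau>) =
        exp (\<Sum>p\<in>A. of_int (m p) * (- (2 * pi * \<i>) * (z - p) + pi * \<i>)) * theta_prod A m z"
      unfolding theta_prod_def th prod.distrib exp_sum[OF assms] ..
    also have "(\<Sum>p\<in>A. of_int (m p) * (- (2 * pi * \<i>) * (z - p) + pi * \<i>)) =
        - (2 * pi * \<i>) * of_int (\<Sum>p\<in>A. m p) * z + b"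
      unfolding b_def of_int_sum sum_distrib_left sum_distrib_right sum.distrib[symmetric]
      by (intro sum.cong) (simp_all add: algebra_simps)
    finally show ?thesis .
  qed
  then show ?thesis by blast
qed

lemma zorder_theta_prod:
  assumes "finite A"
  shows "zorder (theta_prod A m) z = (\<Sum>p\<in>A. if z - p \<in> \<Lambda> then m p else 0)"
proof -
  have "zorder (theta_prod A m) z = (\<Sum>p\<in>A. zorder (\<lambda>z. theta (z - p) powi m p) z)"
    unfolding theta_prod_def
    by (rule zorder_prod)
       (use cosparse_at[OF theta_prod_nz[OF assms, of m], of z] in
         \<open>auto intro!: meromorphic_intros mero_at[OF theta_shift_mero] simp: theta_prod_def\<close>)
  also have "\<dots> = (\<Sum>p\<in>A. if z - p \<in> \<Lambda> then m p else 0)"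
    by (intro sum.cong refl)
       (simp add: zorder_power_int mero_at[OF theta_shift_mero]
          cosparse_frequently[OF theta_nz_cosparse] zorder_theta_shift)
  finally show ?thesis .
qed

abbreviation "divisor f \<equiv> {p \<in> fund_par \<tau>. zorder f p \<noteq> 0}"

text \<open>Dividing out theta factors leaves a zero-free entire function whose logarithmic derivative
  is constant: it has period 1, and its increment under the period \<open>\<tau>\<close> is \<open>2 \<pi> i\<close> times the degree
  of the divisor, which must therefore vanish.\<close>

theorem ell_factorization:
  assumes f: "ell f" and nz: "eventually (\<lambda>z. f z \<noteq> 0) (cosparse UNIV)"
  shows "(\<Sum>p\<in>divisor f. zorder f p) = 0"
    and "\<exists>A \<alpha>. A \<noteq> 0 \<and> eventually (\<lambda>z. f z = A * exp (\<alpha> * z) * theta_prod (divisor f) (zorder f) z) (cosparse UNIV)"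
proof -
  let ?D = "divisor f"
  define P where "P = theta_prod ?D (zorder f)"
  define N where "N = (\<Sum>p\<in>?D. zorder f p)"
  have fin: "finite ?D" by (rule ell_zero_set_finite[OF assms])
  have P: "P meromorphic_on UNIV" "eventually (\<lambda>z. P z \<noteq> 0) (cosparse UNIV)"
    unfolding P_def by (rule theta_prod_mero, rule theta_prod_nz[OF fin])
  \<comment> \<open>Exactly one point of the parallelogram is congruent to \<open>z\<close>, so the
    product has the order of \<open>f\<close> at every point of the plane.\<close>
  have zP: "zorder P z = zorder f z" for z
  proof -
    obtain p0 where p0: "p0 \<in> fund_par \<tau>" "z - p0 \<in> \<Lambda>" by (rule fund_par_exists)
    have "z - p \<in> \<Lambda> \<longleftrightarrow> p = p0" if "p \<in> fund_par \<tau>" for p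
    proof
      assume "z - p \<in> \<Lambda>"
      then have "p0 - p \<in> \<Lambda>" using lattice_diff[OF _ p0(2), of "z - p"] by simp
      then show "p = p0" using fund_par_unique[OF p0(1) that] by simp
    qed (use p0 in auto)
    then have "zorder P z = (\<Sum>p\<in>?D. if p = p0 then zorder f p else 0)"
      unfolding P_def zorder_theta_prod[OF fin] by (intro sum.cong) auto
    also have "\<dots> = zorder f p0" using fin p0 by (simp add: sum.delta)
    also have "\<dots> = zorder f z" using ell_zorder_shift[OF f p0(2), of p0] by simp
    finally show ?thesis .
  qed
  define E where "E = (\<lambda>z. f z / P z)"
  have E: "E meromorphic_on UNIV" unfolding E_def by (intro meromorphic_intros P ell_mero f)
  have Enz: "eventually (\<lambda>z. E z \<noteq> 0) (cosparse UNIV)"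
    using nz P(2) by eventually_elim (simp add: E_def)
  have zE: "zorder E z = 0" for z
    unfolding E_def using zP[of z]
    by (subst Meromorphic.zorder_divide) (auto intro: mero_at ell_mero f P cosparse_frequently nz)
  obtain g where g: "g holomorphic_on UNIV" "eventually (\<lambda>z. E z = g z) (cosparse UNIV)"
    using entire_extension[OF E] mero_pole_iff[OF E Enz] zE by auto
  have gnz: "g z \<noteq> 0" for z
  proof
    assume "g z = 0"
    have "eventually (\<lambda>z. g z \<noteq> 0) (at z)"
      using cosparse_at[OF Enz] cosparse_at[OF g(2)] by eventually_elim simp
    then have "isolated_zero g z"
      using g(1) \<open>g z = 0\<close> analytic_on_open[of UNIV g] analytic_on_analytic_at[of g UNIV]
      by (subst isolated_zero_analytic_iff) auto
    then have "zorder g z > 0"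
      using g(1) analytic_on_open[of UNIV g] analytic_on_analytic_at[of g UNIV]
      by (intro zorder_isolated_zero_pos) auto
    moreover have "zorder g z = zorder E z"
      by (rule zorder_cong) (use cosparse_at[OF g(2), of z] in eventually_elim, auto)
    ultimately show False using zE by simp
  qed
  obtain b where b: "\<And>z. P (z + \<tau>) = exp (- (2 * pi * \<i>) * of_int N * z + b) * P z"
    using theta_prod_plus_tau[OF fin, of "zorder f"] unfolding P_def N_def by blast
  have gs: "(\<lambda>z. g (z + c)) holomorphic_on UNIV" for c
    by (intro holomorphic_on_compose_gen[of "\<lambda>z. z + c" UNIV g UNIV, unfolded o_def]
          holomorphic_intros g) auto
  have g1: "g (z + 1) = g z" for z
  proof (rule entire_eqI[where f = "\<lambda>z. g (z + 1)" and g = g])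
    show "eventually (\<lambda>z. g (z + 1) = g z) (cosparse UNIV)"
      using cosparse_shift[OF g(2), of 1] g(2) ell_periodic[OF f lattice_1]
      by eventually_elim (simp add: E_def P_def theta_prod_plus_1)
  qed (use g gs in auto)
  have gt: "g (z + \<tau>) = exp (2 * pi * \<i> * of_int N * z - b) * g z" for z
  proof (rule entire_eqI[where f = "\<lambda>z. g (z + \<tau>)" and g = "\<lambda>z. exp (2 * pi * \<i> * of_int N * z - b) * g z"])
    show "eventually (\<lambda>z. g (z + \<tau>) = exp (2 * pi * \<i> * of_int N * z - b) * g z) (cosparse UNIV)"
      using cosparse_shift[OF g(2), of \<tau>] g(2) ell_periodic[OF f lattice_tau]
    proof eventually_elim
      case (elim z)
      have "exp (- (2 * pi * \<i>) * of_int N * z + b) = inverse (exp (2 * pi * \<i> * of_int N * z - b))"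
        by (simp flip: exp_minus)
      then have "E (z + \<tau>) = f z / (inverse (exp (2 * pi * \<i> * of_int N * z - b)) * P z)"
        using elim(3) unfolding E_def b by simp
      also have "\<dots> = exp (2 * pi * \<i> * of_int N * z - b) * E z"
        by (simp add: E_def divide_inverse mult_ac)
      finally show ?case using elim(1,2) by simp
    qed
  qed (use g gs in \<open>auto intro!: holomorphic_intros\<close>)
  have gd: "(g has_field_derivative deriv g z) (at z)" for z
    using g by (auto intro: holomorphic_derivI)
  define L where "L = (\<lambda>z. deriv g z / g z)"
  have "L holomorphic_on UNIV" unfolding L_def using gnz g by (intro holomorphic_intros) auto
  moreover have "L (z + 1) = L z" for z
    using deriv_shift[of g 1 z] unfolding L_def by (simp add: g1)
  moreover have "L (z + \<tau>) = L z + 2 * pi * \<i> * of_int N" for z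
  proof -
    let ?c = "2 * pi * \<i> * of_int N"
    have "((\<lambda>z. exp (?c * z - b)) has_field_derivative exp (?c * z - b) * ?c) (at z)"
      by (auto intro!: derivative_eq_intros)
    from DERIV_mult[OF this gd[of z]]
    have "deriv (\<lambda>z. exp (?c * z - b) * g z) z = exp (?c * z - b) * ?c * g z + deriv g z * exp (?c * z - b)"
      by (rule DERIV_imp_deriv)
    then have "deriv g (z + \<tau>) = exp (?c * z - b) * (?c * g z + deriv g z)"
      using deriv_shift[of g \<tau> z] by (simp add: gt algebra_simps)
    then show ?thesis unfolding L_def gt using gnz[of z] by (simp add: field_simps)
  qed
  ultimately have "2 * pi * \<i> * of_int N = 0 \<and> (\<exists>a. \<forall>z. L z = a)"
    by (rule entire_quasi_periodic)
  then obtain a where N: "N = 0" and a: "\<And>z. L z = a" by auto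
  show "(\<Sum>p\<in>divisor f. zorder f p) = 0" using N by (simp add: N_def)
  have "((\<lambda>z. g z * exp (- a * z)) has_field_derivative 0) (at z)" for z
  proof -
    have "((\<lambda>z. exp (- a * z)) has_field_derivative exp (- a * z) * (- a)) (at z)"
      by (auto intro!: derivative_eq_intros)
    from DERIV_mult[OF gd[of z] this]
    show ?thesis using a[of z] gnz[of z] by (simp add: L_def field_simps)
  qed
  then obtain A where A: "\<And>z. g z * exp (- a * z) = A"
    using has_field_derivative_zero_constant[of UNIV "\<lambda>z. g z * exp (- a * z)"] by auto
  then have "g z = A * exp (a * z)" for z
    using A[of z] by (simp add: exp_minus field_simps)
  moreover from this have "A \<noteq> 0" using gnz[of 0] by auto
  moreover have "eventually (\<lambda>z. f z = g z * P z) (cosparse UNIV)"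
    using g(2) P(2) by eventually_elim (simp add: E_def field_simps)
  ultimately show "\<exists>A \<alpha>. A \<noteq> 0 \<and> eventually (\<lambda>z. f z = A * exp (\<alpha> * z) * theta_prod (divisor f) (zorder f) z) (cosparse UNIV)"
    unfolding P_def by auto
qed

text \<open>Halving the multiplicities in the theta factorization gives the root. The halved divisor
  still has degree 0, so both periods multiply \<open>h\<close> by constants, and these square to 1
  because the square of \<open>h\<close> is elliptic. The signs need not be trivial, which is the
  source of the case distinction on covers.\<close>

lemma ell_even_divisor_sqrt:
  assumes f: "ell f" and nz: "eventually (\<lambda>z. f z \<noteq> 0) (cosparse UNIV)"
    and even: "\<And>z. even (zorder f z)"
  obtains h s t where "h meromorphic_on UNIV" "eventually (\<lambda>z. h z ^ 2 = f z) (cosparse UNIV)"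
    "s \<in> {1, -1}" "t \<in> {1, -1}" "\<And>z. h (z + 1) = s * h z" "\<And>z. h (z + \<tau>) = t * h z"
proof -
  let ?D = "divisor f"
  have fin: "finite ?D" by (rule ell_zero_set_finite[OF f nz])
  obtain A \<alpha> where A: "A \<noteq> 0"
    "eventually (\<lambda>z. f z = A * exp (\<alpha> * z) * theta_prod ?D (zorder f) z) (cosparse UNIV)"
    using ell_factorization(2)[OF f nz] by blast
  define m where "m = (\<lambda>p. zorder f p div 2)"
  have m: "zorder f p = 2 * m p" for p using even[of p] by (simp add: m_def)
  have "(\<Sum>p\<in>?D. 2 * m p) = 0" using ell_factorization(1)[OF f nz] by (simp only: m)
  then have M: "(\<Sum>p\<in>?D. m p) = 0" by (simp flip: sum_distrib_left)
  define h where "h = (\<lambda>z. csqrt A * exp (\<alpha> * z / 2) * theta_prod ?D m z)"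
  have hm: "h meromorphic_on UNIV"
    unfolding h_def by (intro meromorphic_intros theta_prod_mero holo_mero holomorphic_intros) auto
  have hnz: "eventually (\<lambda>z. h z \<noteq> 0) (cosparse UNIV)"
    using theta_prod_nz[OF fin, of m] by eventually_elim (simp add: h_def A(1))
  have "theta_prod ?D (zorder f) z = theta_prod ?D m z ^ 2" for z
    unfolding theta_prod_def m by (simp add: prod_power_distrib power_int_mult mult.commute)
  moreover have "exp (\<alpha> * z / 2) ^ 2 = exp (\<alpha> * z)" for z
    by (simp flip: exp_double)
  ultimately have sq: "eventually (\<lambda>z. h z ^ 2 = f z) (cosparse UNIV)"
    using A(2) by (auto simp: h_def power_mult_distrib elim: eventually_mono)
  define s where "s = exp (\<alpha> / 2)"
  have h1: "h (z + 1) = s * h z" for z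
    unfolding h_def s_def theta_prod_plus_1 by (simp add: ring_distribs add_divide_distrib exp_add)
  obtain b where b: "\<And>z. theta_prod ?D m (z + \<tau>) = exp b * theta_prod ?D m z"
    using theta_prod_plus_tau[OF fin, of m] unfolding M by auto
  define t where "t = exp (\<alpha> * \<tau> / 2) * exp b"
  have ht: "h (z + \<tau>) = t * h z" for z
    unfolding h_def t_def b by (simp add: ring_distribs add_divide_distrib exp_add)
  have sgn: "c \<in> {1, -1}" if "\<And>z. h (z + l) = c * h z" "l \<in> \<Lambda>" for c l
  proof -
    have "eventually (\<lambda>z. c ^ 2 * h z ^ 2 = h z ^ 2 \<and> h z \<noteq> 0) (cosparse UNIV)"
      using sq cosparse_shift[OF sq, of l] ell_periodic[OF f that(2)] hnz
      by eventually_elim (simp add: that(1) power_mult_distrib)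
    then have "c ^ 2 = 1" using cosparse_ex by fastforce
    then show ?thesis by (simp add: power2_eq_1_iff)
  qed
  show ?thesis
    by (rule that[OF hm sq sgn[OF h1] sgn[OF ht] h1 ht]) auto
qed

end

subsection \<open>The Weierstrass function\<close>

lemma holo_split:
  fixes f :: "complex \<Rightarrow> complex"
  assumes "f holomorphic_on S" "open S"
  obtains g where "g holomorphic_on S" "\<And>z. z \<in> S \<Longrightarrow> f z = f 0 + z * g z" "g 0 = deriv f 0"
proof
  let ?g = "\<lambda>z. if z = 0 then deriv f 0 else (f z - f 0) / (z - 0)"
  show "?g holomorphic_on S" by (rule pole_lemma_open[OF assms])
qed auto

text \<open>Evenness forces the linear term to vanish, so the square of \<open>z\<close> splits off.
  The quotient is even again, which allows iteration.\<close>

lemma even_split: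
  fixes f :: "complex \<Rightarrow> complex"
  assumes f: "f holomorphic_on ball 0 r" and ev: "\<And>z. z \<in> ball 0 r \<Longrightarrow> f (- z) = f z"
  obtains h where "h holomorphic_on ball 0 r" "\<And>z. z \<in> ball 0 r \<Longrightarrow> h (- z) = h z"
    "\<And>z. z \<in> ball 0 r \<Longrightarrow> f z = f 0 + z ^ 2 * h z"
proof -
  obtain g where g: "g holomorphic_on ball 0 r" "\<And>z. z \<in> ball 0 r \<Longrightarrow> f z = f 0 + z * g z" "g 0 = deriv f 0"
    using holo_split[OF f] by auto
  have g0: "g 0 = 0" if "r > 0"
  proof -
    have "(f has_field_derivative deriv f 0) (at 0)"
      using f that by (intro holomorphic_derivI[of f "ball 0 r"]) auto
    have "((\<lambda>z. f (- z)) has_field_derivative deriv f 0 * (- 1)) (at 0)"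
      by (rule DERIV_chain2[where f = f and g = "\<lambda>z. - z"])
         (use \<open>(f has_field_derivative deriv f 0) (at 0)\<close> in \<open>auto intro!: derivative_eq_intros\<close>)
    moreover have "((\<lambda>z. f (- z)) has_field_derivative deriv f 0) (at 0)"
      by (rule has_field_derivative_transform_within_open[where f = f and S = "ball 0 r"])
         (use that ev \<open>(f has_field_derivative deriv f 0) (at 0)\<close> in auto)
    ultimately have "deriv f 0 = deriv f 0 * (- 1)" by (rule DERIV_unique[rotated])
    then show ?thesis using g(3) by simp
  qed
  obtain h where h: "h holomorphic_on ball 0 r" "\<And>z. z \<in> ball 0 r \<Longrightarrow> g z = g 0 + z * h z"
    using holo_split[OF g(1)] by auto
  have fh: "f z = f 0 + z ^ 2 * h z" if "z \<in> ball 0 r" for z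
  proof -
    have "r > 0" using that by (auto simp: dist_norm intro: le_less_trans[OF norm_ge_zero])
    then show ?thesis using g(2)[OF that] h(2)[OF that] g0 by (simp add: power2_eq_square)
  qed
  moreover have "h (- z) = h z" if "z \<in> ball 0 r" for z
  proof (cases "z = 0")
    case False
    have "f 0 + z ^ 2 * h (- z) = f (- z)" using fh[of "- z"] that by simp
    also have "\<dots> = f z" by (rule ev[OF that])
    also have "\<dots> = f 0 + z ^ 2 * h z" by (rule fh[OF that])
    finally have "f 0 + z ^ 2 * h (- z) = f 0 + z ^ 2 * h z" .
    then show ?thesis using False by (metis add_left_cancel mult_left_cancel power_not_zero)
  qed simp
  ultimately show ?thesis using that h(1) by blast
qed

context half_plane
begin

lemma Lambda_compl_open: "open (- \<Lambda>)"
proof -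
  have "continuous_on UNIV theta" by (rule holomorphic_on_imp_continuous_on) simp
  then have "open (theta -` (- {0}))" by (intro open_vimage) auto
  moreover have "theta -` (- {0}) = - \<Lambda>" using theta_eq_0_iff by auto
  ultimately show ?thesis by simp
qed

lemma Lambda_cosparse: "eventually (\<lambda>z. z \<notin> \<Lambda>) (cosparse UNIV)"
  using theta_nz_cosparse[of 0] by (simp add: theta_eq_0_iff)

text \<open>The Weierstrass zeta function up to adding a polynomial of degree at most 1. In this
  normalization it has period 1, and the whole failure of ellipticity sits in the period
  \<tau>.\<close>

definition zeta :: "complex \<Rightarrow> complex" where "zeta z = deriv theta z / theta z"

lemma zeta_holo: "zeta holomorphic_on (- \<Lambda>)"
  unfolding zeta_def by (intro holomorphic_intros) (auto simp: theta_eq_0_iff Lambda_compl_open)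

lemma zeta_mero: "zeta meromorphic_on UNIV"
  unfolding zeta_def by (intro meromorphic_intros holo_mero) auto

lemma theta_deriv: "(theta has_field_derivative deriv theta z) (at z)"
  using holomorphic_derivI[of theta UNIV z] by auto

lemma zeta_plus_1: "zeta (z + 1) = zeta z"
  using deriv_shift[of theta 1 z] by (simp add: zeta_def theta_plus_1)

lemma zeta_plus_tau:
  assumes "z \<notin> \<Lambda>"
  shows "zeta (z + \<tau>) = zeta z - 2 * pi * \<i>"
proof -
  let ?e = "exp (- (2 * pi * \<i>) * z + pi * \<i>)"
  have "((\<lambda>z. exp (- (2 * pi * \<i>) * z + pi * \<i>)) has_field_derivative ?e * (- (2 * pi * \<i>))) (at z)"
    by (auto intro!: derivative_eq_intros)
  from DERIV_mult[OF this theta_deriv[of z]]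
  have "deriv (\<lambda>z. theta (z + \<tau>)) z = ?e * (- (2 * pi * \<i>)) * theta z + deriv theta z * ?e"
    unfolding theta_plus_tau_exp by (rule DERIV_imp_deriv)
  then have "deriv theta (z + \<tau>) = ?e * (deriv theta z - 2 * pi * \<i> * theta z)"
    unfolding deriv_shift by (simp add: algebra_simps)
  then show ?thesis
    unfolding zeta_def theta_plus_tau_exp using assms
    by (simp add: theta_eq_0_iff[symmetric] field_simps)
qed

lemma zeta_uminus:
  assumes "z \<notin> \<Lambda>"
  shows "zeta (- z) = - zeta z + 2 * pi * \<i>"
proof -
  let ?e = "exp (- (2 * pi * \<i>) * z)"
  have t: "theta (- z) = - theta z * exp (- (2 * pi * \<i>) * z)" for z
    unfolding theta_uminus expi_def by (simp add: exp_minus divide_inverse)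
  have "((\<lambda>z. exp (- (2 * pi * \<i>) * z)) has_field_derivative ?e * (- (2 * pi * \<i>))) (at z)"
    by (auto intro!: derivative_eq_intros)
  from DERIV_mult[OF DERIV_minus[OF theta_deriv[of z]] this]
  have "((\<lambda>z. theta (- z)) has_field_derivative (- deriv theta z * ?e + ?e * (- (2 * pi * \<i>)) * - theta z)) (at z)"
    unfolding t .
  moreover have "((\<lambda>z. theta (- z)) has_field_derivative deriv theta (- z) * (- 1)) (at z)"
    by (rule DERIV_chain2[OF theta_deriv]) (auto intro!: derivative_eq_intros)
  ultimately have "deriv theta (- z) * (- 1) = - deriv theta z * ?e + ?e * (- (2 * pi * \<i>)) * - theta z"
    by (rule DERIV_unique[rotated])
  then have "deriv theta (- z) = ?e * (deriv theta z - 2 * pi * \<i> * theta z)"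
    by (simp add: algebra_simps minus_equation_iff)
  then show ?thesis
    unfolding zeta_def t using assms by (simp add: theta_eq_0_iff[symmetric] field_simps)
qed

text \<open>Since \<open>theta\<close> has a simple zero at 0, it is \<open>z * E z\<close> with
  \<open>E 0\<close> nonzero, and the logarithmic derivative splits accordingly.\<close>

lemma zeta_expansion:
  obtains r A where "r > 0" "A holomorphic_on ball 0 r" "\<And>z. z \<in> ball 0 r - {0} \<Longrightarrow> z \<notin> \<Lambda>"
    "\<And>z. z \<in> ball 0 r - {0} \<Longrightarrow> zeta z = 1 / z + A z"
proof -
  obtain E where E: "E holomorphic_on UNIV" "\<And>z. theta z = z * E z" "E 0 = deriv theta 0"
    using holo_split[of theta UNIV] by auto
  have "continuous_on UNIV E" using E by (intro holomorphic_on_imp_continuous_on)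
  then have "open (E -` (- {0}))" by (intro open_vimage) auto
  moreover have "0 \<in> E -` (- {0})" using E(3) deriv_theta_0 by simp
  ultimately obtain r where r: "r > 0" "ball 0 r \<subseteq> E -` (- {0})" by (rule openE)
  have "(\<lambda>z. deriv E z / E z) holomorphic_on ball 0 r"
    using r by (intro holomorphic_intros holomorphic_on_subset[OF E(1)]) auto
  moreover have "z \<notin> \<Lambda>" if "z \<in> ball 0 r - {0}" for z
    using that r E(2)[of z] theta_eq_0_iff[of z] by auto
  moreover have "zeta z = 1 / z + deriv E z / E z" if "z \<in> ball 0 r - {0}" for z
  proof -
    have "(E has_field_derivative deriv E z) (at z)"
      using E(1) by (auto intro: holomorphic_derivI)
    from DERIV_mult[OF DERIV_ident this] have "((\<lambda>z. z * E z) has_field_derivative E z + deriv E z * z) (at z)"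
      by simp
    moreover have "theta = (\<lambda>z. z * E z)" using E(2) by auto
    ultimately have "deriv theta z = E z + deriv E z * z"
      by (simp add: DERIV_imp_deriv)
    moreover have "E z \<noteq> 0" using that r by auto
    ultimately show ?thesis unfolding zeta_def E(2) using that by (simp add: field_simps)
  qed
  ultimately show ?thesis using that r(1) by blast
qed

lemma deriv_zeta_expansion:
  "\<exists>c r A. r > 0 \<and> A holomorphic_on ball 0 r \<and> A 0 = 0 \<and>
     (\<forall>z\<in>ball 0 r - {0}. z \<notin> \<Lambda> \<and> - deriv zeta z - c = 1 / z ^ 2 + A z)"
proof -
  obtain r A where A: "r > 0" "A holomorphic_on ball 0 r" "\<And>z. z \<in> ball 0 r - {0} \<Longrightarrow> z \<notin> \<Lambda>"
    "\<And>z. z \<in> ball 0 r - {0} \<Longrightarrow> zeta z = 1 / z + A z" by (rule zeta_expansion) blast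
  define B where "B = (\<lambda>z. - deriv A z + deriv A 0)"
  have "B holomorphic_on ball 0 r" unfolding B_def using A by (intro holomorphic_intros) auto
  moreover have "- deriv zeta z + deriv A 0 = 1 / z ^ 2 + B z" if z: "z \<in> ball 0 r - {0}" for z
  proof -
    have "((\<lambda>z. 1 / z + A z) has_field_derivative - (1 / z ^ 2) + deriv A z) (at z)"
    proof (rule DERIV_add)
      show "((\<lambda>z. 1 / z) has_field_derivative - (1 / z ^ 2)) (at z)"
        using z by (auto intro!: derivative_eq_intros simp: power2_eq_square)
      show "(A has_field_derivative deriv A z) (at z)"
        using z A by (intro holomorphic_derivI[of A "ball 0 r"]) auto
    qed
    then have "(zeta has_field_derivative - (1 / z ^ 2) + deriv A z) (at z)"
      by (rule has_field_derivative_transform_within_open[where S = "ball 0 r - {0}"])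
         (use z A in auto)
    then show ?thesis by (simp add: DERIV_imp_deriv B_def)
  qed
  ultimately show ?thesis using A
    by (intro exI[of _ "- deriv A 0"] exI[of _ r] exI[of _ B]) (auto simp: B_def)
qed

text \<open>The constant term of \<open>- deriv zeta\<close> at 0. Because \<open>A 0 = 0\<close>,
  the choice is unique; subtracting it gives the classical normalization of the Weierstrass
  function.\<close>

definition wp_const :: complex where
  "wp_const = (SOME c. \<exists>r A. r > 0 \<and> A holomorphic_on ball 0 r \<and> A 0 = 0 \<and>
     (\<forall>z\<in>ball 0 r - {0}. z \<notin> \<Lambda> \<and> - deriv zeta z - c = 1 / z ^ 2 + A z))"

definition wp :: "complex \<Rightarrow> complex" where "wp z = - deriv zeta z - wp_const"

abbreviation wp' :: "complex \<Rightarrow> complex" where "wp' \<equiv> deriv wp"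

lemma wp_expansion:
  obtains r A where "r > 0" "A holomorphic_on ball 0 r" "A 0 = 0"
    "\<And>z. z \<in> ball 0 r - {0} \<Longrightarrow> z \<notin> \<Lambda>" "\<And>z. z \<in> ball 0 r - {0} \<Longrightarrow> wp z = 1 / z ^ 2 + A z"
  using someI_ex[OF deriv_zeta_expansion] unfolding wp_const_def[symmetric] wp_def by blast

lemma wp_holo: "wp holomorphic_on (- \<Lambda>)"
  unfolding wp_def by (intro holomorphic_intros zeta_holo Lambda_compl_open)

lemma wp'_holo: "wp' holomorphic_on (- \<Lambda>)"
  by (intro holomorphic_deriv wp_holo Lambda_compl_open)

lemma wp_deriv: "z \<notin> \<Lambda> \<Longrightarrow> (wp has_field_derivative wp' z) (at z)"
  by (rule holomorphic_derivI[OF wp_holo Lambda_compl_open]) auto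

lemma wp'_deriv: "z \<notin> \<Lambda> \<Longrightarrow> (wp' has_field_derivative deriv wp' z) (at z)"
  by (rule holomorphic_derivI[OF wp'_holo Lambda_compl_open]) auto

lemma wp_analytic: "z \<notin> \<Lambda> \<Longrightarrow> wp analytic_on {z}"
  using wp_holo Lambda_compl_open analytic_at by auto

lemma wp'_analytic: "z \<notin> \<Lambda> \<Longrightarrow> wp' analytic_on {z}"
  using wp'_holo Lambda_compl_open analytic_at by auto

lemma ell_wp [simp]: "ell wp"
proof -
  have "eventually (\<lambda>z. zeta (z + \<tau>) = zeta z - 2 * pi * \<i>) (cosparse UNIV)"
    using Lambda_cosparse by eventually_elim (rule zeta_plus_tau)
  from mero_deriv_cong[OF this]
  have dd: "eventually (\<lambda>z. deriv zeta (z + \<tau>) = deriv (\<lambda>z. zeta z - 2 * pi * \<i>) z) (cosparse UNIV)"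
    unfolding deriv_shift .
  have d: "deriv (\<lambda>z. zeta z - c) z = deriv zeta z" if "z \<notin> \<Lambda>" for z c
  proof -
    have "(zeta has_field_derivative deriv zeta z) (at z)"
      by (rule holomorphic_derivI[OF zeta_holo Lambda_compl_open]) (use that in auto)
    from DERIV_diff[OF this DERIV_const] show ?thesis by (simp add: DERIV_imp_deriv)
  qed
  have "eventually (\<lambda>z. wp (z + \<tau>) = wp z) (cosparse UNIV)"
    using dd Lambda_cosparse by eventually_elim (simp add: wp_def d)
  moreover have "wp (z + 1) = wp z" for z
    using deriv_shift[of zeta 1 z] by (simp add: wp_def zeta_plus_1)
  moreover have "wp meromorphic_on UNIV"
    unfolding wp_def by (intro meromorphic_intros zeta_mero)
  ultimately show ?thesis by (simp add: ell_iff)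
qed

lemma ell_wp' [simp]: "ell wp'"
  by (intro ell_deriv ell_wp)

lemma wp_mero [meromorphic_intros]: "wp meromorphic_on UNIV" "wp' meromorphic_on UNIV"
  using ell_mero by auto

text \<open>By continuity an identity off a discrete set becomes a pointwise one at every
  non-lattice point.\<close>

lemma holo_off_Lambda_eqI:
  assumes "f holomorphic_on (- \<Lambda>)" "g holomorphic_on (- \<Lambda>)"
    and "eventually (\<lambda>z. f z = g z) (cosparse UNIV)" "z \<notin> \<Lambda>"
  shows "f z = g z"
proof (rule tendsto_unique)
  have lim: "h \<midarrow>z\<rightarrow> h z" if "h holomorphic_on (- \<Lambda>)" for h :: "complex \<Rightarrow> complex"
    using holomorphic_on_imp_continuous_on[OF that] Lambda_compl_open assms(4)
    by (simp add: continuous_on_eq_continuous_at isCont_def)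
  show "f \<midarrow>z\<rightarrow> f z" by (rule lim[OF assms(1)])
  show "f \<midarrow>z\<rightarrow> g z"
    by (rule Lim_transform_eventually[OF lim[OF assms(2)]])
       (use cosparse_at[OF assms(3), of z] in eventually_elim, simp)
qed simp

lemma holo_shift_off_Lambda:
  assumes "f holomorphic_on (- \<Lambda>)" "l \<in> \<Lambda>"
  shows "(\<lambda>z. f (z + l)) holomorphic_on (- \<Lambda>)"
  by (rule holomorphic_on_compose_gen[of "\<lambda>z. z + l" _ f "- \<Lambda>", unfolded o_def])
     (use assms in \<open>auto intro!: holomorphic_intros simp: lattice_add_iff\<close>)

lemma wp'_periodic: "z \<notin> \<Lambda> \<Longrightarrow> l \<in> \<Lambda> \<Longrightarrow> wp' (z + l) = wp' z"
  by (rule holo_off_Lambda_eqI[where f = "\<lambda>z. wp' (z + l)"])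
     (auto intro: holo_shift_off_Lambda wp'_holo ell_periodic)

lemma wp_uminus: "z \<notin> \<Lambda> \<Longrightarrow> wp (- z) = wp z"
proof -
  assume z: "z \<notin> \<Lambda>"
  have zd: "(zeta has_field_derivative deriv zeta w) (at w)" if "w \<notin> \<Lambda>" for w
    by (rule holomorphic_derivI[OF zeta_holo Lambda_compl_open]) (use that in auto)
  have "((\<lambda>z. zeta (- z)) has_field_derivative deriv zeta (- z) * (- 1)) (at z)"
    by (rule DERIV_chain2[OF zd]) (use z in \<open>auto intro!: derivative_eq_intros\<close>)
  moreover have "((\<lambda>z. zeta (- z)) has_field_derivative - deriv zeta z + 0) (at z)"
    by (rule has_field_derivative_transform_within_open[where S = "- \<Lambda>", OF DERIV_add[OF DERIV_minus[OF zd] DERIV_const[of "2 * pi * \<i>"]]])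
       (use z Lambda_compl_open zeta_uminus in auto)
  ultimately have "deriv zeta (- z) * (- 1) = - deriv zeta z + 0" by (rule DERIV_unique)
  then show ?thesis by (simp add: wp_def)
qed

lemma wp'_uminus: "z \<notin> \<Lambda> \<Longrightarrow> wp' (- z) = - wp' z"
proof -
  assume z: "z \<notin> \<Lambda>"
  have "((\<lambda>z. wp (- z)) has_field_derivative wp' (- z) * (- 1)) (at z)"
    by (rule DERIV_chain2[OF wp_deriv]) (use z in \<open>auto intro!: derivative_eq_intros\<close>)
  moreover have "((\<lambda>z. wp (- z)) has_field_derivative wp' z) (at z)"
    by (rule has_field_derivative_transform_within_open[where S = "- \<Lambda>", OF wp_deriv])
       (use z Lambda_compl_open wp_uminus in auto)
  ultimately have "wp' (- z) * (- 1) = wp' z" by (rule DERIV_unique)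
  then show ?thesis by (simp add: minus_equation_iff)
qed

text \<open>Splitting the even regular part twice leaves no odd terms, and the constant term is 0 by
  the choice of \<open>wp_const\<close>. The coefficient \<alpha> is the classical
  \<open>g2 / 20\<close>.\<close>

lemma wp_local:
  obtains r C \<alpha> where "r > 0" "C holomorphic_on ball 0 r"
    "\<And>z. z \<in> ball 0 r - {0} \<Longrightarrow> z \<notin> \<Lambda>"
    "\<And>z. z \<in> ball 0 r - {0} \<Longrightarrow> wp z = 1 / z ^ 2 + \<alpha> * z ^ 2 + z ^ 4 * C z"
    "\<And>z. z \<in> ball 0 r - {0} \<Longrightarrow> wp' z = - 2 / z ^ 3 + 2 * \<alpha> * z + z ^ 3 * (4 * C z + z * deriv C z)"
proof -
  obtain r A where A: "r > 0" "A holomorphic_on ball 0 r" "A 0 = 0"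
    "\<And>z. z \<in> ball 0 r - {0} \<Longrightarrow> z \<notin> \<Lambda>" "\<And>z. z \<in> ball 0 r - {0} \<Longrightarrow> wp z = 1 / z ^ 2 + A z"
    by (rule wp_expansion) blast
  have evA: "A (- z) = A z" if "z \<in> ball 0 r" for z
  proof (cases "z = 0")
    case False
    then show ?thesis using A(5)[of z] A(5)[of "- z"] wp_uminus[OF A(4)] that by simp
  qed simp
  obtain B where B: "B holomorphic_on ball 0 r" "\<And>z. z \<in> ball 0 r \<Longrightarrow> B (- z) = B z"
    "\<And>z. z \<in> ball 0 r \<Longrightarrow> A z = A 0 + z ^ 2 * B z" by (rule even_split[OF A(2) evA]; blast)
  obtain C where C: "C holomorphic_on ball 0 r" "\<And>z. z \<in> ball 0 r \<Longrightarrow> C (- z) = C z"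
    "\<And>z. z \<in> ball 0 r \<Longrightarrow> B z = B 0 + z ^ 2 * C z" by (rule even_split[OF B(1) B(2)]; blast)
  have wp: "wp z = 1 / z ^ 2 + B 0 * z ^ 2 + z ^ 4 * C z" if "z \<in> ball 0 r - {0}" for z
    using A(5)[OF that] B(3)[of z] C(3)[of z] that A(3)
    by (simp add: algebra_simps flip: power_add)
  moreover have "wp' z = - 2 / z ^ 3 + 2 * B 0 * z + z ^ 3 * (4 * C z + z * deriv C z)"
    if z: "z \<in> ball 0 r - {0}" for z
  proof -
    have dC: "(C has_field_derivative deriv C z) (at z)"
      using z C by (intro holomorphic_derivI[of C "ball 0 r"]) auto
    have d1: "((\<lambda>z. 1 / z ^ 2 + B 0 * z ^ 2) has_field_derivative (- 2 / z ^ 3 + 2 * B 0 * z)) (at z)"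
      using z by (auto intro!: derivative_eq_intros simp: field_simps power_numeral_reduce)
    have d2: "((\<lambda>z. z ^ 4) has_field_derivative 4 * z ^ 3) (at z)"
      by (auto intro!: derivative_eq_intros)
    have "((\<lambda>z. 1 / z ^ 2 + B 0 * z ^ 2 + z ^ 4 * C z) has_field_derivative
        (- 2 / z ^ 3 + 2 * B 0 * z + (4 * z ^ 3 * C z + deriv C z * z ^ 4))) (at z)"
      by (intro DERIV_add d1 DERIV_mult d2 dC)
    then have "(wp has_field_derivative
        (- 2 / z ^ 3 + 2 * B 0 * z + (4 * z ^ 3 * C z + deriv C z * z ^ 4))) (at z)"
      by (rule has_field_derivative_transform_within_open[where S = "ball 0 r - {0}"])
         (use z wp in auto)
    then show ?thesis by (simp add: DERIV_imp_deriv algebra_simps power_numeral_reduce)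
  qed
  ultimately show ?thesis using that[of r C "B 0"] A C by blast
qed

end

text \<open>Riemann's removable singularity theorem, in the form that lets leading coefficients be
  peeled off one pole order at a time.\<close>

lemma mero_pole_order_lower:
  assumes f: "f meromorphic_on UNIV" and lim: "((\<lambda>z. z ^ Suc n * f z) \<longlongrightarrow> 0) (at 0)"
  shows "\<exists>c. ((\<lambda>z. z ^ n * f z) \<longlongrightarrow> c) (at 0)"
proof -
  let ?F = "\<lambda>z. z ^ n * f z"
  have F: "?F meromorphic_on UNIV" by (intro meromorphic_intros f)
  obtain r where r: "r > 0" "?F analytic_on ball 0 r - {0}"
    using mero_iso[OF F, of 0] unfolding isolated_singularity_at_def by blast
  then have h: "?F holomorphic_on ball 0 r - {0}" by (intro analytic_imp_holomorphic)
  have "((\<lambda>z. (z - 0) * ?F z) \<longlongrightarrow> 0) (at 0)" using lim by (simp add: mult.assoc)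
  then obtain g where g: "g holomorphic_on ball 0 r" "\<And>z. z \<in> ball 0 r - {0} \<Longrightarrow> g z = ?F z"
    using holomorphic_on_extend_lim[OF h] r(1) by auto
  have "g \<midarrow>0\<rightarrow> g 0"
    using holomorphic_on_imp_continuous_on[OF g(1)] r(1)
    by (simp add: continuous_on_eq_continuous_at isCont_def)
  then have "?F \<midarrow>0\<rightarrow> g 0"
    by (rule Lim_transform_within_open[where s = "ball 0 r"]) (use g r(1) in auto)
  then show ?thesis by blast
qed

lemma mero_not_pole_lim:
  assumes "f meromorphic_on UNIV" "\<not> is_pole f z"
  shows "\<exists>c. f \<midarrow>z\<rightarrow> c"
  using mero_ness[OF assms(1), of z] assms(2) unfolding not_essential_def by blast

lemma lim_not_pole: "f \<midarrow>z\<rightarrow> c \<Longrightarrow> \<not> is_pole f (z::complex)"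
  unfolding is_pole_def using not_tendsto_and_filterlim_at_infinity[of "at z" f c] by auto

text \<open>A pole of \<open>f\<close> would be a pole of its square, and a meromorphic function has
  a limit wherever it has no pole. So the sign of the root cannot oscillate near
  \<open>z\<close>.\<close>

lemma mero_lim_square:
  assumes "f meromorphic_on UNIV" "(\<lambda>z. f z ^ 2) \<midarrow>z\<rightarrow> c"
  shows "\<exists>d. f \<midarrow>z\<rightarrow> d \<and> d ^ 2 = c"
proof -
  have "\<not> is_pole f z"
  proof
    assume "is_pole f z"
    then have "filterlim (\<lambda>z. f z ^ 2) at_infinity (at z)"
      unfolding is_pole_def power2_eq_square by (intro filterlim_at_infinity_times)
    then show False using lim_not_pole[OF assms(2)] by (simp add: is_pole_def)
  qed
  then obtain d where d: "f \<midarrow>z\<rightarrow> d" using mero_not_pole_lim[OF assms(1)] by blast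
  then have "(\<lambda>z. f z ^ 2) \<midarrow>z\<rightarrow> d ^ 2" by (intro tendsto_intros)
  then have "d ^ 2 = c" using assms(2) by (rule tendsto_unique[rotated]) simp
  then show ?thesis using d by blast
qed

section \<open>Elliptic functions with poles only at lattice points\<close>

context half_plane
begin

text \<open>Limits instead of holomorphy, since values at isolated points are arbitrary. The notion
  is stable under arithmetic and, by \<open>reg_sqrt\<close>, under square roots.\<close>

definition reg :: "(complex \<Rightarrow> complex) \<Rightarrow> bool" where
  "reg f \<longleftrightarrow> (\<forall>z. z \<notin> \<Lambda> \<longrightarrow> (\<exists>c. f \<midarrow>z\<rightarrow> c))"

lemma regI: "(\<And>z. z \<notin> \<Lambda> \<Longrightarrow> \<exists>c. f \<midarrow>z\<rightarrow> c) \<Longrightarrow> reg f"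
  by (simp add: reg_def)

lemma regE: "reg f \<Longrightarrow> z \<notin> \<Lambda> \<Longrightarrow> (\<And>c. f \<midarrow>z\<rightarrow> c \<Longrightarrow> P) \<Longrightarrow> P"
  unfolding reg_def by blast

lemma reg_const: "reg (\<lambda>_. c)"
  by (rule regI, rule exI, rule tendsto_const)

lemma reg_add: "reg f \<Longrightarrow> reg g \<Longrightarrow> reg (\<lambda>z. f z + g z)"
  by (rule regI, erule (1) regE, erule (1) regE, rule exI, erule (1) tendsto_add)

lemma reg_diff: "reg f \<Longrightarrow> reg g \<Longrightarrow> reg (\<lambda>z. f z - g z)"
  by (rule regI, erule (1) regE, erule (1) regE, rule exI, erule (1) tendsto_diff)

lemma reg_mult: "reg f \<Longrightarrow> reg g \<Longrightarrow> reg (\<lambda>z. f z * g z)"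
  by (rule regI, erule (1) regE, erule (1) regE, rule exI, erule (1) tendsto_mult)

lemma reg_power: "reg f \<Longrightarrow> reg (\<lambda>z. f z ^ n)"
  by (rule regI, erule (1) regE, rule exI, erule tendsto_power)

lemma reg_holo: "f holomorphic_on (- \<Lambda>) \<Longrightarrow> reg f"
  unfolding reg_def using holomorphic_on_imp_continuous_on[of f "- \<Lambda>"] Lambda_compl_open
  by (auto simp: continuous_on_eq_continuous_at isCont_def)

lemma reg_wp: "reg wp" and reg_wp': "reg wp'" and reg_zeta: "reg zeta"
  by (intro reg_holo wp_holo wp'_holo zeta_holo)+

lemmas reg_intros = reg_const reg_add reg_diff reg_mult reg_power reg_wp reg_wp' reg_zeta

lemma reg_sqrt:
  assumes "h meromorphic_on UNIV" "reg f" "eventually (\<lambda>z. h z ^ 2 = f z) (cosparse UNIV)"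
  shows "reg h"
  unfolding reg_def
proof (intro allI impI)
  fix z assume "z \<notin> \<Lambda>"
  then obtain c where "f \<midarrow>z\<rightarrow> c" using assms(2) unfolding reg_def by blast
  then have "(\<lambda>z. h z ^ 2) \<midarrow>z\<rightarrow> c"
    by (rule Lim_transform_eventually) (use cosparse_at[OF assms(3), of z] in eventually_elim, simp)
  then show "\<exists>c. h \<midarrow>z\<rightarrow> c" using mero_lim_square[OF assms(1)] by blast
qed

lemma lim_wp: "((\<lambda>z. z ^ 2 * wp z) \<longlongrightarrow> 1) (at 0)"
  and lim_wp': "((\<lambda>z. z ^ 3 * wp' z) \<longlongrightarrow> - 2) (at 0)"
proof -
  obtain r C \<alpha> where C: "r > 0" "C holomorphic_on ball 0 r"
    "\<And>z. z \<in> ball 0 r - {0} \<Longrightarrow> z \<notin> \<Lambda>"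
    "\<And>z. z \<in> ball 0 r - {0} \<Longrightarrow> wp z = 1 / z ^ 2 + \<alpha> * z ^ 2 + z ^ 4 * C z"
    "\<And>z. z \<in> ball 0 r - {0} \<Longrightarrow> wp' z = - 2 / z ^ 3 + 2 * \<alpha> * z + z ^ 3 * (4 * C z + z * deriv C z)"
    by (rule wp_local) blast
  have lim: "h \<midarrow>0\<rightarrow> h 0" if "h holomorphic_on ball 0 r" for h :: "complex \<Rightarrow> complex"
    using holomorphic_on_imp_continuous_on[OF that] C(1)
    by (simp add: continuous_on_eq_continuous_at isCont_def)
  have 1: "(\<lambda>z. 1 + \<alpha> * z ^ 4 + z ^ 6 * C z) holomorphic_on ball 0 r"
    by (intro holomorphic_intros C)
  have "((\<lambda>z. z ^ 2 * wp z) \<longlongrightarrow> 1 + \<alpha> * 0 ^ 4 + 0 ^ 6 * C 0) (at 0)"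
    by (rule Lim_transform_within_open[OF lim[OF 1], where s = "ball 0 r"])
       (use C(1,4) in \<open>auto simp: field_simps simp flip: power_add\<close>)
  then show "((\<lambda>z. z ^ 2 * wp z) \<longlongrightarrow> 1) (at 0)" by simp
  have 2: "(\<lambda>z. - 2 + 2 * \<alpha> * z ^ 4 + z ^ 6 * (4 * C z + z * deriv C z)) holomorphic_on ball 0 r"
    by (intro holomorphic_intros C) auto
  have "((\<lambda>z. z ^ 3 * wp' z) \<longlongrightarrow> - 2 + 2 * \<alpha> * 0 ^ 4 + 0 ^ 6 * (4 * C 0 + 0 * deriv C 0)) (at 0)"
  proof (rule Lim_transform_within_open[OF lim[OF 2], where s = "ball 0 r"])
    fix z assume z: "z \<in> ball 0 r" "z \<noteq> (0::complex)"
    then show "- 2 + 2 * \<alpha> * z ^ 4 + z ^ 6 * (4 * C z + z * deriv C z) = z ^ 3 * wp' z"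
      using C(5)[of z] by (simp add: ring_distribs power_numeral_reduce)
  qed (use C(1) in auto)
  then show "((\<lambda>z. z ^ 3 * wp' z) \<longlongrightarrow> - 2) (at 0)" by simp
qed

lemma lim_zeta: "((\<lambda>z. z * zeta z) \<longlongrightarrow> 1) (at 0)"
proof -
  obtain r A where A: "r > 0" "A holomorphic_on ball 0 r" "\<And>z. z \<in> ball 0 r - {0} \<Longrightarrow> z \<notin> \<Lambda>"
    "\<And>z. z \<in> ball 0 r - {0} \<Longrightarrow> zeta z = 1 / z + A z" by (rule zeta_expansion) blast
  have "(\<lambda>z. 1 + z * A z) holomorphic_on ball 0 r" by (intro holomorphic_intros A)
  from holomorphic_on_imp_continuous_on[OF this] have "(\<lambda>z. 1 + z * A z) \<midarrow>0\<rightarrow> 1 + 0 * A 0"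
    using A(1) by (auto simp: continuous_on_eq_continuous_at isCont_def dest!: bspec[where x = 0])
  then have "((\<lambda>z. z * zeta z) \<longlongrightarrow> 1 + 0 * A 0) (at 0)"
    by (rule Lim_transform_within_open[where s = "ball 0 r"]) (use A in \<open>auto simp: field_simps\<close>)
  then show ?thesis by simp
qed

lemma ell_span0:
  assumes "ell f" "reg f" "f \<midarrow>0\<rightarrow> c"
  shows "eventually (\<lambda>z. f z = c) (cosparse UNIV)"
proof -
  have "\<not> is_pole f z" for z
  proof (cases "z \<in> \<Lambda>")
    case True
    then show ?thesis using ell_pole_shift[OF assms(1), of z 0] lim_not_pole[OF assms(3)] by simp
  next
    case False
    then show ?thesis using assms(2) lim_not_pole unfolding reg_def by blast
  qed
  then obtain d where d: "eventually (\<lambda>z. f z = d) (cosparse UNIV)"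
    using ell_no_pole_const[OF assms(1)] by blast
  have "f \<midarrow>0\<rightarrow> d"
    by (rule Lim_transform_eventually[OF tendsto_const])
       (use cosparse_at[OF d, of 0] in eventually_elim, simp)
  then have "d = c" using assms(3) by (rule tendsto_unique[rotated]) simp
  then show ?thesis using d by simp
qed

text \<open>The increment \<open>-2 \<pi> i\<close> of \<open>zeta\<close> under \<open>\<tau>\<close> rules out elliptic functions
  with a single simple pole.\<close>

lemma ell_span1:
  assumes f: "ell f" "reg f" "((\<lambda>z. z * f z) \<longlongrightarrow> c) (at 0)"
  shows "c = 0"
proof -
  define G where "G = (\<lambda>z. f z - c * zeta z)"
  have Gm: "G meromorphic_on UNIV" unfolding G_def by (intro meromorphic_intros ell_mero f zeta_mero)
  have G1: "eventually (\<lambda>z. G (z + 1) = G z) (cosparse UNIV)"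
    using ell_periodic[OF f(1) lattice_1] by eventually_elim (simp add: G_def zeta_plus_1)
  have Gt: "eventually (\<lambda>z. G (z + \<tau>) = G z + c * (2 * pi * \<i>)) (cosparse UNIV)"
    using ell_periodic[OF f(1) lattice_tau] Lambda_cosparse
    by eventually_elim (simp add: G_def zeta_plus_tau algebra_simps)
  have Gl: "\<exists>k. eventually (\<lambda>z. G (z + l) = G z + k) (cosparse UNIV)" if "l \<in> \<Lambda>" for l
    using that
  proof (induction l rule: lattice_induct)
    case 1
    show ?case by (rule exI[of _ 0]) simp
  next
    case (2 l)
    have e: "eventually (\<lambda>z. G (z + (l + 1)) = G (z + l)) (cosparse UNIV)"
      using cosparse_shift[OF G1, of l] by (simp add: add.assoc)
    show ?case
    proof safe
      fix k assume "eventually (\<lambda>z. G (z + l) = G z + k) (cosparse UNIV)"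
      with e have "eventually (\<lambda>z. G (z + (l + 1)) = G z + (k)) (cosparse UNIV)"
        by eventually_elim (simp)
      then show "\<exists>k. eventually (\<lambda>z. G (z + (l + 1)) = G z + k) (cosparse UNIV)" by blast
    next
      fix k assume "eventually (\<lambda>z. G (z + (l + 1)) = G z + k) (cosparse UNIV)"
      with e have "eventually (\<lambda>z. G (z + l) = G z + (k)) (cosparse UNIV)"
        by eventually_elim (simp)
      then show "\<exists>k. eventually (\<lambda>z. G (z + l) = G z + k) (cosparse UNIV)" by blast
    qed
  next
    case (3 l)
    have e: "eventually (\<lambda>z. G (z + (l + \<tau>)) = G (z + l) + c * (2 * pi * \<i>)) (cosparse UNIV)"
      using cosparse_shift[OF Gt, of l] by (simp add: add.assoc)
    show ?case
    proof safe
      fix k assume "eventually (\<lambda>z. G (z + l) = G z + k) (cosparse UNIV)"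
      with e have "eventually (\<lambda>z. G (z + (l + \<tau>)) = G z + (k + c * (2 * pi * \<i>))) (cosparse UNIV)"
        by eventually_elim (simp)
      then show "\<exists>k. eventually (\<lambda>z. G (z + (l + \<tau>)) = G z + k) (cosparse UNIV)" by blast
    next
      fix k assume "eventually (\<lambda>z. G (z + (l + \<tau>)) = G z + k) (cosparse UNIV)"
      with e have "eventually (\<lambda>z. G (z + l) = G z + (k - c * (2 * pi * \<i>))) (cosparse UNIV)"
        by eventually_elim (simp add: algebra_simps)
      then show "\<exists>k. eventually (\<lambda>z. G (z + l) = G z + k) (cosparse UNIV)" by blast
    qed
  qed
  have "((\<lambda>z. z * f z - c * (z * zeta z)) \<longlongrightarrow> c - c * 1) (at 0)"
    by (intro tendsto_intros f lim_zeta)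
  then have "((\<lambda>z. z ^ Suc 0 * G z) \<longlongrightarrow> 0) (at 0)" by (simp add: G_def algebra_simps)
  then obtain d where d: "G \<midarrow>0\<rightarrow> d" using mero_pole_order_lower[OF Gm, of 0] by auto
  have "\<not> is_pole G z" for z
  proof (cases "z \<in> \<Lambda>")
    case True
    then obtain k where k: "eventually (\<lambda>w. G (w + z) = G w + k) (cosparse UNIV)" using Gl by blast
    have "((\<lambda>w. G w + k) \<longlongrightarrow> d + k) (at 0)" by (intro tendsto_intros d)
    then have "((\<lambda>w. G (w + z)) \<longlongrightarrow> d + k) (at 0)"
      by (rule Lim_transform_eventually) (use cosparse_at[OF k, of 0] in eventually_elim, simp)
    then have "G \<midarrow>z\<rightarrow> d + k" using LIM_offset_zero_cancel[of G z "d + k"] by (simp add: add.commute)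
    then show ?thesis by (rule lim_not_pole)
  next
    case False
    have "reg G" unfolding G_def by (intro reg_intros f)
    then show ?thesis using False lim_not_pole unfolding reg_def by blast
  qed
  then obtain g where g: "g holomorphic_on UNIV" "eventually (\<lambda>z. G z = g z) (cosparse UNIV)"
    using entire_extension[OF Gm] by blast
  have gs: "(\<lambda>z. g (z + c)) holomorphic_on UNIV" for c
    by (intro holomorphic_on_compose_gen[of "\<lambda>z. z + c" UNIV g UNIV, unfolded o_def]
          holomorphic_intros g) auto
  have "g (z + 1) = g z" for z
  proof (rule entire_eqI[where f = "\<lambda>z. g (z + 1)" and g = g])
    show "eventually (\<lambda>z. g (z + 1) = g z) (cosparse UNIV)"
      using G1 g(2) cosparse_shift[OF g(2), of 1] by eventually_elim simp
  qed (use g gs in auto)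
  moreover have "g (z + \<tau>) = g z + c * (2 * pi * \<i>)" for z
  proof (rule entire_eqI[where f = "\<lambda>z. g (z + \<tau>)" and g = "\<lambda>z. g z + c * (2 * pi * \<i>)"])
    show "eventually (\<lambda>z. g (z + \<tau>) = g z + c * (2 * pi * \<i>)) (cosparse UNIV)"
      using Gt g(2) cosparse_shift[OF g(2), of \<tau>] by eventually_elim simp
  qed (use g gs in \<open>auto intro!: holomorphic_intros\<close>)
  ultimately have "c * (2 * pi * \<i>) = 0" using entire_quasi_periodic[OF g(1)] by blast
  then show ?thesis by simp
qed

text \<open>After subtracting the multiple of \<open>wp\<close> with the same leading term at most a
  simple pole is left; \<open>ell_span1\<close> removes it and \<open>ell_span0\<close> makes the
  rest constant. The next three lemmas continue this computation of Riemann-Roch spaces.\<close>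

lemma ell_span2:
  assumes f: "ell f" "reg f" "((\<lambda>z. z ^ 2 * f z) \<longlongrightarrow> c) (at 0)"
  shows "\<exists>c0. eventually (\<lambda>z. f z = c0 + c * wp z) (cosparse UNIV)"
proof -
  define g where "g = (\<lambda>z. f z - c * wp z)"
  have g: "ell g" "reg g" unfolding g_def by (intro ell_intros reg_intros f ell_wp)+
  have "((\<lambda>z. z ^ 2 * f z - c * (z ^ 2 * wp z)) \<longlongrightarrow> c - c * 1) (at 0)"
    by (intro tendsto_intros f lim_wp)
  then have "((\<lambda>z. z ^ Suc 1 * g z) \<longlongrightarrow> 0) (at 0)" by (simp add: g_def algebra_simps power2_eq_square)
  then obtain d where d: "((\<lambda>z. z ^ 1 * g z) \<longlongrightarrow> d) (at 0)"
    using mero_pole_order_lower[OF ell_mero[OF g(1)]] by blast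
  then have "d = 0" using ell_span1[OF g] by simp
  then have "((\<lambda>z. z ^ Suc 0 * g z) \<longlongrightarrow> 0) (at 0)" using d by simp
  then obtain c0 where "g \<midarrow>0\<rightarrow> c0"
    using mero_pole_order_lower[OF ell_mero[OF g(1)], of 0] by auto
  then have "eventually (\<lambda>z. g z = c0) (cosparse UNIV)" by (rule ell_span0[OF g])
  then have "eventually (\<lambda>z. f z = c0 + c * wp z) (cosparse UNIV)"
    by eventually_elim (simp add: g_def algebra_simps)
  then show ?thesis by blast
qed

text \<open>The factor \<open>- c / 2\<close> compensates the leading coefficient -2 of
  \<open>wp'\<close>.\<close>

lemma ell_span3:
  assumes f: "ell f" "reg f" "((\<lambda>z. z ^ 3 * f z) \<longlongrightarrow> c) (at 0)"
  shows "\<exists>c0 c1. eventually (\<lambda>z. f z = c0 + c1 * wp z - c / 2 * wp' z) (cosparse UNIV)"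
proof -
  define g where "g = (\<lambda>z. f z + c / 2 * wp' z)"
  have g: "ell g" "reg g" unfolding g_def by (intro ell_intros reg_intros f ell_wp')+
  have "((\<lambda>z. z ^ 3 * f z + c / 2 * (z ^ 3 * wp' z)) \<longlongrightarrow> c + c / 2 * (- 2)) (at 0)"
    by (intro tendsto_intros f lim_wp')
  moreover have "(\<lambda>z. z ^ 3 * f z + c / 2 * (z ^ 3 * wp' z)) = (\<lambda>z. z ^ Suc 2 * g z)"
    by (auto simp: g_def power_numeral_reduce ring_distribs)
  ultimately have "((\<lambda>z. z ^ Suc 2 * g z) \<longlongrightarrow> 0) (at 0)" by simp
  then obtain c1 where "((\<lambda>z. z ^ 2 * g z) \<longlongrightarrow> c1) (at 0)"
    using mero_pole_order_lower[OF ell_mero[OF g(1)]] by blast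
  then obtain c0 where "eventually (\<lambda>z. g z = c0 + c1 * wp z) (cosparse UNIV)"
    using ell_span2[OF g] by blast
  then have "eventually (\<lambda>z. f z = c0 + c1 * wp z - c / 2 * wp' z) (cosparse UNIV)"
    by eventually_elim (simp add: g_def algebra_simps)
  then show ?thesis by blast
qed

lemma ell_span4:
  assumes f: "ell f" "reg f" "((\<lambda>z. z ^ 4 * f z) \<longlongrightarrow> c) (at 0)"
  shows "\<exists>c0 c1 c2. eventually (\<lambda>z. f z = c0 + c1 * wp z + c2 * wp' z + c * wp z ^ 2) (cosparse UNIV)"
proof -
  define g where "g = (\<lambda>z. f z - c * wp z ^ 2)"
  have g: "ell g" "reg g" unfolding g_def by (intro ell_intros reg_intros f ell_wp)+
  have "((\<lambda>z. z ^ 4 * f z - c * (z ^ 2 * wp z) ^ 2) \<longlongrightarrow> c - c * 1 ^ 2) (at 0)"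
    by (intro tendsto_intros f lim_wp)
  moreover have "(\<lambda>z. z ^ 4 * f z - c * (z ^ 2 * wp z) ^ 2) = (\<lambda>z. z ^ Suc 3 * g z)"
    by (auto simp: g_def power_numeral_reduce ring_distribs)
  ultimately have "((\<lambda>z. z ^ Suc 3 * g z) \<longlongrightarrow> 0) (at 0)" by simp
  then obtain c1 where "((\<lambda>z. z ^ 3 * g z) \<longlongrightarrow> c1) (at 0)"
    using mero_pole_order_lower[OF ell_mero[OF g(1)]] by blast
  then obtain c0 c2 where "eventually (\<lambda>z. g z = c0 + c2 * wp z - c1 / 2 * wp' z) (cosparse UNIV)"
    using ell_span3[OF g] by blast
  then have "eventually (\<lambda>z. f z = c0 + c2 * wp z + (- c1 / 2) * wp' z + c * wp z ^ 2) (cosparse UNIV)"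
    by eventually_elim (simp add: g_def algebra_simps)
  then show ?thesis by blast
qed

text \<open>Order 5 is the largest one needed: it occurs for the square root in the half-period
  cases and for a cover multiplied by \<open>wp - wp a\<close>.\<close>

lemma ell_span5:
  assumes f: "ell f" "reg f" "((\<lambda>z. z ^ 5 * f z) \<longlongrightarrow> c) (at 0)"
  shows "\<exists>c0 c1 c2 c3. eventually (\<lambda>z. f z = c0 + c1 * wp z + c2 * wp' z + c3 * wp z ^ 2
    - c / 2 * (wp z * wp' z)) (cosparse UNIV)"
proof -
  define g where "g = (\<lambda>z. f z + c / 2 * (wp z * wp' z))"
  have g: "ell g" "reg g" unfolding g_def by (intro ell_intros reg_intros f ell_wp ell_wp')+
  have "((\<lambda>z. z ^ 5 * f z + c / 2 * ((z ^ 2 * wp z) * (z ^ 3 * wp' z))) \<longlongrightarrow> c + c / 2 * (1 * (- 2))) (at 0)"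
    by (intro tendsto_intros f lim_wp lim_wp')
  moreover have "(\<lambda>z. z ^ 5 * f z + c / 2 * ((z ^ 2 * wp z) * (z ^ 3 * wp' z))) = (\<lambda>z. z ^ Suc 4 * g z)"
    by (auto simp: g_def power_numeral_reduce ring_distribs)
  ultimately have "((\<lambda>z. z ^ Suc 4 * g z) \<longlongrightarrow> 0) (at 0)" by simp
  then obtain c3 where "((\<lambda>z. z ^ 4 * g z) \<longlongrightarrow> c3) (at 0)"
    using mero_pole_order_lower[OF ell_mero[OF g(1)]] by blast
  then obtain c0 c1 c2 where "eventually (\<lambda>z. g z = c0 + c1 * wp z + c2 * wp' z + c3 * wp z ^ 2) (cosparse UNIV)"
    using ell_span4[OF g] by blast
  then have "eventually (\<lambda>z. f z = c0 + c1 * wp z + c2 * wp' z + c3 * wp z ^ 2 - c / 2 * (wp z * wp' z)) (cosparse UNIV)"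
    by eventually_elim (simp add: g_def algebra_simps)
  then show ?thesis by blast
qed

end

section \<open>The differential equation and the values of \<open>wp\<close>\<close>

lemma weierstrass_identity:
  fixes z \<alpha> C D :: complex
  assumes "z \<noteq> 0"
  shows "(- 2 / z ^ 3 + 2 * \<alpha> * z + z ^ 3 * D) ^ 2 - 4 * (1 / z ^ 2 + \<alpha> * z ^ 2 + z ^ 4 * C) ^ 3
      + 20 * \<alpha> * (1 / z ^ 2 + \<alpha> * z ^ 2 + z ^ 4 * C) =
    - 4 * D + 4 * \<alpha>\<^sup>2 * z\<^sup>2 + 4 * \<alpha> * z ^ 4 * D + z ^ 6 * D\<^sup>2 - 12 * C - 12 * z\<^sup>2 * (\<alpha> + z\<^sup>2 * C)\<^sup>2
      - 4 * z ^ 6 * (\<alpha> + z\<^sup>2 * C) ^ 3 + 20 * \<alpha> * (\<alpha> * z\<^sup>2 + z ^ 4 * C)"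
proof -
  \<comment> \<open>With \<open>u * z = 1\<close> the claim is a polynomial identity: the terms of
    degree -6 cancel, and \<open>20 * \<alpha> * wp\<close> is chosen to cancel those of degree
    -2.\<close>
  define u where "u = 1 / z"
  have u: "u * z = 1" using assms by (simp add: u_def)
  have e: "- 2 / z ^ 3 = - 2 * u ^ 3" "1 / z ^ 2 = u ^ 2" by (simp_all add: u_def power_divide)
  show ?thesis unfolding e using u by algebra
qed

context half_plane
begin

lemma off_Lambda_value_eq:
  assumes "f holomorphic_on (- \<Lambda>)" "eventually (\<lambda>z. f z = c) (cosparse UNIV)" "z \<notin> \<Lambda>"
  shows "f z = c"
  by (rule holo_off_Lambda_eqI[OF assms(1) _ assms(2,3)]) (intro holomorphic_intros)

text \<open>The combination \<open>G\<close> has no polar part at 0, so it is an elliptic function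
  without poles and hence constant.\<close>

lemma wp_ode_exists:
  "\<exists>a b. \<forall>z. z \<notin> \<Lambda> \<longrightarrow> wp' z ^ 2 = 4 * wp z ^ 3 - a * wp z - b"
proof -
  obtain r C \<alpha> where C: "r > 0" "C holomorphic_on ball 0 r"
    "\<And>z. z \<in> ball 0 r - {0} \<Longrightarrow> z \<notin> \<Lambda>"
    "\<And>z. z \<in> ball 0 r - {0} \<Longrightarrow> wp z = 1 / z ^ 2 + \<alpha> * z ^ 2 + z ^ 4 * C z"
    "\<And>z. z \<in> ball 0 r - {0} \<Longrightarrow> wp' z = - 2 / z ^ 3 + 2 * \<alpha> * z + z ^ 3 * (4 * C z + z * deriv C z)"
    by (rule wp_local) blast
  define G where "G = (\<lambda>z. wp' z ^ 2 - 4 * wp z ^ 3 + 20 * \<alpha> * wp z)"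
  have "ell G" "reg G" unfolding G_def by (intro ell_intros reg_intros ell_wp ell_wp')+
  define D where "D = (\<lambda>z. 4 * C z + z * deriv C z)"
  define H where "H = (\<lambda>z. - 4 * D z + 4 * \<alpha>\<^sup>2 * z\<^sup>2 + 4 * \<alpha> * z ^ 4 * D z + z ^ 6 * (D z)\<^sup>2 - 12 * C z
    - 12 * z\<^sup>2 * (\<alpha> + z\<^sup>2 * C z)\<^sup>2 - 4 * z ^ 6 * (\<alpha> + z\<^sup>2 * C z) ^ 3 + 20 * \<alpha> * (\<alpha> * z\<^sup>2 + z ^ 4 * C z))"
  have "D holomorphic_on ball 0 r" unfolding D_def by (intro holomorphic_intros C) auto
  then have "H holomorphic_on ball 0 r" unfolding H_def by (intro holomorphic_intros C)
  then have "H \<midarrow>0\<rightarrow> H 0"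
    using holomorphic_on_imp_continuous_on[of H "ball 0 r"] C(1)
    by (simp add: continuous_on_eq_continuous_at isCont_def)
  then have "G \<midarrow>0\<rightarrow> H 0"
  proof (rule Lim_transform_within_open[where s = "ball 0 r"])
    fix z :: complex assume z: "z \<in> ball 0 r" "z \<noteq> 0"
    have "wp z = 1 / z ^ 2 + \<alpha> * z ^ 2 + z ^ 4 * C z" "wp' z = - 2 / z ^ 3 + 2 * \<alpha> * z + z ^ 3 * D z"
      using C(4,5)[of z] z by (auto simp: D_def)
    then show "H z = G z"
      using weierstrass_identity[OF z(2), of \<alpha> "D z" "C z"] unfolding G_def H_def by simp
  qed (use C(1) in auto)
  then have ev: "eventually (\<lambda>z. G z = H 0) (cosparse UNIV)"
    by (rule ell_span0[OF \<open>ell G\<close> \<open>reg G\<close>])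
  have "G holomorphic_on (- \<Lambda>)" unfolding G_def by (intro holomorphic_intros wp_holo wp'_holo)
  then have "G z = H 0" if "z \<notin> \<Lambda>" for z using ev that by (rule off_Lambda_value_eq)
  then have "wp' z ^ 2 = 4 * wp z ^ 3 - 20 * \<alpha> * wp z - (- H 0)" if "z \<notin> \<Lambda>" for z
    using that unfolding G_def by (simp add: algebra_simps)
  then show ?thesis by blast
qed

text \<open>The multipliers of numerator and denominator cancel, so the theta quotient is elliptic
  with one double pole and hence of the form \<open>c0 + k * wp\<close>; its zero at
  \<open>a\<close> determines \<open>c0\<close>. This yields all zeros of \<open>wp z - wp a\<close>
  with orders.\<close>

lemma wp_diff_theta:
  assumes a: "a \<notin> \<Lambda>"
  shows "\<exists>c. c \<noteq> 0 \<and> (\<forall>z. z \<notin> \<Lambda> \<longrightarrow> wp z - wp a = c * (theta (z - a) * theta (z + a) / theta z ^ 2))"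
proof -
  define F where "F = (\<lambda>z. theta (z - a) * theta (z + a) / theta z ^ 2)"
  have Fh: "F holomorphic_on (- \<Lambda>)"
    unfolding F_def by (intro holomorphic_intros) (auto simp: theta_eq_0_iff)
  have "F meromorphic_on UNIV"
    unfolding F_def by (intro meromorphic_intros holo_mero holomorphic_intros)
  moreover have "F (z + 1) = F z" for z
    using theta_plus_1[of "z - a"] theta_plus_1[of "z + a"] theta_plus_1[of z]
    by (simp add: F_def algebra_simps)
  moreover have "F (z + \<tau>) = F z" for z
  proof -
    define E where "E = (\<lambda>z. exp (- (2 * pi * \<i>) * z + pi * \<i>))"
    have t: "theta (z + \<tau>) = E z * theta z" for z by (simp only: theta_plus_tau_exp E_def)
    have "E (z - a) * E (z + a) = E z ^ 2"
      by (simp add: E_def power2_eq_square algebra_simps flip: exp_add)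
    moreover have "E z \<noteq> 0" by (simp add: E_def)
    moreover have "F (z + \<tau>) = (E (z - a) * theta (z - a)) * (E (z + a) * theta (z + a)) / (E z * theta z) ^ 2"
      using t[of "z - a"] t[of "z + a"] t[of z] by (simp add: F_def algebra_simps)
    moreover have "(E (z - a) * theta (z - a)) * (E (z + a) * theta (z + a)) =
        (E (z - a) * E (z + a)) * (theta (z - a) * theta (z + a))" by (simp add: mult_ac)
    ultimately show ?thesis by (simp add: F_def power_mult_distrib)
  qed
  ultimately have "ell F" by (simp add: ell_iff)
  have t0: "((\<lambda>z. theta z / z) \<longlongrightarrow> deriv theta 0) (at 0)"
    using theta_deriv[of 0] by (simp add: has_field_derivative_iff)
  have lim: "(\<lambda>z. theta (z + b)) \<midarrow>0\<rightarrow> theta (0 + b)" for b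
  proof -
    have "(\<lambda>z. theta (z + b)) holomorphic_on UNIV" by (intro holomorphic_intros)
    from holomorphic_on_imp_continuous_on[OF this] have "isCont (\<lambda>z. theta (z + b)) 0"
      by (simp add: continuous_on_eq_continuous_at)
    then show ?thesis by (simp only: isCont_def)
  qed
  have lim': "(\<lambda>z. theta (z - a)) \<midarrow>0\<rightarrow> theta (0 - a)" using lim[of "- a"] by simp
  have "((\<lambda>z. theta (z - a) * theta (z + a) / (theta z / z) ^ 2) \<longlongrightarrow>
      theta (0 - a) * theta (0 + a) / deriv theta 0 ^ 2) (at 0)"
    by (intro tendsto_divide tendsto_mult tendsto_power lim lim' t0) (simp add: deriv_theta_0)
  moreover have "(\<lambda>z. theta (z - a) * theta (z + a) / (theta z / z) ^ 2) = (\<lambda>z. z ^ 2 * F z)"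
    by (auto simp: F_def power_divide)
  ultimately obtain k where k: "((\<lambda>z. z ^ 2 * F z) \<longlongrightarrow> k) (at 0)" "k \<noteq> 0"
    using a deriv_theta_0 by (auto simp: theta_eq_0_iff)
  obtain c0 where "eventually (\<lambda>z. F z = c0 + k * wp z) (cosparse UNIV)"
    using ell_span2[OF \<open>ell F\<close> reg_holo[OF Fh] k(1)] by blast
  then have F: "F z = c0 + k * wp z" if "z \<notin> \<Lambda>" for z
    by (rule holo_off_Lambda_eqI[OF Fh _ _ that, rotated]) (intro holomorphic_intros wp_holo)
  have "F a = 0" by (simp add: F_def)
  then have "c0 = - k * wp a" using F[OF a] by (simp add: eq_neg_iff_add_eq_0)
  then have "wp z - wp a = 1 / k * F z" if "z \<notin> \<Lambda>" for z
    using F[OF that] k(2) by (simp add: field_simps)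
  then show ?thesis using k(2) unfolding F_def by (intro exI[of _ "1 / k"]) auto
qed

lemma wp_eq_iff:
  assumes "a \<notin> \<Lambda>" "z \<notin> \<Lambda>"
  shows "wp z = wp a \<longleftrightarrow> z - a \<in> \<Lambda> \<or> z + a \<in> \<Lambda>"
proof -
  obtain c where "c \<noteq> 0" "wp z - wp a = c * (theta (z - a) * theta (z + a) / theta z ^ 2)"
    using wp_diff_theta[OF assms(1)] assms(2) by blast
  then have "wp z - wp a = 0 \<longleftrightarrow> theta (z - a) * theta (z + a) = 0"
    using assms(2) by (simp add: theta_eq_0_iff)
  then show ?thesis by (simp add: theta_eq_0_iff)
qed

lemma zorder_wp_diff:
  assumes "a \<notin> \<Lambda>"
  shows "zorder (\<lambda>z. wp z - wp a) z =
    of_bool (z - a \<in> \<Lambda>) + of_bool (z + a \<in> \<Lambda>) - 2 * of_bool (z \<in> \<Lambda>)"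
proof -
  obtain c where c: "c \<noteq> 0" "\<And>z. z \<notin> \<Lambda> \<Longrightarrow> wp z - wp a = c * (theta (z - a) * theta (z + a) / theta z ^ 2)"
    using wp_diff_theta[OF assms] by blast
  have m: "(\<lambda>z. theta (z - b)) meromorphic_on {z}" for b by (rule mero_at[OF theta_shift_mero])
  note nz = cosparse_frequently[OF theta_nz_cosparse]
  have nz2: "frequently (\<lambda>w. theta (w - a) * theta (w - (- a)) \<noteq> 0) (at z)"
    by (rule cosparse_frequently) (use theta_nz_cosparse[of a] theta_nz_cosparse[of "- a"] in eventually_elim, simp)
  have nz3: "frequently (\<lambda>w. theta (w - 0) ^ 2 \<noteq> 0) (at z)"
    by (rule cosparse_frequently) (use theta_nz_cosparse[of 0] in eventually_elim, simp)
  have "zorder (\<lambda>z. wp z - wp a) z = zorder (\<lambda>z. c * (theta (z - a) * theta (z - (- a)) / theta (z - 0) ^ 2)) z"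
    by (rule zorder_cong) (use cosparse_at[OF Lambda_cosparse, of z] in eventually_elim, auto simp: c(2))
  also have "\<dots> = zorder (\<lambda>z. theta (z - a) * theta (z - (- a)) / theta (z - 0) ^ 2) z"
    by (rule zorder_cmult[OF c(1)])
  also have "\<dots> = zorder (\<lambda>z. theta (z - a)) z + zorder (\<lambda>z. theta (z - (- a))) z - 2 * zorder (\<lambda>z. theta (z - 0)) z"
    using zorder_power[OF m[of 0] nz, of 2]
    by (subst Meromorphic.zorder_divide[OF _ nz2 _ nz3] , (intro meromorphic_intros m)+,
        subst Meromorphic.zorder_mult[OF m nz m nz], simp)
  also have "\<dots> = of_bool (z - a \<in> \<Lambda>) + of_bool (z + a \<in> \<Lambda>) - 2 * of_bool (z \<in> \<Lambda>)"
    by (subst (1 2 3) zorder_theta_shift) simp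
  finally show ?thesis .
qed

lemma wp_nz_cosparse: "eventually (\<lambda>z. wp z \<noteq> c) (cosparse UNIV)"
proof (rule ccontr)
  assume "\<not> ?thesis"
  then have "eventually (\<lambda>z. wp z = c) (cosparse UNIV)"
    using cosparse_mero_cases[OF wp_mero(1), of c] by blast
  then have w: "wp z = c" if "z \<notin> \<Lambda>" for z using that by (rule off_Lambda_value_eq[OF wp_holo])
  have "((\<lambda>z. z ^ 2 * c) \<longlongrightarrow> 1) (at 0)"
    by (rule Lim_transform_eventually[OF lim_wp])
       (use cosparse_at[OF Lambda_cosparse, of 0] in eventually_elim, simp add: w)
  moreover have "((\<lambda>z. z ^ 2 * c) \<longlongrightarrow> 0 ^ 2 * c) (at 0)" by (intro tendsto_intros)
  ultimately have "(1::complex) = 0 ^ 2 * c" by (rule tendsto_unique[rotated]) simp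
  then show False by simp
qed

text \<open>If \<open>c\<close> were omitted, \<open>1 / (wp - c)\<close> would be elliptic without
  poles and vanish at 0, hence vanish identically.\<close>

lemma wp_surj:
  obtains z where "z \<notin> \<Lambda>" "wp z = c"
proof (rule ccontr)
  assume "\<not> thesis"
  then have n: "\<And>z. z \<notin> \<Lambda> \<Longrightarrow> wp z \<noteq> c" using that by blast
  define g where "g = (\<lambda>z. 1 / (wp z - c))"
  have "ell g" unfolding g_def by (intro ell_intros ell_wp)
  have "g holomorphic_on (- \<Lambda>)" unfolding g_def by (intro holomorphic_intros wp_holo) (use n in auto)
  have "((\<lambda>z. z ^ 2 / (z ^ 2 * wp z - c * z ^ 2)) \<longlongrightarrow> 0 ^ 2 / (1 - c * 0 ^ 2)) (at 0)"
    by (intro tendsto_intros lim_wp) auto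
  then have "((\<lambda>z. z ^ 2 / (z ^ 2 * wp z - c * z ^ 2)) \<longlongrightarrow> 0) (at 0)" by simp
  then have "g \<midarrow>0\<rightarrow> 0"
  proof (rule Lim_transform_within_open[where s = UNIV])
    fix z :: complex assume "z \<noteq> 0"
    have "z ^ 2 * wp z - c * z ^ 2 = z ^ 2 * (wp z - c)" by (simp add: algebra_simps)
    then show "z ^ 2 / (z ^ 2 * wp z - c * z ^ 2) = g z" using \<open>z \<noteq> 0\<close> by (simp add: g_def)
  qed auto
  then have "eventually (\<lambda>z. g z = 0) (cosparse UNIV)"
    by (rule ell_span0[OF \<open>ell g\<close> reg_holo[OF \<open>g holomorphic_on (- \<Lambda>)\<close>]])
  moreover have "eventually (\<lambda>z. g z \<noteq> 0) (cosparse UNIV)"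
    using wp_nz_cosparse[of c] by eventually_elim (simp add: g_def)
  ultimately have "eventually (\<lambda>z::complex. False) (cosparse UNIV)" by eventually_elim simp
  then show False using cosparse_ex by blast
qed

section \<open>Half-period values and the Weierstrass cubic\<close>

definition e1 :: complex where "e1 = wp (1 / 2)"
definition e2 :: complex where "e2 = wp (\<tau> / 2)"
definition e3 :: complex where "e3 = wp ((1 + \<tau>) / 2)"

lemma half_notin:
  assumes "l \<in> fund_par \<tau>" "l \<noteq> 0"
  shows "l \<notin> \<Lambda>"
  using fund_par_unique[OF assms(1) fund_par_0] assms(2) by auto

lemma half_in_fund: "1 / 2 \<in> fund_par \<tau>" "\<tau> / 2 \<in> fund_par \<tau>" "(1 + \<tau>) / 2 \<in> fund_par \<tau>"
  unfolding fund_par_def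
    apply (rule CollectI, rule exI[of _ "1/2"], rule exI[of _ 0], simp)
   apply (rule CollectI, rule exI[of _ 0], rule exI[of _ "1/2"], simp)
  apply (rule CollectI, rule exI[of _ "1/2"], rule exI[of _ "1/2"], simp add: add_divide_distrib)
  done

lemma tau_nz: "\<tau> \<noteq> 0" "1 + \<tau> \<noteq> 0" "\<tau> \<noteq> 1"
  using Im_pos by (auto simp: complex_eq_iff)

lemma half_notin': "1 / 2 \<notin> \<Lambda>" "\<tau> / 2 \<notin> \<Lambda>" "(1 + \<tau>) / 2 \<notin> \<Lambda>"
  using half_notin[OF half_in_fund(1)] half_notin[OF half_in_fund(2)] half_notin[OF half_in_fund(3)] tau_nz by auto

lemma wp'_half: "a \<notin> \<Lambda> \<Longrightarrow> 2 * a \<in> \<Lambda> \<Longrightarrow> wp' a = 0"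
  using wp'_periodic[of "- a" "2 * a"] wp'_uminus[of a] by simp

lemma two_half: "2 * (1 / 2) \<in> \<Lambda>" "2 * (\<tau> / 2) \<in> \<Lambda>" "2 * ((1 + \<tau>) / 2) \<in> \<Lambda>"
proof -
  have h: "2 * (x / 2) = x" for x :: complex by simp
  show "2 * (1 / 2) \<in> \<Lambda>" "2 * (\<tau> / 2) \<in> \<Lambda>" "2 * ((1 + \<tau>) / 2) \<in> \<Lambda>"
    unfolding h by (auto intro: lattice_add)
qed

lemma e_distinct: "e1 \<noteq> e2" "e1 \<noteq> e3" "e2 \<noteq> e3"
proof -
  have neq: "wp a \<noteq> wp b"
    if "a \<in> fund_par \<tau>" "b \<in> fund_par \<tau>" "a \<noteq> b" "a \<notin> \<Lambda>" "b \<notin> \<Lambda>" "2 * b \<in> \<Lambda>" for a b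
  proof
    assume "wp a = wp b"
    then have "a - b \<in> \<Lambda> \<or> a + b \<in> \<Lambda>" using wp_eq_iff that by blast
    \<comment> \<open>For a half-period \<open>b\<close> the two alternatives of
      \<open>wp_eq_iff\<close> are congruent to each other.\<close>
    moreover have "a + b - 2 * b \<in> \<Lambda> \<longleftrightarrow> a + b \<in> \<Lambda>" by (rule lattice_diff_iff[OF that(6)])
    ultimately have "a - b \<in> \<Lambda>" by (auto simp: algebra_simps)
    then show False using fund_par_unique[OF that(1,2)] that(3) by blast
  qed
  have d: "(1::complex) / 2 \<noteq> \<tau> / 2" "1 / 2 \<noteq> (1 + \<tau>) / 2" "\<tau> / 2 \<noteq> (1 + \<tau>) / 2"
    using tau_nz by auto
  show "e1 \<noteq> e2" "e1 \<noteq> e3" "e2 \<noteq> e3"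
    unfolding e1_def e2_def e3_def
    by (intro neq half_in_fund half_notin' two_half d)+
qed

text \<open>Dividing differences of the equations by differences of the roots gives Vieta's
  relations; the missing quadratic term makes the sum 0.\<close>

lemma cubic_three_roots:
  fixes a b x1 x2 x3 :: complex
  assumes "4 * x1 ^ 3 - a * x1 - b = 0" "4 * x2 ^ 3 - a * x2 - b = 0" "4 * x3 ^ 3 - a * x3 - b = 0"
    and "x1 \<noteq> x2" "x1 \<noteq> x3" "x2 \<noteq> x3"
  shows "x1 + x2 + x3 = 0" "4 * x ^ 3 - a * x - b = 4 * (x - x1) * (x - x2) * (x - x3)"
proof -
  have "(x1 - x2) * (4 * (x1\<^sup>2 + x1 * x2 + x2\<^sup>2) - a) = 0" using assms(1,2) by algebra
  then have 1: "a = 4 * (x1\<^sup>2 + x1 * x2 + x2\<^sup>2)" using assms(4) by simp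
  have "(x1 - x3) * (4 * (x1\<^sup>2 + x1 * x3 + x3\<^sup>2) - a) = 0" using assms(1,3) by algebra
  then have 2: "a = 4 * (x1\<^sup>2 + x1 * x3 + x3\<^sup>2)" using assms(5) by simp
  have "(x2 - x3) * (x1 + x2 + x3) = 0" using 1 2 by algebra
  then show s: "x1 + x2 + x3 = 0" using assms(6) by simp
  have x3: "x3 = - x1 - x2" using s by algebra
  have b: "b = 4 * x1 ^ 3 - a * x1" using assms(1) by algebra
  show "4 * x ^ 3 - a * x - b = 4 * (x - x1) * (x - x2) * (x - x3)"
    unfolding b 1 x3 by algebra
qed

theorem e_sum: "e1 + e2 + e3 = 0"
  and wp_ode: "z \<notin> \<Lambda> \<Longrightarrow> wp' z ^ 2 = 4 * (wp z - e1) * (wp z - e2) * (wp z - e3)"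
proof -
  obtain a b where ab: "\<And>z. z \<notin> \<Lambda> \<Longrightarrow> wp' z ^ 2 = 4 * wp z ^ 3 - a * wp z - b"
    using wp_ode_exists by blast
  have r: "4 * wp w ^ 3 - a * wp w - b = 0" if "w \<notin> \<Lambda>" "2 * w \<in> \<Lambda>" for w
    using ab[OF that(1)] wp'_half[OF that] by simp
  note c = cubic_three_roots[OF r r r e_distinct[unfolded e1_def e2_def e3_def],
      OF half_notin'(1) two_half(1) half_notin'(2) two_half(2) half_notin'(3) two_half(3)]
  show "e1 + e2 + e3 = 0" using c(1) by (simp only: e1_def e2_def e3_def)
  show "wp' z ^ 2 = 4 * (wp z - e1) * (wp z - e2) * (wp z - e3)" if "z \<notin> \<Lambda>"
    using ab[OF that] c(2)[of "wp z"] by (simp only: e1_def e2_def e3_def)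
qed

text \<open>The equation fixes \<open>wp'\<close> up to sign once \<open>wp\<close> is given, and
  replacing \<open>z\<close> by \<open>- z\<close> changes that sign.\<close>

lemma curve_param:
  assumes "y ^ 2 = 4 * (x - e1) * (x - e2) * (x - e3)"
  obtains z where "z \<notin> \<Lambda>" "wp z = x" "wp' z = y"
proof -
  obtain z where z: "z \<notin> \<Lambda>" "wp z = x" by (rule wp_surj)
  then have "wp' z ^ 2 = y ^ 2" using wp_ode[of z] assms by simp
  then have "wp' z = y \<or> wp' z = - y" by (simp add: power2_eq_iff)
  then show ?thesis
  proof
    assume "wp' z = - y"
    then show ?thesis using that[of "- z"] z wp_uminus wp'_uminus by simp
  qed (use that z in blast)
qed

text \<open>The differential equation puts \<open>wp z\<close> among the half-period values, and
  these are attained only at half-periods.\<close>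

lemma wp'_eq_0: "z \<notin> \<Lambda> \<Longrightarrow> wp' z = 0 \<longleftrightarrow> 2 * z \<in> \<Lambda>"
proof
  assume z: "z \<notin> \<Lambda>" and "wp' z = 0"
  then have "wp z = e1 \<or> wp z = e2 \<or> wp z = e3" using wp_ode[OF z] by simp
  then obtain w where w: "w \<notin> \<Lambda>" "2 * w \<in> \<Lambda>" "wp z = wp w"
    unfolding e1_def e2_def e3_def using half_notin' two_half by metis
  then consider "z - w \<in> \<Lambda>" | "z + w \<in> \<Lambda>" using wp_eq_iff[OF w(1) z] by blast
  then show "2 * z \<in> \<Lambda>"
  proof cases
    case 1
    then have "(z - w) + (z - w) + 2 * w \<in> \<Lambda>" by (intro lattice_add w)
    then show ?thesis by (simp add: algebra_simps)
  next
    case 2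
    have "(z + w) + (z + w) - 2 * w \<in> \<Lambda>" by (rule lattice_diff[OF lattice_add[OF 2 2] w(2)])
    then show ?thesis by (simp add: algebra_simps)
  qed
qed (rule wp'_half)

definition g2 :: complex where "g2 = - 4 * (e1 * e2 + e1 * e3 + e2 * e3)"
definition g3 :: complex where "g3 = 4 * e1 * e2 * e3"

lemma cubic_g: "4 * (x - e1) * (x - e2) * (x - e3) = 4 * x ^ 3 - g2 * x - g3"
  using e_sum unfolding g2_def g3_def by algebra

lemma wp_ode': "z \<notin> \<Lambda> \<Longrightarrow> wp' z ^ 2 = 4 * wp z ^ 3 - g2 * wp z - g3"
  unfolding cubic_g[symmetric] by (rule wp_ode)

lemma wp'_nz_cosparse: "eventually (\<lambda>z. wp' z \<noteq> 0) (cosparse UNIV)"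
  using wp_nz_cosparse[of e1] wp_nz_cosparse[of e2] wp_nz_cosparse[of e3] Lambda_cosparse
proof eventually_elim
  case (elim z)
  then have "wp' z ^ 2 \<noteq> 0" using wp_ode[of z] by simp
  then show ?case by auto
qed

text \<open>Differentiating the Weierstrass equation gives this multiplied by
  \<open>2 * wp'\<close>. At half-periods, where that factor vanishes, it follows by
  continuity.\<close>

lemma wp'': "z \<notin> \<Lambda> \<Longrightarrow> deriv wp' z = 6 * wp z ^ 2 - g2 / 2"
proof (rule holo_off_Lambda_eqI[where f = "deriv wp'" and g = "\<lambda>z. 6 * wp z ^ 2 - g2 / 2"])
  have "2 * wp' z * deriv wp' z = (12 * wp z ^ 2 - g2) * wp' z" if z: "z \<notin> \<Lambda>" for z
  proof -
    have 1: "((\<lambda>z. wp' z ^ 2) has_field_derivative 2 * wp' z * deriv wp' z) (at z)"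
      using DERIV_power[OF wp'_deriv[OF z], of 2] by (simp add: mult_ac)
    have "((\<lambda>z. 4 * wp z ^ 3 - g2 * wp z - g3) has_field_derivative (12 * wp z ^ 2 - g2) * wp' z) (at z)"
      using DERIV_diff[OF DERIV_diff[OF DERIV_cmult[OF DERIV_power[OF wp_deriv[OF z], of 3], of 4]
          DERIV_cmult[OF wp_deriv[OF z], of g2]] DERIV_const[of g3]]
      by (simp add: algebra_simps)
    then have 2: "((\<lambda>z. wp' z ^ 2) has_field_derivative (12 * wp z ^ 2 - g2) * wp' z) (at z)"
      by (rule has_field_derivative_transform_within_open[where S = "- \<Lambda>"])
         (use z Lambda_compl_open in \<open>auto simp: wp_ode'\<close>)
    show ?thesis by (rule DERIV_unique[OF 1 2])
  qed
  then have d: "deriv wp' z = 6 * wp z ^ 2 - g2 / 2" if "z \<notin> \<Lambda>" "wp' z \<noteq> 0" for z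
  proof -
    have "wp' z * (2 * deriv wp' z - (12 * wp z ^ 2 - g2)) = 0"
      using \<open>\<And>z. z \<notin> \<Lambda> \<Longrightarrow> 2 * wp' z * deriv wp' z = (12 * wp z ^ 2 - g2) * wp' z\<close>[OF that(1)] by algebra
    then have "2 * deriv wp' z = 12 * wp z ^ 2 - g2" using that(2) by simp
    then show ?thesis by (simp add: field_simps)
  qed
  show "eventually (\<lambda>z. deriv wp' z = 6 * wp z ^ 2 - g2 / 2) (cosparse UNIV)"
    using wp'_nz_cosparse Lambda_cosparse by eventually_elim (rule d)
qed (auto intro!: holomorphic_intros wp_holo wp'_holo Lambda_compl_open)

end

section \<open>Square roots of \<open>wp - e\<close> and their signs under the periods\<close>

context half_plane
begin

text \<open>At a half-period the two zeros \<open>a\<close> and \<open>- a\<close> merge into a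
  double zero, so all orders are even.\<close>

lemma wp_sqrt_exists:
  assumes a: "a \<notin> \<Lambda>" "2 * a \<in> \<Lambda>"
  obtains S s t where "S meromorphic_on UNIV" "eventually (\<lambda>z. S z ^ 2 = wp z - wp a) (cosparse UNIV)"
    "s \<in> {1, -1}" "t \<in> {1, -1}" "\<And>z. S (z + 1) = s * S z" "\<And>z. S (z + \<tau>) = t * S z"
proof -
  have "z + a \<in> \<Lambda> \<longleftrightarrow> z - a \<in> \<Lambda>" for z
    using lattice_add_iff[OF a(2), of "z - a"] by (simp add: algebra_simps)
  then have "even (zorder (\<lambda>z. wp z - wp a) z)" for z
    by (simp add: zorder_wp_diff[OF a(1)])
  moreover have "eventually (\<lambda>z. wp z - wp a \<noteq> 0) (cosparse UNIV)"
    using wp_nz_cosparse[of "wp a"] by eventually_elim simp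
  moreover have "ell (\<lambda>z. wp z - wp a)" by (intro ell_intros ell_wp)
  ultimately show ?thesis using ell_even_divisor_sqrt[of "\<lambda>z. wp z - wp a"] that by blast
qed

lemma sign_ell:
  assumes "f meromorphic_on UNIV" "g meromorphic_on UNIV" "s \<in> {1, -1}" "t \<in> {1, -1::complex}"
    and "\<And>z. f (z + 1) = s * f z" "\<And>z. f (z + \<tau>) = t * f z"
    and "\<And>z. g (z + 1) = s * g z" "\<And>z. g (z + \<tau>) = t * g z"
  shows "ell (\<lambda>z. f z * g z)"
proof -
  have "s * s = 1" "t * t = 1" using assms(3,4) by auto
  have "f (z + 1) * g (z + 1) = (s * s) * (f z * g z)" for z by (simp only: assms(5,7) mult_ac)
  moreover have "f (z + \<tau>) * g (z + \<tau>) = (t * t) * (f z * g z)" for z by (simp only: assms(6,8) mult_ac)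
  ultimately show ?thesis
    unfolding ell_iff by (simp add: \<open>s * s = 1\<close> \<open>t * t = 1\<close> meromorphic_on_mult assms(1,2))
qed

lemma lim_wp_minus: "((\<lambda>z. z ^ 2 * (wp z - c)) \<longlongrightarrow> 1) (at 0)"
proof -
  have "((\<lambda>z. z ^ 2 * wp z - c * z ^ 2) \<longlongrightarrow> 1 - c * 0 ^ 2) (at 0)"
    by (intro tendsto_intros lim_wp)
  then show ?thesis by (simp add: algebra_simps)
qed

text \<open>An elliptic root would have a simple pole at 0 and no others modulo the lattice, which
  \<open>ell_span1\<close> forbids.\<close>

lemma wp_sqrt_signs_nontrivial:
  assumes "S meromorphic_on UNIV" "eventually (\<lambda>z. S z ^ 2 = wp z - c) (cosparse UNIV)"
    "\<And>z. S (z + 1) = S z" "\<And>z. S (z + \<tau>) = S z"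
  shows False
proof -
  have "ell S" using assms by (simp add: ell_iff)
  have "reg S" by (rule reg_sqrt[OF assms(1) _ assms(2)]) (intro reg_intros)
  have "((\<lambda>z. (z * S z) ^ 2) \<longlongrightarrow> 1) (at 0)"
    by (rule Lim_transform_eventually[OF lim_wp_minus[of c]])
       (use cosparse_at[OF assms(2), of 0] in eventually_elim, simp add: power_mult_distrib)
  moreover have "(\<lambda>z. z * S z) meromorphic_on UNIV" by (intro meromorphic_intros assms)
  ultimately obtain d where "((\<lambda>z. z * S z) \<longlongrightarrow> d) (at 0)" "d ^ 2 = 1"
    using mero_lim_square[of "\<lambda>z. z * S z" 1 0] by blast
  then show False using ell_span1[OF \<open>ell S\<close> \<open>reg S\<close>] by fastforce
qed

text \<open>With equal signs the product of the roots is elliptic with a double pole, so it is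
  affine in \<open>wp\<close>. Then \<open>(x - c) * (x - d)\<close> is the square of a polynomial,
  which means \<open>c = d\<close>.\<close>

lemma wp_sqrt_signs_distinct:
  assumes "S meromorphic_on UNIV" "eventually (\<lambda>z. S z ^ 2 = wp z - c) (cosparse UNIV)"
    "T meromorphic_on UNIV" "eventually (\<lambda>z. T z ^ 2 = wp z - d) (cosparse UNIV)"
    "s \<in> {1, -1}" "t \<in> {1, -1}"
    "\<And>z. S (z + 1) = s * S z" "\<And>z. S (z + \<tau>) = t * S z"
    "\<And>z. T (z + 1) = s * T z" "\<And>z. T (z + \<tau>) = t * T z"
  shows "c = d"
proof -
  define f where "f = (\<lambda>z. S z * T z)"
  have "ell f" unfolding f_def by (rule sign_ell[where s = s and t = t]) (use assms in auto)
  have fm: "f meromorphic_on UNIV" by (rule ell_mero[OF \<open>ell f\<close>])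
  have sq: "eventually (\<lambda>z. f z ^ 2 = (wp z - c) * (wp z - d)) (cosparse UNIV)"
    using assms(2,4) by eventually_elim (simp add: f_def power_mult_distrib)
  have "reg f" by (rule reg_sqrt[OF fm _ sq]) (intro reg_intros)
  have "((\<lambda>z. (z ^ 2 * (wp z - c)) * (z ^ 2 * (wp z - d))) \<longlongrightarrow> 1 * 1) (at 0)"
    by (intro tendsto_mult lim_wp_minus)
  then have "((\<lambda>z. (z ^ 2 * f z) ^ 2) \<longlongrightarrow> 1 * 1) (at 0)"
    by (rule Lim_transform_eventually)
       (use cosparse_at[OF sq, of 0] in eventually_elim, simp add: power_mult_distrib power2_eq_square mult_ac)
  moreover have "(\<lambda>z. z ^ 2 * f z) meromorphic_on UNIV" by (intro meromorphic_intros fm)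
  ultimately obtain k where "((\<lambda>z. z ^ 2 * f z) \<longlongrightarrow> k) (at 0)"
    using mero_lim_square[of "\<lambda>z. z ^ 2 * f z" "1 * 1" 0] by blast
  then obtain m where "eventually (\<lambda>z. f z = m + k * wp z) (cosparse UNIV)"
    using ell_span2[OF \<open>ell f\<close> \<open>reg f\<close>] by blast
  then have ev: "eventually (\<lambda>z. (m + k * wp z) ^ 2 = (wp z - c) * (wp z - d)) (cosparse UNIV)"
    using sq by eventually_elim simp
  have "(m + k * x) ^ 2 = (x - c) * (x - d)" for x
  proof -
    obtain z where z: "z \<notin> \<Lambda>" "wp z = x" by (rule wp_surj)
    have "(m + k * wp z) ^ 2 = (wp z - c) * (wp z - d)"
      by (rule holo_off_Lambda_eqI[OF _ _ ev z(1)]) (intro holomorphic_intros wp_holo)+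
    then show ?thesis by (simp add: z)
  qed
  note q = this
  have "m + k * c = 0" "m + k * d = 0" using q[of c] q[of d] by auto
  show ?thesis
  proof (rule ccontr)
    assume "c \<noteq> d"
    have "k * (c - d) = 0" using \<open>m + k * c = 0\<close> \<open>m + k * d = 0\<close> by algebra
    then have "k = 0" using \<open>c \<noteq> d\<close> by simp
    then have "m = 0" using \<open>m + k * c = 0\<close> by simp
    \<comment> \<open>Now the quadratic polynomial vanishes identically; any two values off its
      roots refute this.\<close>
    have "(c + 1 - c) * (c + 1 - d) = 0" "(d + 1 - c) * (d + 1 - d) = 0"
      using q[of "c + 1"] q[of "d + 1"] \<open>k = 0\<close> \<open>m = 0\<close> by auto
    then have "c + 1 = d" "d + 1 = c" by auto
    moreover have "(c + 1 - d) + (d + 1 - c) = 2" by simp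
    ultimately show False by simp
  qed
qed

text \<open>A pigeonhole argument: the three half-period values give three distinct nontrivial sign
  pairs, and there are only three.\<close>

lemma sign_cover:
  assumes "s \<in> {1, -1}" "t \<in> {1, -1::complex}" "(s, t) \<noteq> (1, 1)"
  obtains S e where "e \<in> {e1, e2, e3}" "S meromorphic_on UNIV"
    "eventually (\<lambda>z. S z ^ 2 = wp z - e) (cosparse UNIV)"
    "\<And>z. S (z + 1) = s * S z" "\<And>z. S (z + \<tau>) = t * S z"
proof -
  let ?P = "\<lambda>e S s t. S meromorphic_on UNIV \<and> eventually (\<lambda>z. S z ^ 2 = wp z - e) (cosparse UNIV) \<and>
     (\<forall>z. S (z + 1) = s * S z) \<and> (\<forall>z. S (z + \<tau>) = t * S z)"
  have ex: "\<exists>S s t. (s, t) \<in> {1, -1} \<times> {1, -1} \<and> ?P (wp a) S s t" if a: "a \<notin> \<Lambda>" "2 * a \<in> \<Lambda>" for a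
  proof -
    obtain S s t where "S meromorphic_on UNIV" "eventually (\<lambda>z. S z ^ 2 = wp z - wp a) (cosparse UNIV)"
      "s \<in> {1, -1}" "t \<in> {1, -1}" "\<And>z. S (z + 1) = s * S z" "\<And>z. S (z + \<tau>) = t * S z"
      by (rule wp_sqrt_exists[OF a]; blast)
    then show ?thesis by blast
  qed
  obtain S1 s1 t1 where 1: "(s1, t1) \<in> {1, -1} \<times> {1, -1}" "?P e1 S1 s1 t1"
    using ex[OF half_notin'(1) two_half(1)] unfolding e1_def by blast
  obtain S2 s2 t2 where 2: "(s2, t2) \<in> {1, -1} \<times> {1, -1}" "?P e2 S2 s2 t2"
    using ex[OF half_notin'(2) two_half(2)] unfolding e2_def by blast
  obtain S3 s3 t3 where 3: "(s3, t3) \<in> {1, -1} \<times> {1, -1}" "?P e3 S3 s3 t3"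
    using ex[OF half_notin'(3) two_half(3)] unfolding e3_def by blast
  have nt: "(s, t) \<noteq> (1, 1)" if "?P e S s t" for e S s t
    using wp_sqrt_signs_nontrivial[of S e] that by auto
  have d: "e = e'" if "?P e S s t" "?P e' T s t" "(s, t) \<in> {1, -1} \<times> {1, -1}" for e S s t e' T
    by (rule wp_sqrt_signs_distinct[of S e T e' s t]) (use that in auto)
  have "(s1, t1) \<noteq> (s2, t2)" using d[OF 1(2)] 1(1) 2(2) e_distinct(1) by blast
  moreover have "(s1, t1) \<noteq> (s3, t3)" using d[OF 1(2)] 1(1) 3(2) e_distinct(2) by blast
  moreover have "(s2, t2) \<noteq> (s3, t3)" using d[OF 2(2)] 2(1) 3(2) e_distinct(3) by blast
  moreover note nt[OF 1(2)] nt[OF 2(2)] nt[OF 3(2)]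
  ultimately have "(s, t) = (s1, t1) \<or> (s, t) = (s2, t2) \<or> (s, t) = (s3, t3)"
    using assms 1(1) 2(1) 3(1) by auto
  then show ?thesis using 1(2) 2(2) 3(2) that by blast
qed

end

subsection \<open>The algebraic system\<close>

text \<open>Both signs of \<open>y\<close> occur over each \<open>x\<close>, so 1 and
  \<open>y\<close> are independent over the polynomials. At zeros of \<open>W\<close> nothing is
  learned about \<open>V\<close>; therefore \<open>V * W\<close> is shown to vanish and
  \<open>W\<close> is cancelled as a polynomial.\<close>

lemma curve_poly_eq_0:
  fixes U V W :: "complex poly"
  assumes "W \<noteq> 0" and *: "\<And>x y. y ^ 2 = poly W x \<Longrightarrow> poly U x + poly V x * y = 0"
  shows "U = 0" "V = 0"
proof -
  have U: "poly U x = 0" and V: "poly (V * W) x = 0" for x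
  proof -
    define y where "y = csqrt (poly W x)"
    have y: "y ^ 2 = poly W x" by (simp add: y_def)
    have 1: "poly U x + poly V x * y = 0" by (rule *[OF y])
    have 2: "poly U x + poly V x * (- y) = 0" by (rule *) (simp add: y)
    show "poly U x = 0" using 1 2 by algebra
    have "poly V x * y = 0" using 1 2 by algebra
    then have "poly V x * y ^ 2 = 0" by (simp add: power2_eq_square)
    then show "poly (V * W) x = 0" by (simp add: y)
  qed
  show "U = 0" using U poly_all_0_iff_0[of U] by blast
  have "V * W = 0" using V poly_all_0_iff_0[of "V * W"] by blast
  then show "V = 0" using assms(1) by simp
qed

text \<open>\<open>cover_num\<close> is \<open>(x - e)\<^sup>2\<close> times the derivative of the function in \<open>cover_fun\<close> below,
  with \<open>y\<^sup>2\<close> replaced by the Weierstrass cubic.\<close>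

definition cover_num :: "complex \<Rightarrow> complex \<Rightarrow> complex \<Rightarrow> complex \<Rightarrow> complex \<Rightarrow> complex \<Rightarrow> complex \<Rightarrow> complex \<Rightarrow> complex" where
  "cover_num g2 g3 e e' b k x y = (x\<^sup>2 - g2 / 12) * (x - e)\<^sup>2
     - k / 2 * (2 * x ^ 3 - 6 * e * x\<^sup>2 + g2 / 2 * x + g2 * e / 2 + g3) + y * (b * (x - e)\<^sup>2 + k * e' / 2)"

text \<open>The unknowns \<open>d0\<close>, \<open>d1\<close>, \<open>d2\<close> of the square root
  are eliminated. \<open>K\<close> says that the root vanishes at \<open>(e, - e')\<close>, where
  \<open>cover_num\<close> does; \<open>nd\<close> says that the curve is smooth at
  \<open>(e, e')\<close>.\<close>

lemma square_case_trivial: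
  fixes e e' b k g2 g3 :: complex
  assumes sq: "\<And>x y. y ^ 2 = 4 * x ^ 3 - g2 * x - g3 \<Longrightarrow>
      (x\<^sup>2 + d1 * x + d2 * y + d0)\<^sup>2 = cover_num g2 g3 e e' b k x y"
    and K: "e\<^sup>2 + d1 * e - d2 * e' + d0 = 0"
    and curve: "e' ^ 2 = 4 * e ^ 3 - g2 * e - g3"
    and nd: "e' = 0 \<Longrightarrow> 12 * e\<^sup>2 \<noteq> g2" and k: "k \<noteq> 0"
  shows "k = e" "e = b\<^sup>2" "2 * e\<^sup>2 + b * e' + g2 / 12 = 0"
proof -
  \<comment> \<open>Coefficients of the square minus \<open>cover_num\<close> in the basis 1,
    \<open>y\<close>, after \<open>y ^ 2\<close> is replaced by the cubic.\<close>
  define U where "U = [: d0\<^sup>2 - d2\<^sup>2 * g3 + g2 * e\<^sup>2 / 12 + k / 2 * (g2 * e / 2 + g3),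
     2 * d1 * d0 - d2\<^sup>2 * g2 - g2 * e / 6 + k * g2 / 4, d1\<^sup>2 + 2 * d0 - e\<^sup>2 + g2 / 12 - 3 * e * k,
     2 * d1 + 4 * d2\<^sup>2 + 2 * e + k :]"
  define V where "V = [: 2 * d2 * d0 - b * e\<^sup>2 - k * e' / 2, 2 * d2 * d1 + 2 * b * e, 2 * d2 - b :]"
  define W where "W = [: - g3, - g2, 0, 4 :]"
  have "poly U x + poly V x * y = 0" if "y ^ 2 = poly W x" for x y
  proof -
    have "y ^ 2 = 4 * x ^ 3 - g2 * x - g3" using that by (simp add: W_def algebra_simps power3_eq_cube)
    from sq[OF this] this show ?thesis
      unfolding cover_num_def U_def V_def by (simp add: field_simps power2_eq_square power3_eq_cube) algebra
  qed
  then have "U = 0" "V = 0" using curve_poly_eq_0[of W U V] by (auto simp: W_def)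
  then have c: "d0\<^sup>2 - d2\<^sup>2 * g3 + g2 * e\<^sup>2 / 12 + k / 2 * (g2 * e / 2 + g3) = 0"
     "2 * d1 * d0 - d2\<^sup>2 * g2 - g2 * e / 6 + k * g2 / 4 = 0" "d1\<^sup>2 + 2 * d0 - e\<^sup>2 + g2 / 12 - 3 * e * k = 0"
     "2 * d1 + 4 * d2\<^sup>2 + 2 * e + k = 0" "2 * d2 * d0 - b * e\<^sup>2 - k * e' / 2 = 0"
     "2 * d2 * d1 + 2 * b * e = 0" "2 * d2 - b = 0"
    using \<open>U = 0\<close>[unfolded U_def pCons_eq_0_iff] \<open>V = 0\<close>[unfolded V_def pCons_eq_0_iff] by blast+
  define w where "w = g2 / 12"
  have g2: "g2 = 12 * w" by (simp add: w_def)
  have d2: "b = 2 * d2" using c(7) by algebra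
  have "k = e \<and> e = b\<^sup>2 \<and> 2 * e\<^sup>2 + b * e' + w = 0"
  proof (cases "b = 0")
    \<comment> \<open>Then \<open>e' = 0\<close> as well, and the remaining equations force
      \<open>12 * e ^ 2 = g2\<close>, a double root of the cubic, contrary to
      \<open>nd\<close>.\<close>
    case True
    then have d2: "d2 = 0" using d2 by simp
    then have e': "e' = 0" using c(5) True k by simp
    have k2: "k = - 2 * d1 - 2 * e" using c(4) d2 by algebra
    have d0: "d0 = - e\<^sup>2 - d1 * e" using K d2 by algebra
    have x2: "d1\<^sup>2 + 2 * d0 - e\<^sup>2 + w - 3 * e * k = 0" using c(3) g2 by simp
    have x1: "2 * d1 * d0 - 2 * w * e + 3 * w * k = 0" using c(2) g2 d2 by (simp add: mult_ac)
    have "k * (w - e\<^sup>2) = 0" using x1 x2 unfolding d0 k2 by algebra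
    then have "w = e\<^sup>2" using k by simp
    then show ?thesis using nd[OF e'] g2 by simp
  next
    case False
    have "b * (d1 + 2 * e) = 0" using c(6) d2 by algebra
    then have d1: "d1 = - 2 * e" using False by (simp add: eq_neg_iff_add_eq_0)
    have d22: "d2 = b / 2" using d2 by simp
    have kb: "k = 2 * e - b\<^sup>2" using c(4) d1 d2 by algebra
    have d0: "d0 = e\<^sup>2 + d2 * e'" using K d1 by algebra
    have "e' * (b\<^sup>2 - k) = 0" using c(5) d0 unfolding d22 by algebra
    have x2: "d1\<^sup>2 + 2 * d0 - e\<^sup>2 + w - 3 * e * k = 0" using c(3) g2 by simp
    have x1: "2 * d1 * d0 - d2\<^sup>2 * 12 * w - 2 * w * e + 3 * w * k = 0" using c(2) g2 by (simp add: mult_ac)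
    show ?thesis
    proof (cases "e' = 0")
      case False
      then have kb2: "k = b\<^sup>2" using \<open>e' * (b\<^sup>2 - k) = 0\<close> by simp
      then have eb: "e = b\<^sup>2" using kb by algebra
      moreover have "2 * e\<^sup>2 + b * e' + w = 0" using x2 d0 d1 d2 kb2 eb by algebra
      ultimately show ?thesis using kb2 by simp
    next
      case True
      have x2': "3 * e * b\<^sup>2 = e\<^sup>2 - w" using x2 d0 d1 kb True by algebra
      have n: "e\<^sup>2 - w \<noteq> 0" using nd[OF True] g2 by auto
      then have "e \<noteq> 0" using x2' by auto
      have "4 * d2\<^sup>2 = b\<^sup>2" using d2 by algebra
      then have x1': "- 4 * e ^ 3 + 4 * w * e = 6 * b\<^sup>2 * w" using x1 d0 d1 kb True by algebra
      have "b\<^sup>2 * (2 * e\<^sup>2 + w) = 0" using x1' x2' by algebra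
      then have w: "w = - 2 * e\<^sup>2" using False by (simp add: eq_neg_iff_add_eq_0 add.commute)
      have "e * (b\<^sup>2 - e) = 0" using x2' w by algebra
      then have eb: "e = b\<^sup>2" using \<open>e \<noteq> 0\<close> by simp
      then show ?thesis using kb w True by auto
    qed
  qed
  then show "k = e" "e = b\<^sup>2" "2 * e\<^sup>2 + b * e' + g2 / 12 = 0" by (auto simp: w_def)
qed

text \<open>Applied with \<open>d = x - r\<close>, which divides every term of the square because it
  divides the cubic that replaces \<open>y ^ 2\<close>.\<close>

lemma linear_factor_out:
  fixes c d A P M N :: complex
  assumes "c * d = A * (d * P) + d\<^sup>2 * M\<^sup>2 + N * d * M"
  shows "d * (A * P + d * M\<^sup>2 + N * M - c) = 0"
  using assms by (simp add: algebra_simps power2_eq_square)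

text \<open>Again the coefficients of the root are eliminated. \<open>K\<close> and
  \<open>Kr\<close> hold because the right side vanishes at \<open>(e, - e')\<close> and at
  \<open>(r, 0)\<close>, so the root does too.\<close>

lemma square_case_half_period:
  fixes e e' b k g2 g3 r s t :: complex
  assumes sq: "\<And>x y. y ^ 2 = 4 * x ^ 3 - g2 * x - g3 \<Longrightarrow>
      (x * y / 2 + d1 * x + d2 * y + d3 * x\<^sup>2 + d0)\<^sup>2 = cover_num g2 g3 e e' b k x y * (x - r)"
    and K: "- e * e' / 2 + d1 * e - d2 * e' + d3 * e\<^sup>2 + d0 = 0"
    and Kr: "d1 * r + d3 * r\<^sup>2 + d0 = 0"
    and curve: "e' ^ 2 = 4 * (e - r) * (e - s) * (e - t)"
    and g2: "g2 = - 4 * (r * s + r * t + s * t)" and g3: "g3 = 4 * r * s * t" and sum: "r + s + t = 0"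
    and distinct: "r \<noteq> s" "r \<noteq> t" "s \<noteq> t" and k: "k \<noteq> 0"
  shows "k = (e - r) / 9" "e' = - 2 * (e - r) * b" "16 * (e - r)\<^sup>2 + 36 * r * (e - r) + 9 * (r - s) * (r - t) = 0"
proof -
  define p where "p = s * t"
  have g2p: "g2 = 4 * (r\<^sup>2 - p)" and g3p: "g3 = 4 * r * p"
    using sum unfolding g2 g3 p_def by (algebra, simp)
  \<comment> \<open>A quarter of the derivative of the cubic at \<open>r\<close>, nonzero because
    \<open>r\<close> is a simple root; \<open>curve'\<close> is the cubic expanded in
    \<open>u = e - r\<close>.\<close>
  define Q where "Q = 2 * r\<^sup>2 + p"
  have Q: "Q = (r - s) * (r - t)" unfolding Q_def p_def using sum by algebra
  then have Q0: "Q \<noteq> 0" using distinct by simp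
  define u where "u = e - r"
  have eu: "e = r + u" by (simp add: u_def)
  have curve': "e' ^ 2 = 4 * u * (u\<^sup>2 + 3 * r * u + Q)"
    using curve sum unfolding Q u_def by algebra
  \<comment> \<open>\<open>Kr\<close> makes the part of the root without \<open>y\<close> divisible
    by \<open>x - r\<close>; \<open>d3 * x + m\<close> is the quotient.\<close>
  define m where "m = d1 + r * d3"
  have d1: "d1 = m - r * d3" by (simp add: m_def)
  have d0: "d0 = - r * m" using Kr unfolding m_def by algebra
  define D where "D = 2 * d2"
  have d2: "d2 = D / 2" by (simp add: D_def)
  \<comment> \<open>Division by \<open>x - r\<close> is impossible pointwise at
    \<open>x = r\<close>, so the factor is kept as the polynomial \<open>R\<close> and cancelled
    after the comparison of coefficients.\<close>
  define R where "R = [: - r, 1 :]"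
  define U where "U = [: D\<^sup>2 * p - r * m\<^sup>2 + g2 * e\<^sup>2 / 12 + k / 2 * (g2 * e / 2 + g3),
     2 * D * p + D\<^sup>2 * r + m\<^sup>2 - 2 * d3 * m * r - g2 * e / 6 + k * g2 / 4,
     D\<^sup>2 + 2 * D * r + p + 2 * d3 * m - r * d3\<^sup>2 - e\<^sup>2 + g2 / 12 - 3 * e * k,
     2 * D + r + d3\<^sup>2 + 2 * e + k :]"
  define V where "V = [: D * m - b * e\<^sup>2 - k * e' / 2, m + D * d3 + 2 * b * e, d3 - b :]"
  define W where "W = [: - g3, - g2, 0, 4 :]"
  have "poly (R * U) x + poly (R * V) x * y = 0" if "y ^ 2 = poly W x" for x y
  proof -
    have y: "y ^ 2 = 4 * x ^ 3 - g2 * x - g3" using that by (simp add: W_def algebra_simps power3_eq_cube)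
    have c: "4 * x ^ 3 - g2 * x - g3 = 4 * (x - r) * (x\<^sup>2 + r * x + p)"
      unfolding g2p g3p by algebra
    have "x * y / 2 + d1 * x + d2 * y + d3 * x\<^sup>2 + d0 = (x + D) * y / 2 + (x - r) * (d3 * x + m)"
      unfolding d1 d0 d2 by (simp add: field_simps power2_eq_square)
    then have "((x + D) * y / 2 + (x - r) * (d3 * x + m))\<^sup>2 = cover_num g2 g3 e e' b k x y * (x - r)"
      using sq[OF y] by simp
    moreover have "((x + D) * y / 2 + (x - r) * (d3 * x + m))\<^sup>2 =
        (x + D)\<^sup>2 * (y\<^sup>2 / 4) + (x - r)\<^sup>2 * (d3 * x + m)\<^sup>2 + (x + D) * y * (x - r) * (d3 * x + m)"
      by (simp add: field_simps power2_eq_square)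
    moreover have "y\<^sup>2 / 4 = (x - r) * (x\<^sup>2 + r * x + p)" using y c by simp
    ultimately have "cover_num g2 g3 e e' b k x y * (x - r) =
        (x + D)\<^sup>2 * ((x - r) * (x\<^sup>2 + r * x + p)) + (x - r)\<^sup>2 * (d3 * x + m)\<^sup>2 + (x + D) * y * (x - r) * (d3 * x + m)"
      by simp
    then have "(x - r) * ((x + D)\<^sup>2 * (x\<^sup>2 + r * x + p) + (x - r) * (d3 * x + m)\<^sup>2
        + (x + D) * y * (d3 * x + m) - cover_num g2 g3 e e' b k x y) = 0"
      by (rule linear_factor_out)
    moreover have "(x + D)\<^sup>2 * (x\<^sup>2 + r * x + p) + (x - r) * (d3 * x + m)\<^sup>2
        + (x + D) * y * (d3 * x + m) - cover_num g2 g3 e e' b k x y = poly U x + poly V x * y"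
      unfolding cover_num_def U_def V_def poly_pCons poly_0
      by (simp add: field_simps power2_eq_square power3_eq_cube)
    ultimately have "(x - r) * (poly U x + poly V x * y) = 0" by (simp only:)
    moreover have "poly R x = x - r" by (simp add: R_def)
    ultimately show ?thesis by (simp only: poly_mult distrib_left mult.assoc)
  qed
  then have "R * U = 0" "R * V = 0" using curve_poly_eq_0[of W "R * U" "R * V"] by (auto simp: W_def)
  moreover have "R \<noteq> 0" by (simp add: R_def)
  ultimately have "U = 0" "V = 0" by (simp_all only: mult_eq_0_iff simp_thms)
  then have d3b: "d3 - b = 0"
     and y1: "m + D * d3 + 2 * b * e = 0" and y0: "D * m - b * e\<^sup>2 - k * e' / 2 = 0"
     and x3: "2 * D + r + d3\<^sup>2 + 2 * e + k = 0"
     and x2: "D\<^sup>2 + 2 * D * r + p + 2 * d3 * m - r * d3\<^sup>2 - e\<^sup>2 + g2 / 12 - 3 * e * k = 0"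
     and x1: "2 * D * p + D\<^sup>2 * r + m\<^sup>2 - 2 * d3 * m * r - g2 * e / 6 + k * g2 / 4 = 0"
     and x0: "D\<^sup>2 * p - r * m\<^sup>2 + g2 * e\<^sup>2 / 12 + k / 2 * (g2 * e / 2 + g3) = 0"
    unfolding U_def V_def pCons_eq_0_iff by blast+
  have d3: "d3 = b" using d3b by simp
  \<comment> \<open>In this variable condition \<open>K\<close> factors, see
    \<open>ve\<close>.\<close>
  define v where "v = e + D"
  have D: "D = v - e" by (simp add: v_def)
  have m: "m = - b * (e + v)" using y1 unfolding D d3 by algebra
  have kv: "2 * b * v\<^sup>2 = - k * e'" using y0 unfolding D m by algebra
  have ve: "v * (e' + 2 * u * b) = 0"
    using K unfolding d1 d0 d2 D m d3 u_def by algebra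
  have x3': "b\<^sup>2 = - 2 * v - r - k" using x3 unfolding D d3 by algebra
  have x2': "3 * (v\<^sup>2 - 2 * v * e + 2 * v * r - 2 * e * r + p - 2 * b\<^sup>2 * (e + v) - r * b\<^sup>2) + (r\<^sup>2 - p) - 9 * e * k = 0"
    using x2 unfolding D d3 m g2p by algebra
  have x1': "3 * (2 * (v - e) * p + (v - e)\<^sup>2 * r + b\<^sup>2 * (e + v)\<^sup>2 + 2 * b\<^sup>2 * (e + v) * r) - 2 * (r\<^sup>2 - p) * e + 3 * k * (r\<^sup>2 - p) = 0"
    using x1 unfolding D d3 m g2p by algebra
  have pQ: "p = Q - 2 * r\<^sup>2" by (simp add: Q_def)
  have main: "k = u / 9 \<and> e' = - 2 * u * b \<and> 16 * u\<^sup>2 + 36 * r * u + 9 * Q = 0"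
  proof (cases "v = 0")
    \<comment> \<open>A spurious branch: it forces \<open>e' = 0\<close> and
      \<open>2 * e + r = 0\<close>, so \<open>e\<close> would be a double root \<open>s = t\<close>
      of the cubic.\<close>
    case True
    then have e': "e' = 0" using kv k by simp
    have b2: "b\<^sup>2 = - r - k" using x3' True by simp
    have "3 * k * u = 2 * Q" using x2' True b2 unfolding pQ eu by algebra
    moreover from this have "u \<noteq> 0" using Q0 by auto
    ultimately have uq: "u\<^sup>2 + 3 * r * u + Q = 0" using curve' e' by simp
    have x1'': "- 4 * e * Q = 3 * k * r * u" using x1' True b2 uq unfolding pQ eu by algebra
    have "Q * (2 * e + r) = 0" using x1'' \<open>3 * k * u = 2 * Q\<close> by algebra
    then have e2: "2 * e + r = 0" using Q0 by simp
    have "(e - s) * (e - t) = 0" using uq sum unfolding Q u_def by algebra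
    then have "s = t" using e2 sum by (auto; algebra)
    then show ?thesis using distinct by simp
  next
    case False
    then have e': "e' = - 2 * u * b" using ve by (simp add: eq_neg_iff_add_eq_0)
    show ?thesis
    proof (cases "b = 0")
      \<comment> \<open>The chain \<open>v ^ 2 = k * u\<close>, \<open>u = 3 * v\<close>,
        \<open>v = 3 * k\<close> is the origin of the constant 9 in the result.\<close>
      case b: False
      have "2 * b * (v\<^sup>2 - k * u) = 0" using kv e' by algebra
      then have vku: "v\<^sup>2 = k * u" using b by simp
      then have u0: "u \<noteq> 0" using False by auto
      have "4 * u * (u * b\<^sup>2 - (u\<^sup>2 + 3 * r * u + Q)) = 0" using curve' e' by algebra
      then have ub: "u * b\<^sup>2 = u\<^sup>2 + 3 * r * u + Q" using u0 by simp
      have 1: "(u + v)\<^sup>2 + 4 * r * u + Q = 0" using ub x3' vku by algebra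
      have 2: "3 * (4 * v\<^sup>2 + 2 * u * v + 8 * v * r + 2 * v * k) + 2 * Q = 0"
        using x2' x3' vku unfolding pQ eu by algebra
      have "Q * (u - 3 * v) = 0" using 1 2 vku by algebra
      then have uv: "u = 3 * v" using Q0 by simp
      have "v * (v - 3 * k) = 0" using vku uv by algebra
      then have kv: "v = 3 * k" using False by simp
      have "16 * u\<^sup>2 + 36 * r * u + 9 * Q = 0" using 1 uv by algebra
      moreover have "k = u / 9" using uv kv by simp
      ultimately show ?thesis using e' by blast
    next
      \<comment> \<open>Now \<open>e\<close> is a half-period value. The choice \<open>e = r\<close>
        is impossible; another value survives only if \<open>r\<close>, \<open>e\<close> and the
        third root are proportional to 7, -2, -5, and it satisfies the same equations.\<close>
      case b: True
      then have e'0: "e' = 0" using e' by simp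
      have k2: "k = - 2 * v - r" using x3' b by algebra
      show ?thesis
      proof (cases "u = 0")
        case True
        then have er: "e = r" by (simp add: eu)
        have "D\<^sup>2 * p + g2 * r\<^sup>2 / 12 + k / 2 * (g2 * r / 2 + g3) = 0" using x0 m b er by simp
        then have x0': "3 * (v - r)\<^sup>2 * p + (r\<^sup>2 - p) * r\<^sup>2 + 3 * k * ((r\<^sup>2 - p) * r + 2 * r * p) = 0"
          unfolding D er g2p g3p by algebra
        have "v\<^sup>2 * Q = 0" using x0' x1' x2' k2 b er unfolding pQ by algebra
        then show ?thesis using False Q0 by simp
      next
        case u0: False
        then have uq: "u\<^sup>2 + 3 * r * u + Q = 0" using curve' e'0 by simp
        \<comment> \<open>Up to sign, \<open>h\<close> is \<open>s - t\<close>; \<open>h - u\<close>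
          is \<open>r\<close> minus the root other than \<open>r\<close> and \<open>e\<close>. Both
          are therefore nonzero.\<close>
        define h where "h = 2 * e + r"
        have rh: "3 * r = h - 2 * u" and eh: "3 * e = h + u" by (simp_all add: h_def u_def)
        have "(e - s) * (e - t) = 0" using uq sum unfolding Q u_def by algebra
        then have "e = s \<or> e = t" by simp
        then have "h = s - t \<or> h = t - s" unfolding h_def using sum by (auto; algebra)
        then have h0: "h \<noteq> 0" using distinct by auto
        have "h - u = r - t \<or> h - u = r - s"
          using \<open>e = s \<or> e = t\<close> sum unfolding h_def u_def by (auto; algebra)
        then have hu: "h - u \<noteq> 0" using distinct by auto
        have 2: "3 * v\<^sup>2 + 6 * v * h - u * h = 0"
          using x2' k2 b uq unfolding pQ h_def u_def by algebra
        have "h * (h - u) * (u - 3 * v) = 0"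
          using x1' k2 b uq 2 unfolding pQ h_def u_def by algebra
        then have uv: "u = 3 * v" using h0 hu by simp
        have "v * (v + h) = 0" using 2 uv by algebra
        then have hv: "h = - v" using False by (simp add: eq_neg_iff_add_eq_0 add.commute)
        have r: "3 * r = - 7 * v" using rh hv uv by algebra
        have "9 * k = u" using k2 r uv by algebra
        moreover have "16 * u\<^sup>2 + 36 * r * u + 9 * Q = 0" using uq r uv by algebra
        ultimately show ?thesis using e' by auto
      qed
    qed
  qed
  then show "k = (e - r) / 9" "e' = - 2 * (e - r) * b" "16 * (e - r)\<^sup>2 + 36 * r * (e - r) + 9 * (r - s) * (r - t) = 0"
    using main unfolding u_def Q mult.assoc by blast+
qed

text \<open>The converse of \<open>square_case_trivial\<close>: the root is assembled from the
  values \<open>d1 = - 2 * e\<close>, \<open>d2 = b / 2\<close>, \<open>d0 = e ^ 2 + d2 * e'\<close>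
  found there.\<close>

lemma trivial_case_square:
  assumes "k = e" "e = b\<^sup>2" "2 * e\<^sup>2 + b * e' + g2 / 12 = 0" "e' ^ 2 = 4 * e ^ 3 - g2 * e - g3"
    and "y ^ 2 = 4 * x ^ 3 - g2 * x - g3"
  shows "cover_num g2 g3 e e' b k x y = ((x - e)\<^sup>2 + b / 2 * (y + e'))\<^sup>2"
proof -
  define w where "w = g2 / 12"
  have g2: "g2 = 12 * w" by (simp add: w_def)
  define j where "j = b / 2"
  have b: "b = 2 * j" by (simp add: j_def)
  have e: "e = 4 * j\<^sup>2" and k: "k = 4 * j\<^sup>2" using assms b by (auto simp: power2_eq_square)
  have w: "w = - 2 * e\<^sup>2 - 2 * j * e'" using assms(3) g2 b by (simp add: add_eq_0_iff)
  have g3: "g3 = 4 * e ^ 3 - 12 * w * e - e' ^ 2" using assms(4) g2 by algebra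
  have y: "y ^ 2 = 4 * x ^ 3 - 12 * w * x - g3" using assms(5) g2 by simp
  have "cover_num g2 g3 e e' b k x y = (x\<^sup>2 - w) * (x - e)\<^sup>2
     - 2 * j\<^sup>2 * (2 * x ^ 3 - 6 * e * x\<^sup>2 + 6 * w * x + 6 * w * e + g3) + y * (2 * j * (x - e)\<^sup>2 + 2 * j\<^sup>2 * e')"
    unfolding cover_num_def by (simp add: g2 k b mult_ac)
  also have "\<dots> = ((x - e)\<^sup>2 + j * (y + e'))\<^sup>2"
    using y unfolding g3 w e by algebra
  finally show ?thesis by (simp add: j_def)
qed

text \<open>The converse of \<open>square_case_half_period\<close>, with the root found there for
  \<open>v = (e - r) / 3\<close>.\<close>

lemma half_period_case_square:
  fixes e e' b k g2 g3 r s t x y :: complex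
  assumes "k = (e - r) / 9" "e' = - 2 * (e - r) * b"
    "16 * (e - r)\<^sup>2 + 36 * r * (e - r) + 9 * (r - s) * (r - t) = 0"
    and curve: "e' ^ 2 = 4 * (e - r) * (e - s) * (e - t)"
    and g2: "g2 = - 4 * (r * s + r * t + s * t)" and g3: "g3 = 4 * r * s * t" and sum: "r + s + t = 0"
    and distinct: "r \<noteq> s" "r \<noteq> t"
    and y: "y ^ 2 = 4 * x ^ 3 - g2 * x - g3"
  shows "cover_num g2 g3 e e' b k x y * (x - r) =
    ((x - e) * (y / 2 + b * (x - r) + e' / 6) + (e - r) / 6 * (y + e'))\<^sup>2"
proof -
  define p where "p = s * t"
  have g2p: "g2 = 4 * (r\<^sup>2 - p)" and g3p: "g3 = 4 * r * p"
    using sum unfolding g2 g3 p_def by (algebra, simp)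
  have e: "e = r + 9 * k" unfolding assms(1) by (simp add: field_simps)
  have e': "e' = - 18 * k * b" using assms(2) e by simp
  have Q: "(r - s) * (r - t) = 2 * r\<^sup>2 + p" using sum unfolding p_def by algebra
  have "9 * (2 * r\<^sup>2 + p + 144 * k\<^sup>2 + 36 * r * k) = 0" using assms(3) Q e by algebra
  then have "2 * r\<^sup>2 + p + 144 * k\<^sup>2 + 36 * r * k = 0" by (subst (asm) mult_eq_0_iff) simp
  then have p: "p = - 144 * k\<^sup>2 - 36 * r * k - 2 * r\<^sup>2" by algebra
  have "k \<noteq> 0"
  proof
    assume "k = 0"
    then have "(r - s) * (r - t) = 0" using Q p by simp
    then show False using distinct by simp
  qed
  have "(e - s) * (e - t) = e\<^sup>2 + r * e + p" using sum unfolding p_def by algebra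
  then have "324 * k\<^sup>2 * (b\<^sup>2 + 7 * k + r) = 0" using curve e' e p by algebra
  then have "b\<^sup>2 + 7 * k + r = 0" using \<open>k \<noteq> 0\<close> by simp
  \<comment> \<open>Now \<open>e\<close>, \<open>e'\<close>, \<open>r\<close> and \<open>p\<close>
    are all polynomials in \<open>b\<close> and \<open>k\<close>, and the equation of the curve is
    the only relation left.\<close>
  then have r: "r = - b\<^sup>2 - 7 * k" by algebra
  define Y where "Y = y / 2"
  have y2: "y = 2 * Y" by (simp add: Y_def)
  have Y: "Y\<^sup>2 = x ^ 3 - (r\<^sup>2 - p) * x - r * p"
    using y unfolding g2p g3p y2 by (simp add: power_mult_distrib) algebra
  have num: "cover_num g2 g3 e e' b k x y = (x\<^sup>2 - (r\<^sup>2 - p) / 3) * (x - e)\<^sup>2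
     - k * (x ^ 3 - 3 * e * x\<^sup>2 + (r\<^sup>2 - p) * x + (r\<^sup>2 - p) * e + 2 * r * p) + 2 * Y * (b * (x - e)\<^sup>2 - 9 * k\<^sup>2 * b)"
    unfolding cover_num_def g2p g3p e' y2 by (simp add: field_simps power2_eq_square power3_eq_cube)
  define w where "w = (r\<^sup>2 - p) / 3"
  have w3: "r\<^sup>2 - p = 3 * w" by (simp add: w_def)
  have w: "w = 48 * k\<^sup>2 + 12 * r * k + r\<^sup>2" unfolding w_def p by (simp add: field_simps)
  have "((x\<^sup>2 - w) * (x - e)\<^sup>2
     - k * (x ^ 3 - 3 * e * x\<^sup>2 + 3 * w * x + 3 * w * e + 2 * r * p) + 2 * Y * (b * (x - e)\<^sup>2 - 9 * k\<^sup>2 * b)) * (x - r) =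
     ((x - e) * (Y + b * (x - r) - 3 * k * b) + 3 * k * (Y - 9 * k * b))\<^sup>2"
    using Y unfolding w3 unfolding e w p r by algebra
  also have "\<dots> = ((x - e) * (y / 2 + b * (x - r) + e' / 6) + (e - r) / 6 * (y + e'))\<^sup>2"
    unfolding e' Y_def e by (simp add: field_simps)
  finally show ?thesis unfolding num w3 by simp
qed

text \<open>The parameters for which the derivative of the cover is a square (\<open>sols_trivial\<close>), respectively
  a square times \<open>wp - r\<close>, where \<open>r\<close>, \<open>s\<close>, \<open>t\<close> are the half-period values (\<open>sols_half\<close>).\<close>

definition sols_trivial :: "complex \<Rightarrow> complex \<Rightarrow> (complex \<times> complex \<times> complex \<times> complex) set" where
  "sols_trivial g2 g3 = {(e, e', b, k). k = e \<and> e = b\<^sup>2 \<and> 2 * e\<^sup>2 + b * e' + g2 / 12 = 0 \<and>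
     e' ^ 2 = 4 * e ^ 3 - g2 * e - g3}"

definition sols_half :: "complex \<Rightarrow> complex \<Rightarrow> complex \<Rightarrow> (complex \<times> complex \<times> complex \<times> complex) set" where
  "sols_half r s t = {(e, e', b, k). k = (e - r) / 9 \<and> e' = - 2 * (e - r) * b \<and>
     16 * (e - r)\<^sup>2 + 36 * r * (e - r) + 9 * (r - s) * (r - t) = 0 \<and>
     e' ^ 2 = 4 * (e - r) * (e - s) * (e - t)}"

section \<open>Counting the solutions of the systems\<close>

lemma quadratic_two_roots:
  fixes A B C :: complex
  assumes "A \<noteq> 0" "B\<^sup>2 - 4 * A * C \<noteq> 0"
  obtains z1 z2 where "z1 \<noteq> z2" "\<And>z. A * z\<^sup>2 + B * z + C = 0 \<longleftrightarrow> z = z1 \<or> z = z2"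
proof
  define d where "d = csqrt (B\<^sup>2 - 4 * A * C)"
  have d: "d\<^sup>2 = B\<^sup>2 - 4 * A * C" "d \<noteq> 0" using assms(2) by (auto simp: d_def)
  show "(- B + d) / (2 * A) \<noteq> (- B - d) / (2 * A)"
    using assms(1) d(2) by (simp add: field_simps)
  fix z
  have "A * z\<^sup>2 + B * z + C = 0 \<longleftrightarrow> 4 * A * (A * z\<^sup>2 + B * z + C) = 0" using assms(1) by simp
  also have "4 * A * (A * z\<^sup>2 + B * z + C) = (2 * A * z + B - d) * (2 * A * z + B + d)"
    using d(1) by algebra
  also have "\<dots> = 0 \<longleftrightarrow> 2 * A * z + B - d = 0 \<or> 2 * A * z + B + d = 0" by simp
  also have "\<dots> \<longleftrightarrow> z = (- B + d) / (2 * A) \<or> z = (- B - d) / (2 * A)"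
  proof -
    have "2 * A * z + B - d = z * (2 * A) - (- B + d)" "2 * A * z + B + d = z * (2 * A) - (- B - d)"
      by (simp_all add: algebra_simps)
    then show ?thesis using assms(1) by (simp only: right_minus_eq nonzero_eq_divide_eq mult_eq_0_iff
          zero_neq_numeral[symmetric] simp_thms not_False_eq_True)
  qed
  finally show "A * z\<^sup>2 + B * z + C = 0 \<longleftrightarrow> z = (- B + d) / (2 * A) \<or> z = (- B - d) / (2 * A)" .
qed

lemma card_double_cover:
  fixes c :: "complex \<Rightarrow> complex"
  assumes "z1 \<noteq> z2" "\<And>z. P z \<longleftrightarrow> z = z1 \<or> z = z2" "c z1 \<noteq> 0" "c z2 \<noteq> 0"
  shows "card {(z, w). P z \<and> w\<^sup>2 = c z} = 4"
proof -
  define s where "s = (\<lambda>z. csqrt (c z))"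
  have s: "s z ^ 2 = c z" for z by (simp add: s_def)
  have nz: "s z1 \<noteq> 0" "s z2 \<noteq> 0" using assms by (auto simp: s_def)
  have sq: "w\<^sup>2 = c z \<longleftrightarrow> w = s z \<or> w = - s z" for w z
    by (simp add: s[symmetric] power2_eq_iff)
  have "{(z, w). P z \<and> w\<^sup>2 = c z} = {(z1, s z1), (z1, - s z1), (z2, s z2), (z2, - s z2)}"
    unfolding assms(2) sq by auto
  also have "card \<dots> = 4" using assms(1) nz by auto
  finally show ?thesis .
qed

text \<open>Eliminating \<open>e'\<close> leaves a quadratic equation for
  \<open>z = e = b ^ 2\<close>, whose discriminant is a multiple of that of the Weierstrass cubic.
  For \<open>g2\<close> nonzero it has two distinct nonzero roots, each with two signs of
  \<open>b\<close>.\<close>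

lemma card_sols_trivial:
  assumes g2: "g2 \<noteq> 0" and disc: "g2 ^ 3 \<noteq> 27 * g3\<^sup>2"
  shows "card (sols_trivial g2 g3) = 4" "(e, e', b, k) \<in> sols_trivial g2 g3 \<Longrightarrow> k \<noteq> 0"
proof -
  have z0: "z \<noteq> 0" if "192 * g2 * z\<^sup>2 + 144 * g3 * z + g2\<^sup>2 = 0" for z using that g2 by auto
  have "(144 * g3)\<^sup>2 - 4 * (192 * g2) * g2\<^sup>2 = 768 * (27 * g3\<^sup>2 - g2 ^ 3)" by algebra
  then have d: "(144 * g3)\<^sup>2 - 4 * (192 * g2) * g2\<^sup>2 \<noteq> 0" using disc by simp
  have "192 * g2 \<noteq> 0" using g2 by simp
  from this d obtain z1 z2 where z: "z1 \<noteq> z2" "\<And>z. 192 * g2 * z\<^sup>2 + 144 * g3 * z + g2\<^sup>2 = 0 \<longleftrightarrow> z = z1 \<or> z = z2"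
    by (rule quadratic_two_roots; blast)
  let ?S = "{(z, w). 192 * g2 * z\<^sup>2 + 144 * g3 * z + g2\<^sup>2 = 0 \<and> w\<^sup>2 = z}"
  let ?f = "\<lambda>(z, b). (z, - (2 * z\<^sup>2 + g2 / 12) / b, b, z)"
  have S: "card ?S = 4"
    by (rule card_double_cover[where c = "\<lambda>z. z", OF z]) (rule z0, simp only: z simp_thms)+
  have iff: "2 * b ^ 4 + b * e' + g2 / 12 = 0 \<and> e' ^ 2 = 4 * b ^ 6 - g2 * b\<^sup>2 - g3 \<longleftrightarrow>
      192 * g2 * b ^ 4 + 144 * g3 * b\<^sup>2 + g2\<^sup>2 = 0 \<and> e' = - (2 * b ^ 4 + g2 / 12) / b" if "b \<noteq> 0" for b e'
  proof -
    have 1: "2 * b ^ 4 + b * e' + g2 / 12 = 0 \<longleftrightarrow> e' = - (2 * b ^ 4 + g2 / 12) / b"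
    proof -
      define X where "X = 2 * b ^ 4 + g2 / 12"
      have "2 * b ^ 4 + b * e' + g2 / 12 = e' * b - (- X)" unfolding X_def by (simp add: algebra_simps)
      then have "2 * b ^ 4 + b * e' + g2 / 12 = 0 \<longleftrightarrow> e' * b = - X" by (simp only: right_minus_eq)
      then show ?thesis unfolding X_def nonzero_eq_divide_eq[OF that] .
    qed
    have 2: "e' ^ 2 = 4 * b ^ 6 - g2 * b\<^sup>2 - g3 \<longleftrightarrow> 192 * g2 * b ^ 4 + 144 * g3 * b\<^sup>2 + g2\<^sup>2 = 0"
      if h: "2 * b ^ 4 + b * e' + g2 / 12 = 0"
    proof -
      define w where "w = g2 / 12"
      have g: "g2 = 12 * w" by (simp add: w_def)
      \<comment> \<open>The factor \<open>144 * b ^ 2\<close> clears the denominators of the square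
        of \<open>e' = - (2 * b ^ 4 + g2 / 12) / b\<close>.\<close>
      have "e' ^ 2 = 4 * b ^ 6 - g2 * b\<^sup>2 - g3 \<longleftrightarrow> 144 * b\<^sup>2 * (e' ^ 2 - (4 * b ^ 6 - g2 * b\<^sup>2 - g3)) = 0"
        using \<open>b \<noteq> 0\<close> by simp
      also have "144 * b\<^sup>2 * (e' ^ 2 - (4 * b ^ 6 - g2 * b\<^sup>2 - g3)) = 192 * g2 * b ^ 4 + 144 * g3 * b\<^sup>2 + g2\<^sup>2"
        using h unfolding w_def[symmetric] g by algebra
      finally show ?thesis .
    qed
    show ?thesis using 1 2 by blast
  qed
  have b0: "b \<noteq> 0" if "2 * b ^ 4 + b * e' + g2 / 12 = 0" for b e' using that g2 by auto
  have pw: "(b\<^sup>2)\<^sup>2 = b ^ 4" "(b\<^sup>2) ^ 3 = b ^ 6" for b :: complex by (simp_all flip: power_mult)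
  have "sols_trivial g2 g3 = ?f ` ?S"
  proof (intro equalityI subsetI)
    fix x assume "x \<in> sols_trivial g2 g3"
    then obtain e' b where x: "x = (b\<^sup>2, e', b, b\<^sup>2)"
      and h: "2 * b ^ 4 + b * e' + g2 / 12 = 0" "e' ^ 2 = 4 * b ^ 6 - g2 * b\<^sup>2 - g3"
      by (auto simp: sols_trivial_def pw)
    have "192 * g2 * b ^ 4 + 144 * g3 * b\<^sup>2 + g2\<^sup>2 = 0 \<and> e' = - (2 * b ^ 4 + g2 / 12) / b"
      using iff[OF b0[OF h(1)]] h by blast
    then have "(b\<^sup>2, b) \<in> ?S" "x = ?f (b\<^sup>2, b)" using x by (simp_all add: pw)
    then show "x \<in> ?f ` ?S" by blast
  next
    fix x assume "x \<in> ?f ` ?S"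
    then obtain b where b: "192 * g2 * b ^ 4 + 144 * g3 * b\<^sup>2 + g2\<^sup>2 = 0"
      "x = (b\<^sup>2, - (2 * b ^ 4 + g2 / 12) / b, b, b\<^sup>2)" by (auto simp: pw)
    have "b \<noteq> 0" using b(1) g2 by auto
    from iff[OF this, of "- (2 * b ^ 4 + g2 / 12) / b"] b(1)
    have "2 * b ^ 4 + b * (- (2 * b ^ 4 + g2 / 12) / b) + g2 / 12 = 0 \<and>
      (- (2 * b ^ 4 + g2 / 12) / b) ^ 2 = 4 * b ^ 6 - g2 * b\<^sup>2 - g3" by blast
    then show "x \<in> sols_trivial g2 g3" unfolding b(2) sols_trivial_def by (simp only: mem_Collect_eq case_prod_conv pw simp_thms)
  qed
  moreover have "inj_on ?f ?S" by (auto simp: inj_on_def)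
  ultimately show "card (sols_trivial g2 g3) = 4" using S by (simp add: card_image)
  show "(e, e', b, k) \<in> sols_trivial g2 g3 \<Longrightarrow> k \<noteq> 0"
    using g2 by (auto simp: sols_trivial_def)
qed

text \<open>The quadratic for \<open>u = e - r\<close> has discriminant
  \<open>144 * (s - t) ^ 2\<close>, and \<open>e'\<close> is a square root of the cubic at
  \<open>e\<close>. The assumptions \<open>nd\<close> keep \<open>e\<close> away from
  \<open>s\<close> and \<open>t\<close>, where both signs of \<open>e'\<close> would
  coincide.\<close>

lemma card_sols_half:
  fixes r s t :: complex
  assumes sum: "r + s + t = 0" and distinct: "r \<noteq> s" "r \<noteq> t" "s \<noteq> t"
    and nd: "2 * r + 7 * s \<noteq> 0" "2 * r + 7 * t \<noteq> 0"
  shows "card (sols_half r s t) = 4" "(e, e', b, k) \<in> sols_half r s t \<Longrightarrow> k \<noteq> 0"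
proof -
  define Q where "Q = 9 * (r - s) * (r - t)"
  have Q0: "Q \<noteq> 0" using distinct by (simp add: Q_def)
  have z0: "u \<noteq> 0" if "16 * u\<^sup>2 + 36 * r * u + Q = 0" for u using that Q0 by auto
  have "(36 * r)\<^sup>2 - 4 * 16 * Q = 144 * (s - t)\<^sup>2" unfolding Q_def using sum by algebra
  then have "(36 * r)\<^sup>2 - 4 * 16 * Q \<noteq> 0" using distinct by simp
  then obtain u1 u2 where u: "u1 \<noteq> u2" "\<And>u. 16 * u\<^sup>2 + 36 * r * u + Q = 0 \<longleftrightarrow> u = u1 \<or> u = u2"
    by (rule quadratic_two_roots[rotated, of "36 * r" 16 Q]; (simp; fail)?; blast)
  let ?c = "\<lambda>u. 4 * u * (r + u - s) * (r + u - t)"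
  have c0: "?c u \<noteq> 0" if "16 * u\<^sup>2 + 36 * r * u + Q = 0" for u
  proof
    assume "?c u = 0"
    then have "r + u - s = 0 \<or> r + u - t = 0" using z0[OF that] by simp
    then show False
    proof
      assume "r + u - s = 0"
      then have us: "u = s - r" by algebra
      have "(r - s) * (2 * r + 7 * s) = 0" using that us sum unfolding Q_def by algebra
      then show False using nd distinct by simp
    next
      assume "r + u - t = 0"
      then have us: "u = t - r" by algebra
      have "(r - t) * (2 * r + 7 * t) = 0" using that us sum unfolding Q_def by algebra
      then show False using nd distinct by simp
    qed
  qed
  let ?S = "{(u, w). 16 * u\<^sup>2 + 36 * r * u + Q = 0 \<and> w\<^sup>2 = ?c u}"
  let ?f = "\<lambda>(u, w). (r + u, w, - w / (2 * u), u / 9)"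
  have S: "card ?S = 4"
    by (rule card_double_cover[where c = ?c, OF u]) (rule c0, simp only: u simp_thms)+
  have "sols_half r s t = ?f ` ?S"
  proof (intro equalityI subsetI)
    fix x assume "x \<in> sols_half r s t"
    then obtain e e' b where x: "x = (e, e', b, (e - r) / 9)" and h: "e' = - 2 * (e - r) * b"
      "16 * (e - r)\<^sup>2 + 36 * r * (e - r) + Q = 0" "e' ^ 2 = 4 * (e - r) * (e - s) * (e - t)"
      by (auto simp: sols_half_def Q_def)
    have "b = - e' / (2 * (e - r))" using h(1) z0[OF h(2)] by (simp add: field_simps)
    then have "x = ?f (e - r, e')" "(e - r, e') \<in> ?S" using x h(2,3) by simp_all
    then show "x \<in> ?f ` ?S" by blast
  next
    fix x assume "x \<in> ?f ` ?S"
    then obtain u w where x: "x = (r + u, w, - w / (2 * u), u / 9)" and h: "16 * u\<^sup>2 + 36 * r * u + Q = 0" "w\<^sup>2 = ?c u"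
      by auto
    then show "x \<in> sols_half r s t" using z0[OF h(1)] by (simp add: sols_half_def Q_def)
  qed
  moreover have "inj_on ?f ?S" by (auto simp: inj_on_def)
  ultimately show "card (sols_half r s t) = 4" using S by (simp add: card_image)
  show "(e, e', b, k) \<in> sols_half r s t \<Longrightarrow> k \<noteq> 0"
    using z0[of "e - r"] by (auto simp: sols_half_def Q_def)
qed

text \<open>The two formulas for \<open>k\<close> give \<open>r = - 8 * e\<close>; then the
  quadratic equation becomes \<open>s = t\<close>.\<close>

lemma sols_trivial_half_disjoint:
  fixes r s t :: complex
  assumes sum: "r + s + t = 0" and distinct: "r \<noteq> s" "s \<noteq> t" "r \<noteq> t"
  shows "sols_trivial g2 g3 \<inter> sols_half r s t = {}"
proof (rule ccontr)
  assume "sols_trivial g2 g3 \<inter> sols_half r s t \<noteq> {}"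
  then obtain e where "e = (e - r) / 9" and q: "16 * (e - r)\<^sup>2 + 36 * r * (e - r) + 9 * (r - s) * (r - t) = 0"
    by (auto simp: sols_trivial_def sols_half_def)
  then have "r = - 8 * e" by (simp add: field_simps) algebra
  then have "9 * (s - t)\<^sup>2 = 0" using q sum by algebra
  then show False using distinct by simp
qed

subsection \<open>Orders of zeros and poles\<close>

lemma zorder_eq_0_of_lim:
  assumes "f meromorphic_on UNIV" "f \<midarrow>z\<rightarrow> L" "L \<noteq> 0"
  shows "zorder f z = 0"
proof (rule not_pole_not_isolated_zero_imp_zorder_eq_0)
  show "f meromorphic_on {z}" by (rule mero_at[OF assms(1)])
  show "\<not> is_pole f z" by (rule lim_not_pole[OF assms(2)])
  show "\<not> isolated_zero f z"
    using assms(2,3) tendsto_unique[of "at z" f L 0] by (auto simp: isolated_zero_def)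
  have "eventually (\<lambda>w. f w \<noteq> 0) (at z)"
    using assms(2,3) by (rule tendsto_imp_eventually_ne)
  then show "frequently (\<lambda>w. f w \<noteq> 0) (at z)" by (intro eventually_frequently) auto
qed

lemma mero_nz_cosparse:
  assumes "f meromorphic_on UNIV" "f \<midarrow>z\<rightarrow> L" "L \<noteq> 0"
  shows "eventually (\<lambda>w. f w \<noteq> 0) (cosparse UNIV)"
proof (rule ccontr)
  assume "\<not> ?thesis"
  then have "eventually (\<lambda>w. f w = 0) (cosparse UNIV)"
    using cosparse_mero_cases[OF assms(1), of 0] by blast
  then have "eventually (\<lambda>w. f w = 0) (at z)" by (rule cosparse_at)
  moreover have "eventually (\<lambda>w. f w \<noteq> 0) (at z)"
    using assms(2,3) by (rule tendsto_imp_eventually_ne)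
  ultimately have "eventually (\<lambda>w. False) (at z)" by eventually_elim simp
  then show False by simp
qed

lemma zorder_power_self: "zorder (\<lambda>w. w ^ n) (0::complex) = int n"
proof -
  have "zorder (\<lambda>w. (w - 0) ^ n :: complex) 0 = int n"
    by (rule zorder_eqI[where S = UNIV and g = "\<lambda>_. 1"]) auto
  then show ?thesis by simp
qed

lemma zorder_of_lim:
  assumes f: "f meromorphic_on UNIV" and lim: "((\<lambda>w. w ^ n * f w) \<longlongrightarrow> L) (at 0)" and "L \<noteq> 0"
  shows "zorder f 0 = - int n" "eventually (\<lambda>w. f w \<noteq> 0) (cosparse UNIV)"
proof -
  have m: "(\<lambda>w. w ^ n * f w) meromorphic_on UNIV" by (intro meromorphic_intros f)
  have "eventually (\<lambda>w. w ^ n * f w \<noteq> 0) (cosparse UNIV)" by (rule mero_nz_cosparse[OF m lim \<open>L \<noteq> 0\<close>])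
  then show nz: "eventually (\<lambda>w. f w \<noteq> 0) (cosparse UNIV)" by eventually_elim auto
  have "0 = zorder (\<lambda>w. w ^ n * f w) 0" by (rule zorder_eq_0_of_lim[OF m lim \<open>L \<noteq> 0\<close>, symmetric])
  also have "\<dots> = zorder (\<lambda>w. w ^ n) 0 + zorder f 0"
  proof (rule zorder_mult)
    have "eventually (\<lambda>w::complex. w ^ n \<noteq> 0) (at 0)"
      unfolding eventually_at by (auto intro: exI[of _ 1])
    then show "frequently (\<lambda>w::complex. w ^ n \<noteq> 0) (at 0)" by (intro eventually_frequently) auto
  qed (auto intro!: meromorphic_intros mero_at[OF f] cosparse_frequently[OF nz])
  finally show "zorder f 0 = - int n" by (simp add: zorder_power_self)
qed

lemma zorder_nonneg:
  assumes "f meromorphic_on UNIV" "eventually (\<lambda>w. f w \<noteq> 0) (cosparse UNIV)" "\<not> is_pole f z"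
  shows "zorder f z \<ge> 0"
  using mero_pole_iff[OF assms(1,2)] assms(3) by (simp add: not_less)

context half_plane
begin

text \<open>The divisor has degree 0 by \<open>ell_factorization\<close>, so the degree, defined
  through poles, also counts zeros.\<close>

lemma ell_degree_eq_zeros:
  assumes f: "ell f" and nz: "eventually (\<lambda>z. f z \<noteq> 0) (cosparse UNIV)"
  shows "int (ell_degree \<tau> f) = (\<Sum>p\<in>{p \<in> fund_par \<tau>. zorder f p > 0}. zorder f p)"
    and "int (ell_degree \<tau> f) = (\<Sum>p\<in>{p \<in> fund_par \<tau>. zorder f p < 0}. - zorder f p)"
proof -
  let ?N = "{p \<in> fund_par \<tau>. zorder f p < 0}" and ?P = "{p \<in> fund_par \<tau>. zorder f p > 0}"
  have fin: "finite (divisor f)" by (rule ell_zero_set_finite[OF f nz])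
  have "{z \<in> fund_par \<tau>. is_pole f z} = ?N" using mero_pole_iff[OF ell_mero[OF f] nz] by auto
  then have "int (ell_degree \<tau> f) = (\<Sum>p\<in>?N. int (nat (- zorder f p)))"
    by (simp add: ell_degree_def)
  also have "\<dots> = (\<Sum>p\<in>?N. - zorder f p)" by (intro sum.cong) auto
  finally show N: "int (ell_degree \<tau> f) = (\<Sum>p\<in>?N. - zorder f p)" .
  have D: "divisor f = ?N \<union> ?P" by auto
  then have "finite ?N" "finite ?P" using fin by simp_all
  then have "sum (zorder f) (?N \<union> ?P) = sum (zorder f) ?N + sum (zorder f) ?P"
    by (intro sum.union_disjoint) auto
  then have "(\<Sum>p\<in>?N. zorder f p) + (\<Sum>p\<in>?P. zorder f p) = 0"
    using ell_factorization(1)[OF f nz] D by simp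
  then show "int (ell_degree \<tau> f) = (\<Sum>p\<in>?P. zorder f p)" using N by (simp add: sum_negf)
qed

lemma ell_zeros_le_degree:
  assumes f: "ell f" and nz: "eventually (\<lambda>z. f z \<noteq> 0) (cosparse UNIV)"
    and A: "A \<subseteq> fund_par \<tau>" "\<And>p. p \<in> A \<Longrightarrow> zorder f p > 0"
  shows "(\<Sum>p\<in>A. zorder f p) \<le> int (ell_degree \<tau> f)"
  unfolding ell_degree_eq_zeros(1)[OF f nz]
proof (rule sum_mono2)
  show "finite {p \<in> fund_par \<tau>. 0 < zorder f p}"
    by (rule finite_subset[OF _ ell_zero_set_finite[OF f nz]]) auto
qed (use A in auto)

lemma ell_poles_le_degree:
  assumes f: "ell f" and nz: "eventually (\<lambda>z. f z \<noteq> 0) (cosparse UNIV)"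
    and A: "A \<subseteq> fund_par \<tau>" "\<And>p. p \<in> A \<Longrightarrow> zorder f p < 0"
  shows "(\<Sum>p\<in>A. - zorder f p) \<le> int (ell_degree \<tau> f)"
  unfolding ell_degree_eq_zeros(2)[OF f nz]
proof (rule sum_mono2)
  show "finite {p \<in> fund_par \<tau>. zorder f p < 0}"
    by (rule finite_subset[OF _ ell_zero_set_finite[OF f nz]]) auto
qed (use A in auto)

text \<open>For meromorphic functions this is ordinary non-constancy, by
  \<open>cosparse_mero_cases\<close>; this form supplies the non-vanishing conditions that order
  computations require.\<close>

definition nonconst :: "(complex \<Rightarrow> complex) \<Rightarrow> bool" where
  "nonconst f \<longleftrightarrow> (\<forall>c. eventually (\<lambda>z. f z \<noteq> c) (cosparse UNIV))"

lemma nonconst_pole: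
  assumes "f meromorphic_on UNIV" "is_pole f z"
  shows "nonconst f"
  unfolding nonconst_def
proof (intro allI, rule ccontr)
  fix c assume "\<not> eventually (\<lambda>z. f z \<noteq> c) (cosparse UNIV)"
  then have "eventually (\<lambda>z. f z = c) (cosparse UNIV)"
    using cosparse_mero_cases[OF assms(1)] by blast
  then have "frequently (\<lambda>z. f z = c) (at z)" by (rule cosparse_frequently)
  then show False using frequently_const_imp_not_is_pole[of f c z] assms(2) by blast
qed

lemma nonconst_minus_nz:
  "nonconst f \<Longrightarrow> eventually (\<lambda>z. f z - c \<noteq> 0) (cosparse UNIV)"
  unfolding nonconst_def by (auto elim: eventually_mono)

lemma zorder_minus_const_pole:
  assumes "f meromorphic_on UNIV" "is_pole f z"
  shows "zorder (\<lambda>w. f w - c) z = zorder f z"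
proof (cases "c = 0")
  case False
  have nz: "eventually (\<lambda>w. f w \<noteq> 0) (cosparse UNIV)"
    using nonconst_pole[OF assms] by (simp add: nonconst_def)
  have "zorder (\<lambda>w. - c :: complex) z = 0"
    by (rule zorder_zero_eqI[where S = UNIV]) (use False in auto)
  moreover have "zorder f z < 0" using mero_pole_iff[OF assms(1) nz] assms(2) by blast
  ultimately have "zorder (\<lambda>w. f w + - c) z = zorder f z"
    using False by (intro zorder_add1) (auto intro: mero_at[OF assms(1)] cosparse_frequently[OF nz])
  then show ?thesis by simp
qed simp

lemma mero_lim_remove_sings:
  assumes "f meromorphic_on UNIV" "\<not> is_pole f z"
  shows "f \<midarrow>z\<rightarrow> remove_sings f z"
  using mero_not_pole_lim[OF assms] remove_sings_eqI by blast

lemma zorder_value: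
  assumes "f meromorphic_on UNIV" "nonconst f" "\<not> is_pole f z"
  shows "zorder (\<lambda>w. f w - remove_sings f z) z > 0"
proof -
  have m: "(\<lambda>w. f w - remove_sings f z) meromorphic_on UNIV" by (intro meromorphic_intros assms)
  have "((\<lambda>w. f w - remove_sings f z) \<longlongrightarrow> remove_sings f z - remove_sings f z) (at z)"
    by (intro tendsto_intros mero_lim_remove_sings assms)
  then have "isolated_zero (\<lambda>w. f w - remove_sings f z) z"
    using cosparse_at[OF nonconst_minus_nz[OF assms(2)]] by (simp add: isolated_zero_def)
  then show ?thesis by (intro zorder_isolated_zero_pos' mero_iso m)
qed

lemma deriv_minus_const_cosparse:
  assumes "f meromorphic_on UNIV"
  shows "eventually (\<lambda>w. deriv (\<lambda>w. f w - c) w = deriv f w) (cosparse UNIV)"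
  using analytic_cosparse[OF assms]
proof eventually_elim
  case (elim z)
  then have "f field_differentiable at z" by (simp add: analytic_on_imp_differentiable_at)
  then have "(f has_field_derivative deriv f z) (at z)" by (simp add: field_differentiable_derivI)
  from DERIV_diff[OF this DERIV_const] show ?case by (simp add: DERIV_imp_deriv)
qed

lemma zorder_deriv_value:
  assumes "f meromorphic_on UNIV" "nonconst f" "\<not> is_pole f z"
  shows "zorder (deriv f) z = zorder (\<lambda>w. f w - remove_sings f z) z - 1"
proof -
  let ?g = "\<lambda>w. f w - remove_sings f z"
  have m: "?g meromorphic_on UNIV" by (intro meromorphic_intros assms)
  have "zorder (deriv f) z = zorder (deriv ?g) z"
    by (rule zorder_cong[OF _ refl])
       (use cosparse_at[OF deriv_minus_const_cosparse[OF assms(1), of "remove_sings f z"], of z]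
         in eventually_elim, simp)
  also have "\<dots> = zorder ?g z - 1"
    using zorder_value[OF assms]
    by (intro zorder_deriv_minus_1 mero_iso mero_ness m cosparse_frequently nonconst_minus_nz assms) auto
  finally show ?thesis .
qed

lemma zorder_deriv_pole:
  assumes "f meromorphic_on UNIV" "is_pole f z"
  shows "zorder (deriv f) z = zorder f z - 1"
  using zorder_deriv[OF assms(2) mero_iso[OF assms(1)]] .

lemma deriv_nz:
  assumes "f meromorphic_on UNIV" "is_pole f z"
  shows "eventually (\<lambda>w. deriv f w \<noteq> 0) (cosparse UNIV)"
proof -
  have "is_pole (deriv f) z" using is_pole_deriv[OF assms(2) mero_iso[OF assms(1)]] .
  moreover have "deriv f meromorphic_on UNIV" by (intro meromorphic_intros assms)
  ultimately show ?thesis using nonconst_pole unfolding nonconst_def by blast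
qed

lemma ram_index_pole: "is_pole f z \<Longrightarrow> ram_index f z = nat (- zorder f z)"
  by (simp add: ram_index_def)

text \<open>Away from poles, triple ramification thus means a zero of the derivative of order at
  least 2.\<close>

lemma ram_index_deriv:
  assumes "f meromorphic_on UNIV" "nonconst f" "\<not> is_pole f z"
  shows "int (ram_index f z) = zorder (deriv f) z + 1"
  using zorder_deriv_value[OF assms] zorder_value[OF assms] assms(3) by (simp add: ram_index_def)

end

subsection \<open>Normal form of the covers\<close>

text \<open>The quotient rule for \<open>cover_fun\<close> as pure algebra, with
  \<open>x' = y\<close> and \<open>y' = 6 * x ^ 2 - g2 / 2\<close> inserted.\<close>

lemma cover_num_deriv_identity:
  fixes x y e e' b k g2 g3 :: complex
  assumes "x \<noteq> e" "y ^ 2 = 4 * x ^ 3 - g2 * x - g3"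
  shows "((6 * x\<^sup>2 - g2 / 2) / 6 + b * y - k / 2 * (((6 * x\<^sup>2 - g2 / 2) * (x - e) - (y + e') * y) / ((x - e) * (x - e)))) * (x - e)\<^sup>2
    = cover_num g2 g3 e e' b k x y"
proof -
  have q: "(P - c * (M / (d * d))) * d\<^sup>2 = P * d\<^sup>2 - c * M" if "d \<noteq> 0" for P c M d :: complex
    using that by (simp add: left_diff_distrib power2_eq_square)
  have c: "(X + b * y) * d - k / 2 * (M - e' * y) = X * d - k / 2 * M + y * (b * d + k * e' / 2)" for X d M
    by (simp add: field_simps)
  have X: "(6 * x\<^sup>2 - g2 / 2) / 6 = x\<^sup>2 - g2 / 12" by (simp add: diff_divide_distrib)
  have "(6 * x\<^sup>2 - g2 / 2) * (x - e) - (y + e') * y = (6 * x\<^sup>2 - g2 / 2) * (x - e) - y ^ 2 - e' * y"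
    by (simp add: power2_eq_square algebra_simps)
  also have "\<dots> = (2 * x ^ 3 - 6 * e * x\<^sup>2 + g2 / 2 * x + g2 * e / 2 + g3) - e' * y"
    unfolding assms(2) by (simp add: field_simps power2_eq_square power3_eq_cube)
  finally have M: "(6 * x\<^sup>2 - g2 / 2) * (x - e) - (y + e') * y =
    (2 * x ^ 3 - 6 * e * x\<^sup>2 + g2 / 2 * x + g2 * e / 2 + g3) - e' * y" .
  have "x - e \<noteq> 0" using assms(1) by simp
  from q[OF this] show ?thesis unfolding M X cover_num_def c[symmetric] by blast
qed

context half_plane
begin

text \<open>At \<open>(e, e') = (wp a, wp' a)\<close> the last quotient has simple poles at 0 and
  \<open>a\<close> only, as the numerator cancels the zero of \<open>wp - e\<close> at
  \<open>- a\<close>. The resulting residues are \<open>k\<close> at 0 and \<open>- k\<close> at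
  \<open>a\<close>.\<close>

definition cover_fun :: "complex \<Rightarrow> complex \<Rightarrow> complex \<Rightarrow> complex \<Rightarrow> complex \<Rightarrow> complex" where
  "cover_fun e e' b k z = wp' z / 6 + b * wp z - k / 2 * ((wp' z + e') / (wp z - e))"

lemma ell_cover_fun: "ell (cover_fun e e' b k)"
  unfolding cover_fun_def[abs_def] by (intro ell_intros ell_wp ell_wp')

lemma cover_fun_mero: "cover_fun e e' b k meromorphic_on UNIV"
  by (rule ell_mero[OF ell_cover_fun])

lemma cover_fun_lim: "((\<lambda>z. z ^ 3 * cover_fun e e' b k z) \<longlongrightarrow> - 1 / 3) (at 0)"
proof -
  have "((\<lambda>z. (z ^ 3 * wp' z) / 6 + b * z * (z ^ 2 * wp z)
      - k / 2 * (z ^ 2 * (z ^ 3 * wp' z + e' * z ^ 3) / (z ^ 2 * (wp z - e)))) \<longlongrightarrow>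
      (- 2) / 6 + b * 0 * 1 - k / 2 * (0 ^ 2 * (- 2 + e' * 0 ^ 3) / 1)) (at 0)"
    by (intro tendsto_intros lim_wp lim_wp' lim_wp_minus) auto
  then have "((\<lambda>z. (z ^ 3 * wp' z) / 6 + b * z * (z ^ 2 * wp z)
      - k / 2 * (z ^ 2 * (z ^ 3 * wp' z + e' * z ^ 3) / (z ^ 2 * (wp z - e)))) \<longlongrightarrow> - 1 / 3) (at 0)"
    by simp
  then show ?thesis
  proof (rule Lim_transform_within_open[where s = UNIV])
    fix z :: complex assume "z \<noteq> 0"
    have "z ^ 2 * (z ^ 3 * wp' z + e' * z ^ 3) / (z ^ 2 * (wp z - e)) = (z ^ 3 * wp' z + e' * z ^ 3) / (wp z - e)"
      using \<open>z \<noteq> 0\<close> by simp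
    also have "\<dots> = z ^ 3 * ((wp' z + e') / (wp z - e))" by (simp add: distrib_left mult.commute)
    finally have "z ^ 2 * (z ^ 3 * wp' z + e' * z ^ 3) / (z ^ 2 * (wp z - e)) = z ^ 3 * ((wp' z + e') / (wp z - e))" .
    then show "(z ^ 3 * wp' z) / 6 + b * z * (z ^ 2 * wp z)
      - k / 2 * (z ^ 2 * (z ^ 3 * wp' z + e' * z ^ 3) / (z ^ 2 * (wp z - e))) = z ^ 3 * cover_fun e e' b k z"
      by (simp add: cover_fun_def algebra_simps power2_eq_square power3_eq_cube)
  qed auto
qed

lemma zorder_cover_fun_0: "zorder (cover_fun e e' b k) 0 = - 3"
  and cover_fun_nz: "eventually (\<lambda>z. cover_fun e e' b k z \<noteq> 0) (cosparse UNIV)"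
  using zorder_of_lim[OF cover_fun_mero cover_fun_lim] by auto

lemma cover_fun_pole_0: "is_pole (cover_fun e e' b k) 0"
  using mero_pole_iff[OF cover_fun_mero cover_fun_nz] zorder_cover_fun_0 by simp

lemma cover_fun_nonconst: "nonconst (cover_fun e e' b k)"
  by (rule nonconst_pole[OF cover_fun_mero cover_fun_pole_0])

lemma wp_lim: "z \<notin> \<Lambda> \<Longrightarrow> wp \<midarrow>z\<rightarrow> wp z"
  and wp'_lim: "z \<notin> \<Lambda> \<Longrightarrow> wp' \<midarrow>z\<rightarrow> wp' z"
  using analytic_at_imp_isCont[OF wp_analytic] analytic_at_imp_isCont[OF wp'_analytic]
  by (simp_all only: isCont_def)

lemma wp_minus_nz: "eventually (\<lambda>z. wp z - c \<noteq> 0) (cosparse UNIV)"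
  using wp_nz_cosparse[of c] by eventually_elim simp

lemma nonconst_wp: "nonconst wp"
  using wp_nz_cosparse by (simp add: nonconst_def)

lemma wp'_plus_nz: "eventually (\<lambda>z. wp' z + c \<noteq> 0) (cosparse UNIV)"
proof -
  have "zorder wp' 0 = - 3" "eventually (\<lambda>z. wp' z \<noteq> 0) (cosparse UNIV)"
    using zorder_of_lim[OF wp_mero(2) lim_wp'] by auto
  then have "is_pole wp' 0" using mero_pole_iff[OF wp_mero(2)] by auto
  from nonconst_minus_nz[OF nonconst_pole[OF wp_mero(2) this], of "- c"] show ?thesis by simp
qed

text \<open>If \<open>a\<close> is a half-period, the denominator has a double zero and the
  numerator, which is then \<open>wp'\<close>, a simple one. Otherwise the denominator has a simple
  zero and the numerator none.\<close>

lemma zorder_quot: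
  assumes a: "a \<notin> \<Lambda>"
  shows "zorder (\<lambda>z. (wp' z + wp' a) / (wp z - wp a)) a = - 1"
proof -
  have m: "(\<lambda>z. wp' z + wp' a) meromorphic_on UNIV" by (intro meromorphic_intros wp_mero)
  have m2: "(\<lambda>z. wp z - wp a) meromorphic_on UNIV" by (intro meromorphic_intros wp_mero)
  have zx: "zorder (\<lambda>z. wp z - wp a) a = 1 + of_bool (2 * a \<in> \<Lambda>)"
    using a zorder_wp_diff[OF a, of a] by simp
  have zy: "zorder (\<lambda>z. wp' z + wp' a) a = of_bool (2 * a \<in> \<Lambda>)"
  proof (cases "2 * a \<in> \<Lambda>")
    case True
    have "\<not> is_pole wp a" by (rule lim_not_pole[OF wp_lim[OF a]])
    then have "zorder wp' a = zorder (\<lambda>w. wp w - remove_sings wp a) a - 1"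
      by (rule zorder_deriv_value[OF wp_mero(1) nonconst_wp])
    moreover have "remove_sings wp a = wp a" by (rule remove_sings_eqI[OF wp_lim[OF a]])
    ultimately show ?thesis using zx True wp'_half[OF a True] by simp
  next
    case False
    have "((\<lambda>z. wp' z + wp' a) \<longlongrightarrow> wp' a + wp' a) (at a)" by (intro tendsto_intros wp'_lim a)
    moreover have "wp' a + wp' a \<noteq> 0" using wp'_eq_0[OF a] False by simp
    ultimately show ?thesis using zorder_eq_0_of_lim[OF m] False by simp
  qed
  have "zorder (\<lambda>z. (wp' z + wp' a) / (wp z - wp a)) a = zorder (\<lambda>z. wp' z + wp' a) a - zorder (\<lambda>z. wp z - wp a) a"
    by (rule zorder_divide[OF mero_at[OF m] cosparse_frequently[OF wp'_plus_nz]
        mero_at[OF m2] cosparse_frequently[OF wp_minus_nz]])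
  then show ?thesis using zx zy by simp
qed

lemma quot_lim:
  assumes a: "a \<notin> \<Lambda>" and z: "z \<notin> \<Lambda>" "z - a \<notin> \<Lambda>"
  shows "\<exists>c. (\<lambda>z. (wp' z + wp' a) / (wp z - wp a)) \<midarrow>z\<rightarrow> c"
proof (cases "wp z = wp a")
  case False
  then have "((\<lambda>z. (wp' z + wp' a) / (wp z - wp a)) \<longlongrightarrow> (wp' z + wp' a) / (wp z - wp a)) (at z)"
    by (intro tendsto_intros wp_lim wp'_lim z) simp
  then show ?thesis by blast
next
  case True
  then have za: "z + a \<in> \<Lambda>" using wp_eq_iff[OF a z(1)] z(2) by blast
  have "2 * a \<notin> \<Lambda>"
  proof
    assume "2 * a \<in> \<Lambda>"
    then have "z + a - 2 * a \<in> \<Lambda>" by (rule lattice_diff[OF za])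
    then show False using z(2) by (simp add: algebra_simps)
  qed
  then have nz: "wp' a \<noteq> 0" using wp'_eq_0[OF a] by simp
  have "wp' z = wp' (- a)" using wp'_periodic[of "- a" "z + a"] za a by (simp add: add.commute)
  then have w: "wp' z - wp' a \<noteq> 0" using wp'_uminus[OF a] nz by simp
  \<comment> \<open>At \<open>- a\<close> both numerator and denominator vanish. Expanding by the
    conjugate \<open>wp' w - wp' a\<close> and using the equation of the curve turns the quotient
    into one with nonzero denominator.\<close>
  let ?g = "\<lambda>w. (4 * wp w ^ 2 + 4 * wp w * wp a + 4 * wp a ^ 2 - g2) / (wp' w - wp' a)"
  have "(?g \<longlongrightarrow> ?g z) (at z)"
    by (intro tendsto_intros wp_lim wp'_lim z w)
  moreover have "eventually (\<lambda>w. ?g w = (wp' w + wp' a) / (wp w - wp a)) (at z)"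
    using cosparse_at[OF wp'_plus_nz[of "- wp' a"], of z] cosparse_at[OF wp_minus_nz[of "wp a"], of z]
      cosparse_at[OF Lambda_cosparse, of z]
  proof eventually_elim
    case (elim w)
    have "(4 * wp w ^ 2 + 4 * wp w * wp a + 4 * wp a ^ 2 - g2) * (wp w - wp a) = wp' w ^ 2 - wp' a ^ 2"
      unfolding wp_ode'[OF elim(3)] wp_ode'[OF a] by algebra
    also have "\<dots> = (wp' w + wp' a) * (wp' w - wp' a)" by algebra
    finally show ?case using elim by (simp add: frac_eq_eq)
  qed
  ultimately have "(\<lambda>z. (wp' z + wp' a) / (wp z - wp a)) \<midarrow>z\<rightarrow> ?g z" by (rule Lim_transform_eventually)
  then show ?thesis by (rule exI)
qed

lemma cover_fun_deriv:
  assumes "z \<notin> \<Lambda>" "wp z \<noteq> e"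
  shows "deriv (cover_fun e e' b k) z * (wp z - e)\<^sup>2 = cover_num g2 g3 e e' b k (wp z) (wp' z)"
proof -
  have "(cover_fun e e' b k has_field_derivative (deriv wp' z / 6 + b * wp' z
     - k / 2 * (((deriv wp' z + 0) * (wp z - e) - (wp' z + e') * (wp' z - 0)) / ((wp z - e) * (wp z - e))))) (at z)"
    unfolding cover_fun_def[abs_def]
    by (intro DERIV_diff DERIV_add DERIV_cdivide DERIV_cmult DERIV_divide wp_deriv wp'_deriv DERIV_const assms)
       (use assms in simp)
  then have "deriv (cover_fun e e' b k) z = (6 * wp z ^ 2 - g2 / 2) / 6 + b * wp' z
     - k / 2 * (((6 * wp z ^ 2 - g2 / 2) * (wp z - e) - (wp' z + e') * wp' z) / ((wp z - e) * (wp z - e)))"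
    by (simp only: DERIV_imp_deriv wp''[OF assms(1)] add_0_right diff_0_right)
  then show ?thesis using cover_num_deriv_identity[OF assms(2) wp_ode'[OF assms(1)]] by simp
qed

lemma cover_fun_deriv_cosparse:
  "eventually (\<lambda>z. deriv (cover_fun e e' b k) z * (wp z - e)\<^sup>2 = cover_num g2 g3 e e' b k (wp z) (wp' z)) (cosparse UNIV)"
  using wp_nz_cosparse[of e] Lambda_cosparse by eventually_elim (intro cover_fun_deriv)

context
  fixes a b k :: complex
  assumes a: "a \<notin> \<Lambda>" and k: "k \<noteq> 0"
begin

abbreviation "F \<equiv> cover_fun (wp a) (wp' a) b k"

lemma zorder_cover_fun_a: "zorder F a = - 1"
proof -
  let ?G = "\<lambda>z. wp' z / 6 + b * wp z" and ?q = "\<lambda>z. - k / 2 * ((wp' z + wp' a) / (wp z - wp a))"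
  have zq: "zorder ?q a = - 1" using zorder_quot[OF a] k by (subst zorder_cmult) auto
  have G: "?G meromorphic_on UNIV" by (intro meromorphic_intros wp_mero)
  have q: "?q meromorphic_on UNIV" by (intro meromorphic_intros wp_mero)
  have Gnz: "eventually (\<lambda>z. ?G z \<noteq> 0) (cosparse UNIV)"
    using cover_fun_nz[of 0 0 b 0] by (simp add: cover_fun_def)
  have qnz: "eventually (\<lambda>z. ?q z \<noteq> 0) (cosparse UNIV)"
    using wp'_plus_nz[of "wp' a"] wp_minus_nz[of "wp a"] by eventually_elim (simp add: k)
  have "(?G \<longlongrightarrow> wp' a / 6 + b * wp a) (at a)" by (intro tendsto_intros wp_lim wp'_lim a) simp
  then have "\<not> is_pole ?G a" by (rule lim_not_pole)
  then have "zorder ?G a \<ge> 0" by (rule zorder_nonneg[OF G Gnz])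
  then have "zorder (\<lambda>z. ?q z + ?G z) a = zorder ?q a"
    using zq by (intro zorder_add1 mero_at q G cosparse_frequently qnz Gnz) simp
  moreover have "F = (\<lambda>z. ?q z + ?G z)" by (auto simp: cover_fun_def)
  ultimately show ?thesis using zq by simp
qed

lemma cover_fun_pole_iff: "is_pole F z \<longleftrightarrow> z \<in> \<Lambda> \<or> z - a \<in> \<Lambda>"
proof
  assume p: "is_pole F z"
  show "z \<in> \<Lambda> \<or> z - a \<in> \<Lambda>"
  proof (rule ccontr)
    assume n: "\<not> (z \<in> \<Lambda> \<or> z - a \<in> \<Lambda>)"
    then obtain c where c: "(\<lambda>z. (wp' z + wp' a) / (wp z - wp a)) \<midarrow>z\<rightarrow> c" using quot_lim[OF a] by blast
    have "(F \<longlongrightarrow> wp' z / 6 + b * wp z - k / 2 * c) (at z)"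
      unfolding cover_fun_def[abs_def] using n by (intro tendsto_intros wp_lim wp'_lim c) auto
    then show False using p lim_not_pole by blast
  qed
next
  assume "z \<in> \<Lambda> \<or> z - a \<in> \<Lambda>"
  moreover have "is_pole F a"
    using mero_pole_iff[OF cover_fun_mero cover_fun_nz] zorder_cover_fun_a by simp
  ultimately show "is_pole F z"
    using ell_pole_shift[OF ell_cover_fun, of z _ _ _ _ 0] cover_fun_pole_0
      ell_pole_shift[OF ell_cover_fun, of "z - a" _ _ _ _ a] by auto
qed

text \<open>The parameter \<open>a\<close> need not lie in the parallelogram in which degrees are
  counted.\<close>

lemma fund_rep:
  obtains a0 where "a0 \<in> fund_par \<tau>" "a - a0 \<in> \<Lambda>" "a0 \<noteq> 0"
    "{p \<in> fund_par \<tau>. is_pole F p} = {0, a0}" "zorder F a0 = - 1"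
proof -
  obtain a0 where a0: "a0 \<in> fund_par \<tau>" "a - a0 \<in> \<Lambda>" by (rule fund_par_exists)
  have "a0 \<noteq> 0" using a0(2) a by auto
  have "p \<in> \<Lambda> \<or> p - a \<in> \<Lambda> \<longleftrightarrow> p = 0 \<or> p = a0" if p: "p \<in> fund_par \<tau>" for p
  proof
    assume "p \<in> \<Lambda> \<or> p - a \<in> \<Lambda>"
    then show "p = 0 \<or> p = a0"
    proof
      assume "p - a \<in> \<Lambda>"
      then have "p - a0 \<in> \<Lambda>" using lattice_add[OF _ a0(2), of "p - a"] by simp
      then show ?thesis using fund_par_unique[OF p a0(1)] by blast
    qed (use fund_par_unique[OF p fund_par_0] in auto)
  next
    assume "p = 0 \<or> p = a0"
    moreover have "a0 - a \<in> \<Lambda>" using lattice_uminus[OF a0(2)] by simp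
    ultimately show "p \<in> \<Lambda> \<or> p - a \<in> \<Lambda>" by auto
  qed
  then have "{p \<in> fund_par \<tau>. is_pole F p} = {0, a0}" using a0 by (auto simp: cover_fun_pole_iff)
  moreover have "zorder F a0 = - 1"
    using ell_zorder_shift[OF ell_cover_fun a0(2), of _ _ _ _ a0] zorder_cover_fun_a by simp
  ultimately show ?thesis using that a0 \<open>a0 \<noteq> 0\<close> by blast
qed

lemma ell_degree_cover_fun: "ell_degree \<tau> F = 4"
proof -
  obtain a0 where a0: "a0 \<noteq> 0" "{p \<in> fund_par \<tau>. is_pole F p} = {0, a0}" "zorder F a0 = - 1"
    by (rule fund_rep) blast
  show ?thesis unfolding ell_degree_def a0(2) using a0 by (simp add: zorder_cover_fun_0)
qed

text \<open>Each of the two poles, of orders 3 and 1, gains one order.\<close>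

lemma ell_degree_deriv_cover_fun: "ell_degree \<tau> (deriv F) = 6"
proof -
  obtain a0 where a0: "a0 \<noteq> 0" "{p \<in> fund_par \<tau>. is_pole F p} = {0, a0}" "zorder F a0 = - 1"
    by (rule fund_rep) blast
  have p: "is_pole F 0" "is_pole F a0" using a0(2) by auto
  have e: "{p \<in> fund_par \<tau>. is_pole (deriv F) p} = {0, a0}"
    unfolding is_pole_deriv_iff[OF mero_at[OF cover_fun_mero]] by (rule a0(2))
  show ?thesis unfolding ell_degree_def e using a0
    by (simp add: zorder_deriv_pole[OF cover_fun_mero p(1)] zorder_deriv_pole[OF cover_fun_mero p(2)] zorder_cover_fun_0)
qed

end

end

section \<open>Even orders of the derivative and the parameter systems\<close>

context half_plane
begin

text \<open>One triple for each distinguished half-period value; \<open>sols_half\<close> is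
  symmetric in the other two, so their order is immaterial.\<close>

definition root_triples :: "(complex \<times> complex \<times> complex) set" where
  "root_triples = {(e1, e2, e3), (e2, e1, e3), (e3, e1, e2)}"

definition sols :: "(complex \<times> complex \<times> complex \<times> complex) set" where
  "sols = sols_trivial g2 g3 \<union> (\<Union>(r, s, t)\<in>root_triples. sols_half r s t)"

lemma root_triples_facts:
  assumes "(r, s, t) \<in> root_triples"
  shows "r + s + t = 0" "r \<noteq> s" "r \<noteq> t" "s \<noteq> t"
    "g2 = - 4 * (r * s + r * t + s * t)" "g3 = 4 * r * s * t"
    "4 * x ^ 3 - g2 * x - g3 = 4 * (x - r) * (x - s) * (x - t)"
    "\<exists>w. w \<notin> \<Lambda> \<and> 2 * w \<in> \<Lambda> \<and> wp w = r"
proof -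
  from assms consider "(r, s, t) = (e1, e2, e3)" | "(r, s, t) = (e2, e1, e3)" | "(r, s, t) = (e3, e1, e2)"
    by (auto simp: root_triples_def)
  then have "r + s + t = 0 \<and> r \<noteq> s \<and> r \<noteq> t \<and> s \<noteq> t \<and>
    g2 = - 4 * (r * s + r * t + s * t) \<and> g3 = 4 * r * s * t \<and>
    4 * (x - e1) * (x - e2) * (x - e3) = 4 * (x - r) * (x - s) * (x - t)"
    by cases (use e_sum e_distinct in \<open>auto simp: g2_def g3_def algebra_simps\<close>)
  then show "r + s + t = 0" "r \<noteq> s" "r \<noteq> t" "s \<noteq> t"
    "g2 = - 4 * (r * s + r * t + s * t)" "g3 = 4 * r * s * t"
    "4 * x ^ 3 - g2 * x - g3 = 4 * (x - r) * (x - s) * (x - t)"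
    unfolding cubic_g[symmetric] by blast+
  have "r \<in> {e1, e2, e3}" using assms by (auto simp: root_triples_def)
  then show "\<exists>w. w \<notin> \<Lambda> \<and> 2 * w \<in> \<Lambda> \<and> wp w = r"
    unfolding e1_def e2_def e3_def using half_notin' two_half by blast
qed

lemma root_triples_ex: "r \<in> {e1, e2, e3} \<Longrightarrow> \<exists>s t. (r, s, t) \<in> root_triples"
  by (auto simp: root_triples_def)

lemma zorder_wp_root_even:
  assumes "(r, s, t) \<in> root_triples"
  shows "even (zorder (\<lambda>z. wp z - r) z)"
proof -
  obtain w where w: "w \<notin> \<Lambda>" "2 * w \<in> \<Lambda>" "wp w = r" using root_triples_facts(8)[OF assms] by blast
  have "z + w \<in> \<Lambda> \<longleftrightarrow> z - w \<in> \<Lambda>"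
    using lattice_add_iff[OF w(2), of "z - w"] by (simp add: algebra_simps)
  then show ?thesis using zorder_wp_diff[OF w(1), of z] w(3) by simp
qed

lemma zorder_even_of_square:
  assumes "f meromorphic_on UNIV" "eventually (\<lambda>z. f z \<noteq> 0) (cosparse UNIV)"
    "g meromorphic_on UNIV" "eventually (\<lambda>z. g z \<noteq> 0) (cosparse UNIV)"
    "h meromorphic_on UNIV" "eventually (\<lambda>z. h z \<noteq> 0) (cosparse UNIV)" "even (zorder h z)"
    "K meromorphic_on UNIV" "eventually (\<lambda>z. f z * g z ^ 2 * h z = K z ^ 2) (cosparse UNIV)"
  shows "even (zorder f z)"
proof -
  have Knz: "eventually (\<lambda>z. K z \<noteq> 0) (cosparse UNIV)"
    using assms(2,4,6,9) by eventually_elim auto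
  have g2: "(\<lambda>z. g z ^ 2) meromorphic_on UNIV" "eventually (\<lambda>z. g z ^ 2 \<noteq> 0) (cosparse UNIV)"
    using assms(4) by (auto intro!: meromorphic_intros assms)
  have fg: "(\<lambda>z. f z * g z ^ 2) meromorphic_on UNIV" by (intro meromorphic_intros assms)
  have fgnz: "eventually (\<lambda>z. f z * g z ^ 2 \<noteq> 0) (cosparse UNIV)"
    using assms(2,4) by eventually_elim simp
  have "zorder (\<lambda>z. K z ^ 2) z = zorder (\<lambda>z. f z * g z ^ 2 * h z) z"
    by (rule zorder_cong[OF _ refl]) (use cosparse_at[OF assms(9), of z] in eventually_elim, simp)
  also have "\<dots> = zorder (\<lambda>z. f z * g z ^ 2) z + zorder h z"
    by (rule zorder_mult[OF mero_at[OF fg] cosparse_frequently[OF fgnz] mero_at[OF assms(5)] cosparse_frequently[OF assms(6)]])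
  also have "zorder (\<lambda>z. f z * g z ^ 2) z = zorder f z + zorder (\<lambda>z. g z ^ 2) z"
    by (rule zorder_mult[OF mero_at[OF assms(1)] cosparse_frequently[OF assms(2)] mero_at[OF g2(1)] cosparse_frequently[OF g2(2)]])
  also have "zorder (\<lambda>z. g z ^ 2) z = 2 * zorder g z"
    using zorder_power[OF mero_at[OF assms(3)] cosparse_frequently[OF assms(4)], of 2] by simp
  finally have "2 * zorder K z = zorder f z + 2 * zorder g z + zorder h z"
    using zorder_power[OF mero_at[OF assms(8)] cosparse_frequently[OF Knz], of 2] by simp
  then have "zorder f z = 2 * (zorder K z - zorder g z) - zorder h z" by simp
  then show ?thesis using assms(7) by simp
qed

lemma deriv_cover_fun_nz: "eventually (\<lambda>z. deriv (cover_fun e e' b k) z \<noteq> 0) (cosparse UNIV)"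
  by (rule deriv_nz[OF cover_fun_mero cover_fun_pole_0])

lemma deriv_cover_fun_mero: "deriv (cover_fun e e' b k) meromorphic_on UNIV"
  by (intro meromorphic_intros cover_fun_mero)

lemma sols_on_curve:
  assumes "(e, e', b, k) \<in> sols"
  shows "e' ^ 2 = 4 * e ^ 3 - g2 * e - g3"
  using assms unfolding sols_def
proof
  assume "(e, e', b, k) \<in> sols_trivial g2 g3"
  then show ?thesis by (simp add: sols_trivial_def)
next
  assume "(e, e', b, k) \<in> (\<Union>(r, s, t)\<in>root_triples. sols_half r s t)"
  then obtain r s t where rst: "(r, s, t) \<in> root_triples" and "(e, e', b, k) \<in> sols_half r s t" by blast
  then have "e' ^ 2 = 4 * (e - r) * (e - s) * (e - t)" unfolding sols_half_def by blast
  then show ?thesis unfolding root_triples_facts(7)[OF rst] .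
qed

text \<open>The explicit square roots show that the derivative differs from a square only by a
  square and possibly by \<open>wp - r\<close>, whose orders are even.\<close>

lemma even_of_sols:
  assumes "(e, e', b, k) \<in> sols"
  shows "even (zorder (deriv (cover_fun e e' b k)) z)"
  using assms unfolding sols_def
proof
  assume "(e, e', b, k) \<in> sols_trivial g2 g3"
  then have s: "k = e" "e = b\<^sup>2" "2 * e\<^sup>2 + b * e' + g2 / 12 = 0" "e' ^ 2 = 4 * e ^ 3 - g2 * e - g3"
    by (auto simp: sols_trivial_def)
  let ?K = "\<lambda>z. (wp z - e)\<^sup>2 + b / 2 * (wp' z + e')"
  have K: "?K meromorphic_on UNIV" by (intro meromorphic_intros wp_mero)
  have "eventually (\<lambda>z. deriv (cover_fun e e' b k) z * (wp z - e) ^ 2 * 1 = ?K z ^ 2) (cosparse UNIV)"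
    using cover_fun_deriv_cosparse[of e e' b k] Lambda_cosparse
  proof eventually_elim
    case (elim z)
    show ?case unfolding elim(1) mult_1_right
      by (rule trivial_case_square[OF s wp_ode'[OF elim(2)]])
  qed
  note sq = this
  have z1: "zorder (\<lambda>_::complex. 1::complex) z = 0"
    by (rule zorder_zero_eqI[where S = UNIV]) auto
  have m: "(\<lambda>z. wp z - e) meromorphic_on UNIV" "(\<lambda>_. 1) meromorphic_on UNIV"
    by (intro meromorphic_intros wp_mero)+
  show ?thesis
    by (rule zorder_even_of_square[OF deriv_cover_fun_mero deriv_cover_fun_nz m(1) wp_minus_nz m(2) _ _ K sq])
       (simp_all add: z1)
next
  assume "(e, e', b, k) \<in> (\<Union>(r, s, t)\<in>root_triples. sols_half r s t)"
  then obtain r s t where rst: "(r, s, t) \<in> root_triples" and "(e, e', b, k) \<in> sols_half r s t" by blast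
  then have s: "k = (e - r) / 9" "e' = - 2 * (e - r) * b" "16 * (e - r)\<^sup>2 + 36 * r * (e - r) + 9 * (r - s) * (r - t) = 0"
    "e' ^ 2 = 4 * (e - r) * (e - s) * (e - t)"
    by (auto simp: sols_half_def)
  note f = root_triples_facts[OF rst]
  let ?K = "\<lambda>z. (wp z - e) * (wp' z / 2 + b * (wp z - r) + e' / 6) + (e - r) / 6 * (wp' z + e')"
  have K: "?K meromorphic_on UNIV" by (intro meromorphic_intros wp_mero)
  have "eventually (\<lambda>z. deriv (cover_fun e e' b k) z * (wp z - e) ^ 2 * (wp z - r) = ?K z ^ 2) (cosparse UNIV)"
    using cover_fun_deriv_cosparse[of e e' b k] Lambda_cosparse
  proof eventually_elim
    case (elim z)
    show ?case unfolding elim(1)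
      by (rule half_period_case_square[OF s f(5,6,1-3) wp_ode'[OF elim(2)]])
  qed
  moreover have "(\<lambda>z. wp z - c) meromorphic_on UNIV" for c
    by (intro meromorphic_intros wp_mero)
  ultimately show ?thesis
    by (intro zorder_even_of_square[OF deriv_cover_fun_mero deriv_cover_fun_nz _ wp_minus_nz[of e] _ wp_minus_nz[of r]
          zorder_wp_root_even[OF rst] K])
qed

text \<open>The leading term is the fourth power of \<open>wp\<close>. So a square root has pole
  order 4 at 0, and order 5 after multiplication by \<open>wp - r\<close> under the root.\<close>

lemma cover_num_lim:
  "((\<lambda>z. z ^ 8 * cover_num g2 g3 e e' b k (wp z) (wp' z)) \<longlongrightarrow> 1) (at 0)"
proof -
  have "((\<lambda>z. ((z ^ 2 * wp z)\<^sup>2 - g2 / 12 * z ^ 4) * (z ^ 2 * wp z - e * z ^ 2)\<^sup>2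
     - k / 2 * (2 * (z ^ 2 * wp z) ^ 3 * z ^ 2 - 6 * e * z ^ 4 * (z ^ 2 * wp z)\<^sup>2 + g2 / 2 * z ^ 6 * (z ^ 2 * wp z)
         + (g2 * e / 2 + g3) * z ^ 8)
     + (z ^ 3 * wp' z) * (b * z * (z ^ 2 * wp z - e * z ^ 2)\<^sup>2 + k * e' / 2 * z ^ 5)) \<longlongrightarrow>
     (1\<^sup>2 - g2 / 12 * 0 ^ 4) * (1 - e * 0 ^ 2)\<^sup>2
     - k / 2 * (2 * 1 ^ 3 * 0 ^ 2 - 6 * e * 0 ^ 4 * 1\<^sup>2 + g2 / 2 * 0 ^ 6 * 1 + (g2 * e / 2 + g3) * 0 ^ 8)
     + (- 2) * (b * 0 * (1 - e * 0 ^ 2)\<^sup>2 + k * e' / 2 * 0 ^ 5)) (at 0)"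
    by (intro tendsto_intros lim_wp lim_wp')
  moreover have "((z ^ 2 * wp z)\<^sup>2 - g2 / 12 * z ^ 4) * (z ^ 2 * wp z - e * z ^ 2)\<^sup>2
     - k / 2 * (2 * (z ^ 2 * wp z) ^ 3 * z ^ 2 - 6 * e * z ^ 4 * (z ^ 2 * wp z)\<^sup>2 + g2 / 2 * z ^ 6 * (z ^ 2 * wp z)
         + (g2 * e / 2 + g3) * z ^ 8)
     + (z ^ 3 * wp' z) * (b * z * (z ^ 2 * wp z - e * z ^ 2)\<^sup>2 + k * e' / 2 * z ^ 5)
     = z ^ 8 * cover_num g2 g3 e e' b k (wp z) (wp' z)" for z
  proof -
    have A: "((z ^ 2 * x)\<^sup>2 - c * z ^ 4) * (z ^ 2 * x - e * z ^ 2)\<^sup>2 = z ^ 8 * ((x\<^sup>2 - c) * (x - e)\<^sup>2)" for x c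
      by algebra
    have B: "2 * (z ^ 2 * x) ^ 3 * z ^ 2 - 6 * e * z ^ 4 * (z ^ 2 * x)\<^sup>2 + c * z ^ 6 * (z ^ 2 * x) + (d + d') * z ^ 8
        = z ^ 8 * (2 * x ^ 3 - 6 * e * x\<^sup>2 + c * x + d + d')" for x c d d'
      by algebra
    have C: "(z ^ 3 * y) * (b * z * (z ^ 2 * x - e * z ^ 2)\<^sup>2 + c * z ^ 5) = z ^ 8 * (y * (b * (x - e)\<^sup>2 + c))" for x y c
      by algebra
    show ?thesis unfolding A B C cover_num_def by (simp only: right_diff_distrib distrib_left mult.left_commute[of "k / 2" "z ^ 8"])
  qed
  ultimately show ?thesis by simp
qed

lemma cover_num_holo: "(\<lambda>z. cover_num g2 g3 e e' b k (wp z) (wp' z)) holomorphic_on (- \<Lambda>)"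
  unfolding cover_num_def by (intro holomorphic_intros wp_holo wp'_holo) auto

lemma cover_num_reg: "reg (\<lambda>z. cover_num g2 g3 e e' b k (wp z) (wp' z))"
  by (rule reg_holo[OF cover_num_holo])

text \<open>This point is the image of \<open>- a\<close>, where the square of \<open>wp - e\<close>
  annihilates the derivative. It provides an additional linear condition on the square root.\<close>

lemma cover_num_reflected:
  assumes "e' ^ 2 = 4 * e ^ 3 - g2 * e - g3"
  shows "cover_num g2 g3 e e' b k e (- e') = 0"
proof -
  have X: "2 * e ^ 3 - 6 * e * e\<^sup>2 + g2 / 2 * e + g2 * e / 2 + g3 = - (e' ^ 2)"
    unfolding assms by (simp add: power2_eq_square power3_eq_cube)
  show ?thesis unfolding cover_num_def X by (simp add: power2_eq_square)
qed

text \<open>Because \<open>wp\<close> and \<open>wp'\<close> parametrize the curve, an identity of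
  functions of \<open>z\<close> becomes one at every point of the curve, which is what coefficient
  comparison needs.\<close>

lemma curve_identityI:
  assumes "(\<lambda>z. P (wp z) (wp' z)) holomorphic_on (- \<Lambda>)" "(\<lambda>z. R (wp z) (wp' z)) holomorphic_on (- \<Lambda>)"
    and "eventually (\<lambda>z. P (wp z) (wp' z) = R (wp z) (wp' z)) (cosparse UNIV)"
    and "y ^ 2 = 4 * x ^ 3 - g2 * x - g3"
  shows "P x y = R x y"
proof -
  obtain z where z: "z \<notin> \<Lambda>" "wp z = x" "wp' z = y"
    using curve_param[of y x] assms(4) cubic_g by metis
  have "P (wp z) (wp' z) = R (wp z) (wp' z)"
    by (rule holo_off_Lambda_eqI[OF assms(1,2,3) z(1)])
  then show ?thesis by (simp only: z)
qed

text \<open>\<open>K\<close> has a pole of order 4 at 0 and none off the lattice, so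
  \<open>ell_span4\<close> turns it into a polynomial expression in \<open>wp\<close> and
  \<open>wp'\<close> to which \<open>square_case_trivial\<close> applies.\<close>

lemma sols_of_square_trivial:
  assumes a: "a \<notin> \<Lambda>" and k: "k \<noteq> 0"
    and K: "ell K" "eventually (\<lambda>z. K z ^ 2 = cover_num g2 g3 (wp a) (wp' a) b k (wp z) (wp' z)) (cosparse UNIV)"
  shows "(wp a, wp' a, b, k) \<in> sols_trivial g2 g3"
proof -
  let ?e = "wp a" and ?e' = "wp' a"
  have Km: "K meromorphic_on UNIV" by (rule ell_mero[OF K(1)])
  have "reg K" by (rule reg_sqrt[OF Km cover_num_reg K(2)])
  have "((\<lambda>z. (z ^ 4 * K z) ^ 2) \<longlongrightarrow> 1) (at 0)"
    by (rule Lim_transform_eventually[OF cover_num_lim[of ?e ?e' b k]])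
       (use cosparse_at[OF K(2), of 0] in eventually_elim, simp add: power_mult_distrib flip: power_mult)
  moreover have "(\<lambda>z. z ^ 4 * K z) meromorphic_on UNIV" by (intro meromorphic_intros Km)
  ultimately obtain d where d: "((\<lambda>z. z ^ 4 * K z) \<longlongrightarrow> d) (at 0)" "d ^ 2 = 1"
    using mero_lim_square[of "\<lambda>z. z ^ 4 * K z" 1 0] by blast
  obtain c0 c1 c2 where c: "eventually (\<lambda>z. K z = c0 + c1 * wp z + c2 * wp' z + d * wp z ^ 2) (cosparse UNIV)"
    using ell_span4[OF K(1) \<open>reg K\<close> d(1)] by blast
  \<comment> \<open>The leading coefficient \<open>d\<close> is 1 or -1; multiplying by it makes the
    root monic without changing its square.\<close>
  define d0 d1 d2 where "d0 = d * c0" and "d1 = d * c1" and "d2 = d * c2"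
  have ev: "eventually (\<lambda>z. (wp z ^ 2 + d1 * wp z + d2 * wp' z + d0)\<^sup>2 =
      cover_num g2 g3 ?e ?e' b k (wp z) (wp' z)) (cosparse UNIV)"
    using c K(2)
  proof eventually_elim
    case (elim z)
    have "wp z ^ 2 + d1 * wp z + d2 * wp' z + d0 = d * K z"
      unfolding elim(1) d0_def d1_def d2_def using d(2) by algebra
    then show ?case using elim(2) d(2) by (simp add: power_mult_distrib)
  qed
  have sq: "(x ^ 2 + d1 * x + d2 * y + d0)\<^sup>2 = cover_num g2 g3 ?e ?e' b k x y"
    if "y ^ 2 = 4 * x ^ 3 - g2 * x - g3" for x y
    by (rule curve_identityI[where P = "\<lambda>x y. (x ^ 2 + d1 * x + d2 * y + d0)\<^sup>2"
          and R = "\<lambda>x y. cover_num g2 g3 ?e ?e' b k x y", OF _ cover_num_holo ev that])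
       (intro holomorphic_intros wp_holo wp'_holo)
  have curve: "?e' ^ 2 = 4 * ?e ^ 3 - g2 * ?e - g3" by (rule wp_ode'[OF a])
  have "(?e ^ 2 + d1 * ?e + d2 * (- ?e') + d0)\<^sup>2 = cover_num g2 g3 ?e ?e' b k ?e (- ?e')"
    by (rule sq) (simp add: curve)
  also have "\<dots> = 0" by (rule cover_num_reflected[OF curve])
  finally have K0: "?e\<^sup>2 + d1 * ?e - d2 * ?e' + d0 = 0" by simp
  \<comment> \<open>\<open>12 * x ^ 2 - g2\<close> is the derivative of the cubic, nonzero at its
    simple roots.\<close>
  have nd: "12 * ?e\<^sup>2 \<noteq> g2" if "?e' = 0"
  proof
    assume g: "12 * ?e\<^sup>2 = g2"
    have "(?e - e1) * (?e - e2) * (?e - e3) = 0" using wp_ode[OF a] that by simp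
    moreover have "12 * x\<^sup>2 - g2 = 4 * ((x - e1) * (x - e2) + (x - e1) * (x - e3) + (x - e2) * (x - e3))" for x
      unfolding g2_def using e_sum by algebra
    then have "(?e - e1) * (?e - e2) + (?e - e1) * (?e - e3) + (?e - e2) * (?e - e3) = 0"
      using g by (metis mult_eq_0_iff right_minus_eq zero_neq_numeral)
    ultimately show False using e_distinct by auto
  qed
  show ?thesis
    unfolding sols_trivial_def
    using square_case_trivial[OF sq K0 curve nd k] curve by simp
qed

lemma sols_of_square_half:
  assumes a: "a \<notin> \<Lambda>" and k: "k \<noteq> 0" and rst: "(r, s, t) \<in> root_triples"
    and K: "ell K" "eventually (\<lambda>z. K z ^ 2 = cover_num g2 g3 (wp a) (wp' a) b k (wp z) (wp' z) * (wp z - r)) (cosparse UNIV)"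
  shows "(wp a, wp' a, b, k) \<in> sols_half r s t"
proof -
  let ?e = "wp a" and ?e' = "wp' a"
  note f = root_triples_facts[OF rst]
  have Km: "K meromorphic_on UNIV" by (rule ell_mero[OF K(1)])
  have "reg K" by (rule reg_sqrt[OF Km _ K(2)]) (intro reg_mult cover_num_reg reg_diff reg_wp reg_const)
  have "((\<lambda>z. (z ^ 8 * cover_num g2 g3 ?e ?e' b k (wp z) (wp' z)) * (z ^ 2 * (wp z - r))) \<longlongrightarrow> 1 * 1) (at 0)"
    by (intro tendsto_mult cover_num_lim lim_wp_minus)
  then have "((\<lambda>z. (z ^ 5 * K z) ^ 2) \<longlongrightarrow> 1 * 1) (at 0)"
    by (rule Lim_transform_eventually)
       (use cosparse_at[OF K(2), of 0] in eventually_elim, simp add: power_mult_distrib mult_ac flip: power_mult power_add)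
  moreover have "(\<lambda>z. z ^ 5 * K z) meromorphic_on UNIV" by (intro meromorphic_intros Km)
  ultimately obtain d where d: "((\<lambda>z. z ^ 5 * K z) \<longlongrightarrow> d) (at 0)" "d ^ 2 = 1 * 1"
    using mero_lim_square[of "\<lambda>z. z ^ 5 * K z" "1 * 1" 0] by blast
  obtain c0 c1 c2 c3 where c: "eventually (\<lambda>z. K z = c0 + c1 * wp z + c2 * wp' z + c3 * wp z ^ 2 - d / 2 * (wp z * wp' z)) (cosparse UNIV)"
    using ell_span5[OF K(1) \<open>reg K\<close> d(1)] by blast
  \<comment> \<open>Here the sign is \<open>- d\<close>, since the term \<open>wp * wp'\<close> of
    \<open>K\<close> has coefficient \<open>- d / 2\<close>.\<close>
  define d0 d1 d2 d3 where "d0 = - d * c0" and "d1 = - d * c1" and "d2 = - d * c2" and "d3 = - d * c3"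
  have ev: "eventually (\<lambda>z. (wp z * wp' z / 2 + d1 * wp z + d2 * wp' z + d3 * wp z ^ 2 + d0)\<^sup>2 =
      cover_num g2 g3 ?e ?e' b k (wp z) (wp' z) * (wp z - r)) (cosparse UNIV)"
    using c K(2)
  proof eventually_elim
    case (elim z)
    have "d * (d / 2 * (wp z * wp' z)) = wp z * wp' z / 2" using d(2) by (simp add: power2_eq_square mult.assoc[symmetric])
    then have "wp z * wp' z / 2 + d1 * wp z + d2 * wp' z + d3 * wp z ^ 2 + d0 = - d * K z"
      unfolding elim(1) d0_def d1_def d2_def d3_def by (simp add: algebra_simps)
    then show ?case using elim(2) d(2) by (simp add: power_mult_distrib)
  qed
  have sq: "(x * y / 2 + d1 * x + d2 * y + d3 * x ^ 2 + d0)\<^sup>2 = cover_num g2 g3 ?e ?e' b k x y * (x - r)"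
    if "y ^ 2 = 4 * x ^ 3 - g2 * x - g3" for x y
    by (rule curve_identityI[where P = "\<lambda>x y. (x * y / 2 + d1 * x + d2 * y + d3 * x ^ 2 + d0)\<^sup>2"
          and R = "\<lambda>x y. cover_num g2 g3 ?e ?e' b k x y * (x - r)", OF _ _ ev that])
       ((intro holomorphic_intros wp_holo wp'_holo, simp; fail) | (intro holomorphic_intros cover_num_holo wp_holo))+
  have curve: "?e' ^ 2 = 4 * ?e ^ 3 - g2 * ?e - g3" by (rule wp_ode'[OF a])
  have "(?e * (- ?e') / 2 + d1 * ?e + d2 * (- ?e') + d3 * ?e ^ 2 + d0)\<^sup>2 = cover_num g2 g3 ?e ?e' b k ?e (- ?e') * (?e - r)"
    by (rule sq) (simp add: curve)
  also have "cover_num g2 g3 ?e ?e' b k ?e (- ?e') = 0"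
    by (rule cover_num_reflected[OF curve])
  finally have K0: "- ?e * ?e' / 2 + d1 * ?e - d2 * ?e' + d3 * ?e\<^sup>2 + d0 = 0" by simp
  \<comment> \<open>Evaluation at the half-period point \<open>(r, 0)\<close>, where the right side
    vanishes.\<close>
  have "(r * 0 / 2 + d1 * r + d2 * 0 + d3 * r ^ 2 + d0)\<^sup>2 = cover_num g2 g3 ?e ?e' b k r 0 * (r - r)"
    by (rule sq) (simp add: f(7))
  then have Kr: "d1 * r + d3 * r\<^sup>2 + d0 = 0" by simp
  have curve': "?e' ^ 2 = 4 * (?e - r) * (?e - s) * (?e - t)" unfolding curve f(7) ..
  show ?thesis
    unfolding sols_half_def
    using square_case_half_period[OF sq K0 Kr curve' f(5,6,1-4) k] curve' by simp
qed

theorem sols_of_even: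
  assumes a: "a \<notin> \<Lambda>" and k: "k \<noteq> 0" and ev: "\<And>z. even (zorder (deriv (cover_fun (wp a) (wp' a) b k)) z)"
  shows "(wp a, wp' a, b, k) \<in> sols"
proof -
  let ?F = "cover_fun (wp a) (wp' a) b k"
  have D: "ell (deriv ?F)" by (intro ell_deriv ell_cover_fun)
  obtain h s t where h: "h meromorphic_on UNIV" "eventually (\<lambda>z. h z ^ 2 = deriv ?F z) (cosparse UNIV)"
    and st: "s \<in> {1, -1}" "t \<in> {1, -1}" "\<And>z. h (z + 1) = s * h z" "\<And>z. h (z + \<tau>) = t * h z"
    by (rule ell_even_divisor_sqrt[OF D deriv_cover_fun_nz ev]; blast)
  show ?thesis
  proof (cases "(s, t) = (1, 1)")
    case True
    then have "ell h" using st h by (simp add: ell_iff)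
    \<comment> \<open>The factor \<open>wp - wp a\<close> clears the pole of \<open>h\<close> at
      \<open>a\<close> and turns the derivative into \<open>cover_num\<close>.\<close>
    then have "ell (\<lambda>z. h z * (wp z - wp a))" by (intro ell_intros ell_wp)
    moreover have "eventually (\<lambda>z. (h z * (wp z - wp a)) ^ 2 = cover_num g2 g3 (wp a) (wp' a) b k (wp z) (wp' z)) (cosparse UNIV)"
      using h(2) cover_fun_deriv_cosparse[of "wp a" "wp' a" b k] by eventually_elim (simp add: power_mult_distrib)
    ultimately have "(wp a, wp' a, b, k) \<in> sols_trivial g2 g3" by (rule sols_of_square_trivial[OF a k])
    then show ?thesis by (simp add: sols_def)
  next
    case False
    obtain S r where S: "r \<in> {e1, e2, e3}" "S meromorphic_on UNIV"
      "eventually (\<lambda>z. S z ^ 2 = wp z - r) (cosparse UNIV)"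
      "\<And>z. S (z + 1) = s * S z" "\<And>z. S (z + \<tau>) = t * S z"
      by (rule sign_cover[OF st(1,2) False]; blast)
    obtain r' t' where rst: "(r, r', t') \<in> root_triples" using root_triples_ex[OF S(1)] by blast
    have "ell (\<lambda>z. h z * S z)" by (rule sign_ell[OF h(1) S(2) st S(4,5)])
    then have "ell (\<lambda>z. h z * S z * (wp z - wp a))" by (intro ell_mult[OF _ ell_diff] ell_wp ell_const)
    moreover have "eventually (\<lambda>z. (h z * S z * (wp z - wp a)) ^ 2 =
        cover_num g2 g3 (wp a) (wp' a) b k (wp z) (wp' z) * (wp z - r)) (cosparse UNIV)"
      using h(2) S(3) cover_fun_deriv_cosparse[of "wp a" "wp' a" b k]
      by eventually_elim (simp add: power_mult_distrib)
    ultimately have "(wp a, wp' a, b, k) \<in> sols_half r r' t'" by (rule sols_of_square_half[OF a k rst])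
    then show ?thesis using rst by (auto simp: sols_def)
  qed
qed

end

subsection \<open>Good covers\<close>

context half_plane
begin

lemma ram_index_cover_fun_0: "ram_index (cover_fun e e' b k) 0 = 3"
  by (simp add: ram_index_pole[OF cover_fun_pole_0] zorder_cover_fun_0)

lemma ell_minus_const: "ell f \<Longrightarrow> ell (\<lambda>z. f z - c)"
  by (intro ell_intros)

lemma ell_degree_minus_const:
  assumes "f meromorphic_on UNIV"
  shows "ell_degree \<tau> (\<lambda>z. f z - c) = ell_degree \<tau> f"
  unfolding ell_degree_def is_pole_minus_const_iff
  by (intro sum.cong refl) (auto simp: zorder_minus_const_pole[OF assms])

text \<open>A zero of the derivative of order 4 or more would be a ramification index above the
  degree 4. So all zeros are double, and the derivative, having degree 6, has exactly three of
  them.\<close>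

theorem good_cover_of_even:
  assumes a: "a \<notin> \<Lambda>" and k: "k \<noteq> 0"
    and ev: "\<And>z. even (zorder (deriv (cover_fun (wp a) (wp' a) b k)) z)"
  shows "good_cover \<tau> (cover_fun (wp a) (wp' a) b k)"
proof -
  let ?F = "cover_fun (wp a) (wp' a) b k"
  let ?D = "deriv ?F"
  define Z where "Z = {p \<in> fund_par \<tau>. zorder ?D p > 0}"
  have D: "ell ?D" by (intro ell_deriv ell_cover_fun)
  have np: "\<not> is_pole ?F p" if "p \<in> Z" for p
    using zorder_deriv_pole[OF cover_fun_mero, of _ _ _ _ p] that
      mero_pole_iff[OF cover_fun_mero cover_fun_nz, of _ _ _ _ p] by (auto simp: Z_def)
  have two: "zorder ?D p = 2" if p: "p \<in> Z" for p
  proof -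
    let ?G = "\<lambda>w. ?F w - remove_sings ?F p"
    have G: "zorder ?G p > 0" by (rule zorder_value[OF cover_fun_mero cover_fun_nonconst np[OF p]])
    have "(\<Sum>p\<in>{p}. zorder ?G p) \<le> int (ell_degree \<tau> ?G)"
      using p G by (intro ell_zeros_le_degree ell_minus_const ell_cover_fun nonconst_minus_nz cover_fun_nonconst)
        (auto simp: Z_def)
    then have "zorder ?G p \<le> 4"
      by (simp add: ell_degree_minus_const[OF cover_fun_mero] ell_degree_cover_fun[OF a k])
    then have "zorder ?D p \<le> 3"
      using zorder_deriv_value[OF cover_fun_mero cover_fun_nonconst np[OF p]] by simp
    moreover have "zorder ?D p > 0" using p by (simp add: Z_def)
    moreover have "even (zorder ?D p)" by (rule ev)
    ultimately show ?thesis by presburger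
  qed
  have "int (ell_degree \<tau> ?D) = (\<Sum>p\<in>Z. zorder ?D p)"
    unfolding Z_def by (rule ell_degree_eq_zeros(1)[OF D deriv_cover_fun_nz])
  also have "\<dots> = (\<Sum>p\<in>Z. 2)" by (intro sum.cong refl two)
  finally have "card Z = 3" by (simp add: ell_degree_deriv_cover_fun[OF a k])
  then obtain p1 p2 p3 where p: "Z = {p1, p2, p3}" "p1 \<noteq> p2" "p2 \<noteq> p3" "p1 \<noteq> p3"
    by (auto simp: card_3_iff)
  have fund: "q \<in> fund_par \<tau>" if "q \<in> Z" for q using that by (simp add: Z_def)
  have nL: "q \<notin> \<Lambda>" if "q \<in> Z" for q
  proof
    assume "q \<in> \<Lambda>"
    then have "q = 0" using fund_par_unique[OF fund[OF that] fund_par_0] by simp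
    then show False using np[OF that] cover_fun_pole_0 by simp
  qed
  have dL: "q - q' \<notin> \<Lambda>" if "q \<in> Z" "q' \<in> Z" "q \<noteq> q'" for q q'
    using fund_par_unique[OF fund[OF that(1)] fund[OF that(2)]] that(3) by blast
  have ram: "ram_index ?F q \<ge> 3" if "q \<in> Z" for q
    using ram_index_deriv[OF cover_fun_mero cover_fun_nonconst np[OF that]] two[OF that] by simp
  have "p1 \<in> Z" "p2 \<in> Z" "p3 \<in> Z" using p(1) by auto
  then show ?thesis
    unfolding good_cover_def using p(2-) nL dL ram
    by (intro conjI exI[of _ p1] exI[of _ p2] exI[of _ p3])
       (simp_all add: ell_cover_fun ell_degree_cover_fun[OF a k] ram_index_cover_fun_0)
qed

lemma remove_sings_shift:
  assumes "ell f" "l \<in> \<Lambda>"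
  shows "remove_sings f (z + l) = remove_sings f z"
proof -
  have "remove_sings f (z + l) = remove_sings (\<lambda>w. f (z + l + w)) 0" by (rule remove_sings_shift_0)
  also have "\<dots> = remove_sings (\<lambda>w. f (z + w)) 0"
    by (rule remove_sings_cong[OF _ refl])
       (use cosparse_at[OF cosparse_shift[OF ell_periodic[OF assms], of z], of 0] in eventually_elim, simp add: add_ac)
  also have "\<dots> = remove_sings f z" by (rule remove_sings_shift_0[symmetric])
  finally show ?thesis .
qed

lemma ram_index_shift:
  assumes "ell f" "l \<in> \<Lambda>"
  shows "ram_index f (z + l) = ram_index f z"
  unfolding ram_index_def ell_pole_shift[OF assms] ell_zorder_shift[OF assms] remove_sings_shift[OF assms]
    ell_zorder_shift[OF ell_minus_const[OF assms(1)] assms(2)] ..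

lemma good_coverE:
  assumes "good_cover \<tau> f"
  obtains q1 q2 q3 where "ell f" "ell_degree \<tau> f = 4" "ram_index f 0 \<ge> 3" "nonconst f"
    "q1 \<in> fund_par \<tau>" "q2 \<in> fund_par \<tau>" "q3 \<in> fund_par \<tau>" "q1 \<noteq> 0" "q2 \<noteq> 0" "q3 \<noteq> 0"
    "q1 \<noteq> q2" "q1 \<noteq> q3" "q2 \<noteq> q3" "ram_index f q1 \<ge> 3" "ram_index f q2 \<ge> 3" "ram_index f q3 \<ge> 3"
proof -
  from assms obtain p1 p2 p3 where f: "ell f" "ell_degree \<tau> f = 4" "ram_index f 0 \<ge> 3"
    and p: "p1 \<notin> \<Lambda>" "p2 \<notin> \<Lambda>" "p3 \<notin> \<Lambda>" "p1 - p2 \<notin> \<Lambda>" "p1 - p3 \<notin> \<Lambda>" "p2 - p3 \<notin> \<Lambda>"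
      "ram_index f p1 \<ge> 3" "ram_index f p2 \<ge> 3" "ram_index f p3 \<ge> 3"
    unfolding good_cover_def by blast
  \<comment> \<open>A degree different from 0 needs a pole, and a function with a pole is not
    constant.\<close>
  have "{z \<in> fund_par \<tau>. is_pole f z} \<noteq> {}"
  proof
    assume "{z \<in> fund_par \<tau>. is_pole f z} = {}"
    then have "ell_degree \<tau> f = 0" unfolding ell_degree_def by (simp only: sum.empty)
    then show False using f(2) by simp
  qed
  then have nc: "nonconst f" using nonconst_pole[OF ell_mero[OF f(1)]] by blast
  have rep: "\<exists>q. q \<in> fund_par \<tau> \<and> p - q \<in> \<Lambda> \<and> ram_index f q = ram_index f p" for p
  proof -
    obtain q where q: "q \<in> fund_par \<tau>" "p - q \<in> \<Lambda>" by (rule fund_par_exists)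
    then show ?thesis using ram_index_shift[OF f(1) q(2), of q] by auto
  qed
  obtain q1 q2 q3 where q: "q1 \<in> fund_par \<tau>" "q2 \<in> fund_par \<tau>" "q3 \<in> fund_par \<tau>"
    "p1 - q1 \<in> \<Lambda>" "p2 - q2 \<in> \<Lambda>" "p3 - q3 \<in> \<Lambda>"
    "ram_index f q1 = ram_index f p1" "ram_index f q2 = ram_index f p2" "ram_index f q3 = ram_index f p3"
    using rep[of p1] rep[of p2] rep[of p3] by blast
  have d: "q \<noteq> q'" if "p - p' \<notin> \<Lambda>" "p - q \<in> \<Lambda>" "p' - q' \<in> \<Lambda>" for p p' q q'
    using lattice_diff[OF that(2,3)] that(1) by auto
  have "q1 \<noteq> 0" "q2 \<noteq> 0" "q3 \<noteq> 0" using p(1-3) q(4-6) by auto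
  then show ?thesis
    using that[OF f nc q(1-3)] d[OF p(4) q(4,5)] d[OF p(5) q(4,6)] d[OF p(6) q(5,6)] p(7-9) q(7-9) by simp
qed

lemma lim_of_zorder:
  assumes f: "f meromorphic_on UNIV" "eventually (\<lambda>w. f w \<noteq> 0) (cosparse UNIV)" "zorder f 0 = - int n"
  obtains L where "((\<lambda>z. z ^ n * f z) \<longlongrightarrow> L) (at 0)" "L \<noteq> 0"
proof -
  let ?g = "\<lambda>z. z ^ n * f z"
  have m: "?g meromorphic_on UNIV" by (intro meromorphic_intros f)
  have pnz: "eventually (\<lambda>w::complex. w \<noteq> 0) (cosparse UNIV)"
    using Lambda_cosparse by eventually_elim auto
  have nz: "eventually (\<lambda>w. ?g w \<noteq> 0) (cosparse UNIV)"
    using f(2) pnz by eventually_elim simp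
  have "frequently (\<lambda>w::complex. w ^ n \<noteq> 0) (at 0)"
    by (rule cosparse_frequently) (use pnz in eventually_elim, simp)
  then have "zorder ?g 0 = zorder (\<lambda>w. w ^ n) 0 + zorder f 0"
    by (rule zorder_mult[OF _ _ mero_at[OF f(1)] cosparse_frequently[OF f(2)], rotated]) (intro meromorphic_intros)
  then have z: "zorder ?g 0 = 0" using f(3) by (simp add: zorder_power_self)
  then have "\<not> is_pole ?g 0" using mero_pole_iff[OF m nz] by simp
  then obtain L where L: "(?g \<longlongrightarrow> L) (at 0)" using mero_not_pole_lim[OF m] by blast
  have "L \<noteq> 0"
  proof
    assume "L = 0"
    then have "isolated_zero ?g 0" using L cosparse_at[OF nz] by (simp add: isolated_zero_def)
    then have "zorder ?g 0 > 0" by (rule zorder_isolated_zero_pos'[OF _ mero_iso[OF m]])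
    then show False using z by simp
  qed
  then show ?thesis using that L by blast
qed

text \<open>Counting zeros and poles of the derivative: three double zeros force
  the polar divisor \<open>3 \<cdot> 0 + a\<close>.\<close>

lemma good_cover_divisors:
  assumes "good_cover \<tau> g" "is_pole g 0"
  obtains a where "a \<in> fund_par \<tau>" "a \<notin> \<Lambda>" "zorder g 0 = - 3" "zorder g a = - 1"
    "{p \<in> fund_par \<tau>. is_pole g p} = {0, a}" "\<And>z. even (zorder (deriv g) z)"
proof -
  obtain q1 q2 q3 where g: "ell g" "ell_degree \<tau> g = 4" "ram_index g 0 \<ge> 3" and nc: "nonconst g"
    and q: "q1 \<in> fund_par \<tau>" "q2 \<in> fund_par \<tau>" "q3 \<in> fund_par \<tau>" "q1 \<noteq> 0" "q2 \<noteq> 0" "q3 \<noteq> 0"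
    "q1 \<noteq> q2" "q1 \<noteq> q3" "q2 \<noteq> q3" "ram_index g q1 \<ge> 3" "ram_index g q2 \<ge> 3" "ram_index g q3 \<ge> 3"
    by (rule good_coverE[OF assms(1)]; blast)
  note gm = ell_mero[OF g(1)]
  have nz: "eventually (\<lambda>z. g z \<noteq> 0) (cosparse UNIV)" using nc by (simp add: nonconst_def)
  note pole = mero_pole_iff[OF gm nz]
  have z0: "zorder g 0 \<le> - 3" using g(3) ram_index_pole[OF assms(2)] by simp
  let ?N = "{p \<in> fund_par \<tau>. zorder g p < 0}"
  have deg: "4 = (\<Sum>p\<in>?N. - zorder g p)" using ell_degree_eq_zeros(2)[OF g(1) nz] g(2) by simp
  have le4: "(\<Sum>p\<in>A. - zorder g p) \<le> 4" if "A \<subseteq> fund_par \<tau>" "\<And>p. p \<in> A \<Longrightarrow> zorder g p < 0" for A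
    using ell_poles_le_degree[OF g(1) nz that] g(2) by simp
  \<comment> \<open>Two poles of order at least 3 would exceed the degree 4.\<close>
  have npole: "\<not> is_pole g q" if "q \<in> fund_par \<tau>" "q \<noteq> 0" "ram_index g q \<ge> 3" for q
  proof
    assume p: "is_pole g q"
    then have zq: "zorder g q \<le> - 3" using ram_index_pole[OF p] that(3) by simp
    have "(\<Sum>p\<in>{0, q}. - zorder g p) \<le> 4"
      by (rule le4) (use that zq z0 in auto)
    then show False using that(2) zq z0 by simp
  qed
  have D: "ell (deriv g)" by (rule ell_deriv[OF g(1)])
  have Dnz: "eventually (\<lambda>z. deriv g z \<noteq> 0) (cosparse UNIV)" by (rule deriv_nz[OF gm assms(2)])
  have Dpole: "zorder (deriv g) p < 0 \<longleftrightarrow> zorder g p < 0" for p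
    unfolding pole[symmetric] mero_pole_iff[OF ell_mero[OF D] Dnz, symmetric]
    by (rule is_pole_deriv_iff[OF mero_at[OF gm]])
  have Dz: "zorder (deriv g) p = zorder g p - 1" if "zorder g p < 0" for p
    using zorder_deriv_pole[OF gm] that pole by blast
  have "int (ell_degree \<tau> (deriv g)) = (\<Sum>p\<in>?N. - zorder (deriv g) p)"
    using ell_degree_eq_zeros(2)[OF D Dnz] unfolding Dpole .
  also have "\<dots> = (\<Sum>p\<in>?N. - zorder g p + 1)" by (intro sum.cong) (auto simp: Dz)
  \<comment> \<open>Differentiation raises the order of each pole by one, so the number of distinct
    poles enters.\<close>
  also have "\<dots> = 4 + int (card ?N)" by (simp only: sum.distrib deg[symmetric]) simp
  finally have degD: "int (ell_degree \<tau> (deriv g)) = 4 + int (card ?N)" .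
  have rq: "zorder (deriv g) q \<ge> 2" if "q \<in> fund_par \<tau>" "q \<noteq> 0" "ram_index g q \<ge> 3" for q
    using ram_index_deriv[OF gm nc npole[OF that]] that(3) by simp
  note r = rq[OF q(1,4,10)] rq[OF q(2,5,11)] rq[OF q(3,6,12)]
  have leD: "(\<Sum>p\<in>A. zorder (deriv g) p) \<le> 4 + int (card ?N)"
    if "A \<subseteq> fund_par \<tau>" "\<And>p. p \<in> A \<Longrightarrow> zorder (deriv g) p > 0" for A
    using ell_zeros_le_degree[OF D Dnz that] degD by simp
  have "(\<Sum>p\<in>{q1, q2, q3}. zorder (deriv g) p) \<le> 4 + int (card ?N)"
    by (rule leD) (use q r in auto)
  then have S3: "zorder (deriv g) q1 + zorder (deriv g) q2 + zorder (deriv g) q3 \<le> 4 + int (card ?N)"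
    using q(7-9) by simp
  \<comment> \<open>Three zeros of order at least 2 require degree at least 6. As 0 takes at least 3
    of the 4 pole orders, exactly one simple pole remains.\<close>
  have "2 \<le> card ?N" using S3 r by linarith
  have fin: "finite ?N" by (rule finite_subset[OF _ ell_zero_set_finite[OF g(1) nz]]) auto
  have "0 \<in> ?N" using z0 by simp
  have "?N - {0} \<noteq> {}"
  proof
    assume "?N - {0} = {}"
    then have "card ?N \<le> card {0::complex}" by (intro card_mono) auto
    then show False using \<open>2 \<le> card ?N\<close> by simp
  qed
  then obtain a where a: "a \<in> fund_par \<tau>" "zorder g a < 0" "a \<noteq> 0" by blast
  have "(\<Sum>p\<in>{0, a}. - zorder g p) \<le> 4" by (rule le4) (use z0 a in auto)
  then have s: "- zorder g 0 - zorder g a \<le> 4" using a(3) by simp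
  have ord: "zorder g 0 = - 3" "zorder g a = - 1" using s z0 a(2) by linarith+
  have N: "?N = {0, a}"
  proof (rule ccontr)
    assume "?N \<noteq> {0, a}"
    then obtain p where p: "p \<in> fund_par \<tau>" "zorder g p < 0" "p \<noteq> 0" "p \<noteq> a"
      using a \<open>0 \<in> ?N\<close> by blast
    then have "(\<Sum>p\<in>{0, a, p}. - zorder g p) \<le> 4" using a \<open>0 \<in> ?N\<close> by (intro le4) auto
    then show False using p a(3) ord by simp
  qed
  have card2: "card ?N = 2" unfolding N using a(3) by simp
  have "{p \<in> fund_par \<tau>. is_pole g p} = {0, a}" using N pole by auto
  moreover have "a \<notin> \<Lambda>" using fund_par_unique[OF a(1) fund_par_0] a(3) by auto
  moreover have "even (zorder (deriv g) z)" for z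
  proof -
    obtain p where p: "p \<in> fund_par \<tau>" "z - p \<in> \<Lambda>" by (rule fund_par_exists)
    have "even (zorder (deriv g) p)"
    proof (cases "p \<in> {0, a}")
      case True
      then show ?thesis using Dz[of 0] Dz[of a] ord by auto
    next
      case False
      then have ge: "zorder (deriv g) p \<ge> 0" using N Dpole[of p] p by fastforce
      show ?thesis
      proof (cases "p \<in> {q1, q2, q3}")
        case True
        have "zorder (deriv g) q1 + zorder (deriv g) q2 + zorder (deriv g) q3 \<le> 6"
          using S3 card2 by simp
        then have "zorder (deriv g) p = 2" using r True by auto
        then show ?thesis by simp
      next
        case F: False
        have "zorder (deriv g) p = 0"
        proof (rule ccontr)
          assume "zorder (deriv g) p \<noteq> 0"
          then have pp: "zorder (deriv g) p > 0" using ge by simp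
          \<comment> \<open>The three ramification points already use up the degree 6, so a fourth
            zero is excluded.\<close>
          have "(\<Sum>p\<in>{p, q1, q2, q3}. zorder (deriv g) p) \<le> 4 + int (card ?N)"
            using q r p pp by (intro leD) auto
          then show False using F q r pp card2 by auto
        qed
        then show ?thesis by simp
      qed
    qed
    then show ?thesis using ell_zorder_shift[OF D p(2), of p] by simp
  qed
  ultimately show ?thesis using that a ord by blast
qed

text \<open>Multiplication by \<open>wp - wp a\<close> clears the pole at \<open>a\<close> and
  leaves pole order 5 at 0, so \<open>ell_span5\<close> applies. One of the five coefficients is
  fixed by a zero at \<open>- a\<close>; the others become \<open>b\<close>, \<open>k\<close> and
  the affine normalization.\<close>

lemma good_cover_normal_form:
  assumes "good_cover \<tau> g" "is_pole g 0"
  obtains e e' b k al de where "(e, e', b, k) \<in> sols" "al \<noteq> 0"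
    "eventually (\<lambda>z. g z = al * cover_fun e e' b k z + de) (cosparse UNIV)"
proof -
  obtain a where a: "a \<in> fund_par \<tau>" "a \<notin> \<Lambda>" and ord: "zorder g 0 = - 3" "zorder g a = - 1"
    and poles: "{p \<in> fund_par \<tau>. is_pole g p} = {0, a}" and ev: "\<And>z. even (zorder (deriv g) z)"
    by (rule good_cover_divisors[OF assms]; blast)
  have g: "ell g" using assms(1) by (simp add: good_cover_def)
  note gm = ell_mero[OF g]
  have nz: "eventually (\<lambda>z. g z \<noteq> 0) (cosparse UNIV)"
    using nonconst_pole[OF gm assms(2)] by (simp add: nonconst_def)
  let ?e = "wp a" and ?e' = "wp' a"
  let ?X = "\<lambda>z. wp z - ?e"
  define N where "N = (\<lambda>z. g z * ?X z)"
  have N: "ell N" unfolding N_def by (intro ell_mult g ell_diff ell_wp ell_const)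
  have Xm: "?X meromorphic_on UNIV" by (intro meromorphic_intros wp_mero)
  have zN: "zorder N z = zorder g z + zorder ?X z" for z
    unfolding N_def
    by (rule zorder_mult[OF mero_at[OF gm] cosparse_frequently[OF nz] mero_at[OF Xm] cosparse_frequently[OF wp_minus_nz]])
  have Nnz: "eventually (\<lambda>z. N z \<noteq> 0) (cosparse UNIV)"
    using nz wp_minus_nz[of ?e] by eventually_elim (simp add: N_def)
  have pole: "z \<in> \<Lambda> \<or> (z - a \<in> \<Lambda> \<and> zorder g z = - 1)" if "is_pole g z" for z
  proof -
    obtain p where p: "p \<in> fund_par \<tau>" "z - p \<in> \<Lambda>" by (rule fund_par_exists)
    have "is_pole g p" using ell_pole_shift[OF g p(2), of p] that by simp
    then have "p = 0 \<or> p = a" using poles p(1) by blast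
    then show ?thesis using p(2) ell_zorder_shift[OF g p(2), of p] ord by auto
  qed
  have "\<not> is_pole N z" if z: "z \<notin> \<Lambda>" for z
  proof (cases "is_pole g z")
    case True
    then have "z - a \<in> \<Lambda>" "zorder g z = - 1" using pole z by auto
    then have "zorder N z \<ge> 0" using zN[of z] zorder_wp_diff[OF a(2), of z] z by simp
    then show ?thesis using mero_pole_iff[OF ell_mero[OF N] Nnz] by simp
  next
    case False
    then have "zorder g z \<ge> 0" by (rule zorder_nonneg[OF gm nz])
    then have "zorder N z \<ge> 0" using zN[of z] zorder_wp_diff[OF a(2), of z] z by simp
    then show ?thesis using mero_pole_iff[OF ell_mero[OF N] Nnz] by simp
  qed
  then have regN: "reg N" unfolding reg_def using mero_not_pole_lim[OF ell_mero[OF N]] by blast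
  obtain L where L: "((\<lambda>z. z ^ 3 * g z) \<longlongrightarrow> L) (at 0)" "L \<noteq> 0"
    using lim_of_zorder[OF gm nz, of 3] ord by auto
  have "((\<lambda>z. (z ^ 3 * g z) * (z ^ 2 * ?X z)) \<longlongrightarrow> L * 1) (at 0)"
    by (intro tendsto_mult L lim_wp_minus)
  moreover have "(\<lambda>z. (z ^ 3 * g z) * (z ^ 2 * ?X z)) = (\<lambda>z. z ^ 5 * N z)"
    by (rule ext) (simp add: N_def mult_ac flip: power_add)
  ultimately have "((\<lambda>z. z ^ 5 * N z) \<longlongrightarrow> L) (at 0)" by simp
  then obtain c0 c1 c2 c3 where c: "eventually (\<lambda>z. N z = c0 + c1 * wp z + c2 * wp' z + c3 * wp z ^ 2
      - L / 2 * (wp z * wp' z)) (cosparse UNIV)"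
    using ell_span5[OF N regN] by blast
  let ?n = "\<lambda>z. c0 + c1 * wp z + c2 * wp' z + c3 * wp z ^ 2 - L / 2 * (wp z * wp' z)"
  \<comment> \<open>\<open>wp - wp a\<close> vanishes at \<open>- a\<close>, and \<open>g\<close>
    has no pole there unless \<open>- a\<close> is congruent to \<open>a\<close>; in that case a
    double zero meets a simple pole.\<close>
  have "?n (- a) = 0"
  proof (rule ccontr)
    assume n0: "?n (- a) \<noteq> 0"
    have ma: "- a \<notin> \<Lambda>" using a(2) by simp
    have "(?n \<longlongrightarrow> ?n (- a)) (at (- a))" by (intro tendsto_intros wp_lim wp'_lim ma)
    then have "zorder ?n (- a) = 0" using n0 by (intro zorder_eq_0_of_lim) (intro meromorphic_intros wp_mero)
    moreover have "zorder N (- a) = zorder ?n (- a)"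
      by (rule zorder_cong[OF cosparse_at[OF c] refl])
    ultimately have "zorder g (- a) + zorder ?X (- a) = 0" using zN by simp
    moreover have "zorder ?X (- a) = 1 + of_bool (2 * a \<in> \<Lambda>)"
      using zorder_wp_diff[OF a(2), of "- a"] a(2) lattice_uminus_iff[of "2 * a" \<tau>] by simp
    ultimately have neg: "zorder g (- a) = - 1 - of_bool (2 * a \<in> \<Lambda>)" by simp
    then have "is_pole g (- a)" using mero_pole_iff[OF gm nz, of "- a"] by simp
    from pole[OF this] ma have "- a - a \<in> \<Lambda>" "zorder g (- a) = - 1" by blast+
    moreover from this(1) have "2 * a \<in> \<Lambda>" using lattice_uminus_iff[of "2 * a" \<tau>] by simp
    ultimately show False using neg by simp
  qed
  then have n: "c0 + c1 * ?e - c2 * ?e' + c3 * ?e ^ 2 + L / 2 * (?e * ?e') = 0"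
    using wp_uminus[OF a(2)] wp'_uminus[OF a(2)] by simp
  \<comment> \<open>\<open>cover_fun\<close> has leading coefficient -1/3 at 0.\<close>
  define al where "al = - 3 * L"
  define b where "b = c3 / al"
  define k where "k = - 2 * (c2 + al * ?e / 6) / al"
  define de where "de = c1 + c3 * ?e"
  have al: "al \<noteq> 0" using L(2) by (simp add: al_def)
  have gF: "eventually (\<lambda>z. g z = al * cover_fun ?e ?e' b k z + de) (cosparse UNIV)"
    using c wp_minus_nz[of ?e]
  proof eventually_elim
    case (elim z)
    have 1: "al * b = c3" "al * k = - 2 * (c2 + al * ?e / 6)" using al by (simp_all add: b_def k_def)
    have "(al * cover_fun ?e ?e' b k z + de) * ?X z
        = al * (wp' z / 6) * ?X z + (al * b) * wp z * ?X z - (al * k) / 2 * (wp' z + ?e') + de * ?X z"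
      using elim(2) by (simp add: cover_fun_def algebra_simps) (simp add: field_simps)
    also have "\<dots> = N z" unfolding 1 elim(1) de_def using n by (simp add: al_def field_simps power2_eq_square) algebra
    finally have "(al * cover_fun ?e ?e' b k z + de) * ?X z = g z * ?X z" by (simp add: N_def)
    then show ?case using elim(2) by simp
  qed
  \<comment> \<open>Without the quotient term \<open>g\<close> would be regular at
    \<open>a\<close>.\<close>
  have k0: "k \<noteq> 0"
  proof
    assume "k = 0"
    have "((\<lambda>z. al * (wp' z / 6 + b * wp z) + de) \<longlongrightarrow> al * (wp' a / 6 + b * wp a) + de) (at a)"
      by (intro tendsto_intros wp_lim wp'_lim a) simp
    then have "(g \<longlongrightarrow> al * (wp' a / 6 + b * wp a) + de) (at a)"
      by (rule Lim_transform_eventually)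
         (use cosparse_at[OF gF, of a] in eventually_elim, simp add: cover_fun_def \<open>k = 0\<close>)
    then show False using lim_not_pole poles by blast
  qed
  have "even (zorder (deriv (cover_fun ?e ?e' b k)) z)" for z
  proof -
    have "eventually (\<lambda>w. deriv g w = al * deriv (cover_fun ?e ?e' b k) w) (cosparse UNIV)"
      using mero_deriv_cong[OF gF] analytic_cosparse[OF cover_fun_mero[of ?e ?e' b k]]
    proof eventually_elim
      case (elim w)
      have "(cover_fun ?e ?e' b k has_field_derivative deriv (cover_fun ?e ?e' b k) w) (at w)"
        using elim(2) by (simp add: analytic_on_imp_differentiable_at field_differentiable_derivI)
      from DERIV_add[OF DERIV_cmult[OF this, of al] DERIV_const[of de]] show ?case
        unfolding elim(1) by (simp add: DERIV_imp_deriv)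
    qed
    then have "zorder (deriv g) z = zorder (\<lambda>w. al * deriv (cover_fun ?e ?e' b k) w) z"
      by (intro zorder_cong[OF _ refl] cosparse_at)
    then show ?thesis using ev[of z] al by (simp add: zorder_cmult)
  qed
  then have "(?e, ?e', b, k) \<in> sols" by (rule sols_of_even[OF a(2) k0])
  then show ?thesis using that al gF by blast
qed

end

subsection \<open>Counting classes of covers\<close>

lemma moebius_equiv_iff:
  "moebius_equiv f g \<longleftrightarrow> (\<exists>a b c d. a * d - b * c \<noteq> 0 \<and>
     eventually (\<lambda>w. g w = (a * f w + b) / (c * f w + d)) (cosparse UNIV))"
  unfolding moebius_equiv_def cosparse_UNIV_iff ..

lemma moebius_equiv_refl: "moebius_equiv f f"
  unfolding moebius_equiv_iff
  by (rule exI[of _ 1], rule exI[of _ 0], rule exI[of _ 0], rule exI[of _ 1]) simp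

context half_plane
begin

lemma moebius_denominator_nz:
  assumes "nonconst f" "a * d - b * c \<noteq> 0"
  shows "eventually (\<lambda>w. c * f w + d \<noteq> 0) (cosparse UNIV)"
proof (cases "c = 0")
  case True
  then show ?thesis using assms(2) by simp
next
  case False
  have "eventually (\<lambda>w. f w \<noteq> - d / c) (cosparse UNIV)" using assms(1) by (simp add: nonconst_def)
  then show ?thesis
  proof eventually_elim
    case (elim w)
    show ?case
    proof
      assume "c * f w + d = 0"
      then have "f w * c = - d" by algebra
      then have "f w = - d / c" using False by (subst nonzero_eq_divide_eq) auto
      then show False using elim by blast
    qed
  qed
qed

lemma moebius_equiv_sym:
  assumes "nonconst f" "moebius_equiv f g"
  shows "moebius_equiv g f"
proof -
  obtain a b c d where det: "a * d - b * c \<noteq> 0"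
    and g: "eventually (\<lambda>w. g w = (a * f w + b) / (c * f w + d)) (cosparse UNIV)"
    using assms(2) unfolding moebius_equiv_iff by blast
  have "eventually (\<lambda>w. f w = (d * g w + (- b)) / ((- c) * g w + a)) (cosparse UNIV)"
    using g moebius_denominator_nz[OF assms(1) det]
  proof eventually_elim
    case (elim w)
    have g: "g w * (c * f w + d) = a * f w + b" using elim by simp
    have "((- c) * g w + a) * (c * f w + d) = a * d - b * c" using g by algebra
    then have nz: "(- c) * g w + a \<noteq> 0" using det by auto
    have "f w * ((- c) * g w + a) = d * g w + (- b)" using g by algebra
    then show ?case using nz by (simp add: nonzero_eq_divide_eq)
  qed
  moreover have "d * a - (- b) * (- c) \<noteq> 0" using det by (simp add: mult.commute)
  ultimately show ?thesis unfolding moebius_equiv_iff by blast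
qed

lemma moebius_equiv_trans:
  assumes "nonconst f" "moebius_equiv f g" "moebius_equiv g h"
  shows "moebius_equiv f h"
proof -
  obtain a b c d where det: "a * d - b * c \<noteq> 0"
    and g: "eventually (\<lambda>w. g w = (a * f w + b) / (c * f w + d)) (cosparse UNIV)"
    using assms(2) unfolding moebius_equiv_iff by blast
  obtain a' b' c' d' where det': "a' * d' - b' * c' \<noteq> 0"
    and h: "eventually (\<lambda>w. h w = (a' * g w + b') / (c' * g w + d')) (cosparse UNIV)"
    using assms(3) unfolding moebius_equiv_iff by blast
  have "eventually (\<lambda>w. h w = ((a' * a + b' * c) * f w + (a' * b + b' * d)) /
      ((c' * a + d' * c) * f w + (c' * b + d' * d))) (cosparse UNIV)"
    using g h moebius_denominator_nz[OF assms(1) det]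
  proof eventually_elim
    case (elim w)
    let ?Q = "c * f w + d"
    have "a' * g w + b' = ((a' * a + b' * c) * f w + (a' * b + b' * d)) / ?Q"
      "c' * g w + d' = ((c' * a + d' * c) * f w + (c' * b + d' * d)) / ?Q"
      unfolding elim(1) using elim(3) by (simp_all add: add_divide_eq_iff algebra_simps)
    then show ?case unfolding elim(2) using elim(3) by simp
  qed
  moreover have "(a' * a + b' * c) * (c' * b + d' * d) - (a' * b + b' * d) * (c' * a + d' * c)
      = (a * d - b * c) * (a' * d' - b' * c')" by algebra
  then have "(a' * a + b' * c) * (c' * b + d' * d) - (a' * b + b' * d) * (c' * a + d' * c) \<noteq> 0"
    using det det' by simp
  ultimately show ?thesis unfolding moebius_equiv_iff by blast
qed

text \<open>Composition with a Moebius map that sends the value at 0 to infinity. The work lies in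
  showing that degree and all ramification indices are preserved.\<close>

lemma good_cover_invert:
  assumes "good_cover \<tau> f" "\<not> is_pole f 0"
  obtains g where "good_cover \<tau> g" "is_pole g 0" "moebius_equiv f g"
proof -
  obtain q1 q2 q3 where f: "ell f" "ell_degree \<tau> f = 4" "ram_index f 0 \<ge> 3" and nc: "nonconst f"
    by (rule good_coverE[OF assms(1)]; blast)
  note fm = ell_mero[OF f(1)]
  define c where "c = remove_sings f 0"
  let ?h = "\<lambda>z. f z - c"
  define g where "g = (\<lambda>z. 1 / (f z - c))"
  have h: "ell ?h" by (rule ell_minus_const[OF f(1)])
  note hm = ell_mero[OF h]
  have hnz: "eventually (\<lambda>z. ?h z \<noteq> 0) (cosparse UNIV)" by (rule nonconst_minus_nz[OF nc])
  have g: "ell g" unfolding g_def by (intro ell_divide ell_const h)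
  note gm = ell_mero[OF g]
  have gnz: "eventually (\<lambda>z. g z \<noteq> 0) (cosparse UNIV)" using hnz by eventually_elim (simp add: g_def)
  have zg: "zorder g z = - zorder ?h z" for z
    using zorder_inverse[OF mero_iso[OF hm] mero_ness[OF hm] cosparse_frequently[OF hnz], of z]
    by (simp add: g_def inverse_eq_divide)
  have deg: "ell_degree \<tau> g = 4"
  proof -
    have "int (ell_degree \<tau> g) = (\<Sum>p\<in>{p \<in> fund_par \<tau>. zorder g p < 0}. - zorder g p)"
      by (rule ell_degree_eq_zeros(2)[OF g gnz])
    also have "\<dots> = int (ell_degree \<tau> ?h)"
      unfolding zg ell_degree_eq_zeros(1)[OF h hnz] by simp
    also have "\<dots> = 4" by (simp add: ell_degree_minus_const[OF fm] f(2))
    finally show ?thesis by simp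
  qed
  have ram: "ram_index g z = ram_index f z" for z
  proof (cases "is_pole f z")
    case True
    then have n: "zorder ?h z = zorder f z" by (rule zorder_minus_const_pole[OF fm])
    have "zorder f z < 0" using isolated_pole_imp_neg_zorder[OF mero_iso[OF fm] True] .
    then have "zorder g z > 0" using zg n by simp
    then have "\<not> is_pole g z" "isolated_zero g z"
      using mero_pole_iff[OF gm gnz] zorder_pos_imp_isolated_zero[OF mero_at[OF gm] cosparse_at[OF gnz]] by auto
    then have "remove_sings g z = 0" by (intro remove_sings_eqI) (simp add: isolated_zero_def)
    then show ?thesis using \<open>\<not> is_pole g z\<close> True zg n by (simp add: ram_index_def)
  next
    case False
    define d where "d = remove_sings f z"
    have fd: "f \<midarrow>z\<rightarrow> d" unfolding d_def by (rule mero_lim_remove_sings[OF fm False])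
    show ?thesis
    proof (cases "d = c")
      case True
      have pos: "zorder ?h z > 0" using zorder_value[OF fm nc False] True by (simp add: d_def)
      then have "is_pole g z" using mero_pole_iff[OF gm gnz] zg by simp
      then show ?thesis using False zg True by (simp add: ram_index_def d_def)
    next
      \<comment> \<open>Both values are finite here. The difference of the reciprocals is
        \<open>f - d\<close> times a factor with a nonzero limit, so the orders agree.\<close>
      case dc: False
      have hl: "?h \<midarrow>z\<rightarrow> d - c" by (intro tendsto_intros fd)
      have gl: "g \<midarrow>z\<rightarrow> 1 / (d - c)" unfolding g_def using dc by (intro tendsto_intros hl) simp
      then have np: "\<not> is_pole g z" and rs: "remove_sings g z = 1 / (d - c)"
        by (auto intro: lim_not_pole dest: lim_not_pole)
      have fdm: "(\<lambda>w. f w - d) meromorphic_on UNIV" by (rule ell_mero[OF ell_minus_const[OF f(1)]])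
      let ?u = "\<lambda>w. - 1 / ((d - c) * (f w - c))"
      have um: "?u meromorphic_on UNIV" by (intro meromorphic_intros fm)
      have ul: "?u \<midarrow>z\<rightarrow> - 1 / ((d - c) * (d - c))" using dc by (intro tendsto_intros fd) simp
      have u0: "- 1 / ((d - c) * (d - c)) \<noteq> 0" using dc by simp
      have inv: "1 / p - 1 / q = (p - q) * (- 1 / (q * p))" if "p \<noteq> 0" "q \<noteq> 0" for p q :: complex
        using that by (simp add: field_simps)
      have "zorder (\<lambda>w. g w - 1 / (d - c)) z = zorder (\<lambda>w. (f w - d) * ?u w) z"
        by (rule zorder_cong[OF _ refl])
           (use cosparse_at[OF hnz, of z] in eventually_elim, use inv[of "_ - c" "d - c"] dc in \<open>simp add: g_def\<close>)
      also have "\<dots> = zorder (\<lambda>w. f w - d) z + zorder ?u z"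
        by (rule zorder_mult[OF mero_at[OF fdm] cosparse_frequently[OF nonconst_minus_nz[OF nc]]
              mero_at[OF um] cosparse_frequently[OF mero_nz_cosparse[OF um ul u0]]])
      also have "zorder ?u z = 0" by (rule zorder_eq_0_of_lim[OF um ul u0])
      finally show ?thesis using np False rs by (simp add: ram_index_def d_def)
    qed
  qed
  have "good_cover \<tau> g" using assms(1) unfolding good_cover_def ram by (simp add: g deg)
  moreover have "is_pole g 0"
    using zorder_value[OF fm nc assms(2)] mero_pole_iff[OF gm gnz, of 0] zg[of 0] by (simp add: c_def)
  moreover have "moebius_equiv f g" unfolding moebius_equiv_iff
    by (rule exI[of _ 0], rule exI[of _ 1], rule exI[of _ 1], rule exI[of _ "- c"]) (simp add: g_def)
  ultimately show ?thesis using that by blast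
qed

definition cover_of :: "complex \<times> complex \<times> complex \<times> complex \<Rightarrow> complex \<Rightarrow> complex" where
  "cover_of = (\<lambda>(e, e', b, k). cover_fun e e' b k)"

lemma nonconst_cover_of: "nonconst (cover_of t)"
  by (simp add: cover_of_def cover_fun_nonconst split: prod.splits)

lemma good_cover_cover_of:
  assumes "(e, e', b, k) \<in> sols" "k \<noteq> 0"
  shows "good_cover \<tau> (cover_of (e, e', b, k))"
proof -
  have "e' ^ 2 = 4 * (e - e1) * (e - e2) * (e - e3)" using sols_on_curve[OF assms(1)] cubic_g by simp
  then obtain a where a: "a \<notin> \<Lambda>" "wp a = e" "wp' a = e'" by (rule curve_param)
  have "good_cover \<tau> (cover_fun (wp a) (wp' a) b k)"
    by (rule good_cover_of_even[OF a(1) assms(2)]) (use even_of_sols[OF assms(1)] a in simp)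
  then show ?thesis by (simp add: cover_of_def a)
qed

text \<open>Both functions have a pole at 0, so the Moebius map fixes infinity and is affine; equal
  leading coefficients make it a translation. The parameters are then compared after clearing
  denominators.\<close>

lemma cover_of_inj:
  assumes "moebius_equiv (cover_of (e, e', b, k)) (cover_of (f, f', c, l))" "k \<noteq> 0"
  shows "(e, e', b, k) = (f, f', c, l)"
proof -
  let ?F = "cover_fun e e' b k" and ?G = "cover_fun f f' c l"
  obtain A B C D where det: "A * D - B * C \<noteq> 0"
    and ev: "eventually (\<lambda>w. ?G w = (A * ?F w + B) / (C * ?F w + D)) (cosparse UNIV)"
    using assms(1) unfolding moebius_equiv_iff cover_of_def by auto
  have ev2: "eventually (\<lambda>w. ?G w * (C * ?F w + D) = A * ?F w + B) (cosparse UNIV)"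
    using ev moebius_denominator_nz[OF cover_fun_nonconst[of e e' b k] det] by eventually_elim simp
  \<comment> \<open>Multiplied by the sixth power of \<open>z\<close>, only the term with
    \<open>C\<close> survives on the left at 0, while the right side tends to 0.\<close>
  have "((\<lambda>z. (z ^ 3 * ?G z) * (C * (z ^ 3 * ?F z) + D * z ^ 3)) \<longlongrightarrow> (- 1 / 3) * (C * (- 1 / 3) + D * 0 ^ 3)) (at 0)"
    by (intro tendsto_intros cover_fun_lim)
  then have "((\<lambda>z. z ^ 3 * (A * (z ^ 3 * ?F z) + B * z ^ 3)) \<longlongrightarrow> (- 1 / 3) * (C * (- 1 / 3) + D * 0 ^ 3)) (at 0)"
  proof (rule Lim_transform_eventually)
    show "eventually (\<lambda>z. (z ^ 3 * ?G z) * (C * (z ^ 3 * ?F z) + D * z ^ 3) = z ^ 3 * (A * (z ^ 3 * ?F z) + B * z ^ 3)) (at 0)"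
      using cosparse_at[OF ev2, of 0]
    proof eventually_elim
      case (elim z)
      have "(z ^ 3 * ?G z) * (C * (z ^ 3 * ?F z) + D * z ^ 3) = z ^ 3 * z ^ 3 * (?G z * (C * ?F z + D))"
        by (simp add: algebra_simps)
      then show ?case unfolding elim by (simp add: algebra_simps)
    qed
  qed
  moreover have "((\<lambda>z. z ^ 3 * (A * (z ^ 3 * ?F z) + B * z ^ 3)) \<longlongrightarrow> 0 ^ 3 * (A * (- 1 / 3) + B * 0 ^ 3)) (at 0)"
    by (intro tendsto_intros cover_fun_lim)
  ultimately have "(- 1 / 3) * (C * (- 1 / 3) + D * 0 ^ 3) = 0 ^ 3 * (A * (- 1 / 3) + B * 0 ^ 3)"
    by (rule tendsto_unique[rotated]) simp
  then have C: "C = 0" by simp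
  then have D: "D \<noteq> 0" using det by auto
  define \<alpha> \<delta> where "\<alpha> = A / D" and "\<delta> = B / D"
  have ev3: "eventually (\<lambda>w. ?G w = \<alpha> * ?F w + \<delta>) (cosparse UNIV)"
    using ev by eventually_elim (simp add: C \<alpha>_def \<delta>_def add_divide_distrib)
  have "((\<lambda>z. \<alpha> * (z ^ 3 * ?F z) + \<delta> * z ^ 3) \<longlongrightarrow> \<alpha> * (- 1 / 3) + \<delta> * 0 ^ 3) (at 0)"
    by (intro tendsto_intros cover_fun_lim)
  then have "((\<lambda>z. z ^ 3 * ?G z) \<longlongrightarrow> \<alpha> * (- 1 / 3) + \<delta> * 0 ^ 3) (at 0)"
    by (rule Lim_transform_eventually)
       (use cosparse_at[OF ev3, of 0] in eventually_elim, simp add: algebra_simps)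
  then have "\<alpha> * (- 1 / 3) + \<delta> * 0 ^ 3 = - 1 / 3"
    by (rule tendsto_unique[rotated, OF _ cover_fun_lim]) simp
  then have \<alpha>: "\<alpha> = 1" by simp
  \<comment> \<open>The equation \<open>?G - ?F = \<delta>\<close> multiplied by both denominators;
    the terms with \<open>wp' / 6\<close> have cancelled.\<close>
  define P where "P = (\<lambda>x y. (c - b) * x * (x - e) * (x - f) - l / 2 * (y + f') * (x - e)
     + k / 2 * (y + e') * (x - f) - \<delta> * (x - e) * (x - f))"
  have hP: "(\<lambda>z. P (wp z) (wp' z)) holomorphic_on (- \<Lambda>)"
    unfolding P_def by (intro holomorphic_intros wp_holo wp'_holo) auto
  have evP: "eventually (\<lambda>w. P (wp w) (wp' w) = 0) (cosparse UNIV)"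
    using ev3 wp_minus_nz[of e] wp_minus_nz[of f]
  proof eventually_elim
    case (elim w)
    have q: "(T - k / 2 * (M / d)) * d = T * d - k / 2 * M" if "d \<noteq> 0" for T k M d :: complex
      using that by (simp add: left_diff_distrib)
    have 1: "?F w * (wp w - e) = (wp' w / 6 + b * wp w) * (wp w - e) - k / 2 * (wp' w + e')"
      unfolding cover_fun_def by (rule q[OF elim(2)])
    have 2: "?G w * (wp w - f) = (wp' w / 6 + c * wp w) * (wp w - f) - l / 2 * (wp' w + f')"
      unfolding cover_fun_def by (rule q[OF elim(3)])
    have "?G w * (wp w - f) * (wp w - e) = ?F w * (wp w - e) * (wp w - f) + \<delta> * (wp w - e) * (wp w - f)"
      unfolding elim(1) \<alpha> by (simp add: algebra_simps)
    then show ?case unfolding 1 2 P_def by (simp add: algebra_simps)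
  qed
  have P0: "P x y = 0" if "y ^ 2 = 4 * x ^ 3 - g2 * x - g3" for x y
    by (rule curve_identityI[where P = P and R = "\<lambda>_ _. 0", OF hP holomorphic_on_const evP that])
  define U where "U = [: (l * f' * e - k * e' * f) / 2 - \<delta> * e * f,
     (c - b) * e * f + (k * e' - l * f') / 2 + \<delta> * (e + f), - (c - b) * (e + f) - \<delta>, c - b :]"
  define V where "V = [: (l * e - k * f) / 2, (k - l) / 2 :]"
  define W where "W = [: - g3, - g2, 0, 4 :]"
  have "poly U x + poly V x * y = 0" if "y ^ 2 = poly W x" for x y
  proof -
    have "y ^ 2 = 4 * x ^ 3 - g2 * x - g3" using that by (simp add: W_def algebra_simps power3_eq_cube)
    then have "P x y = 0" by (rule P0)
    moreover have "poly U x + poly V x * y = P x y"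
      unfolding U_def V_def P_def by (simp add: field_simps)
    ultimately show ?thesis by simp
  qed
  then have "U = 0" "V = 0" using curve_poly_eq_0[of W U V] by (auto simp: W_def)
  then have "(l * e - k * f) / 2 = 0" "(k - l) / 2 = 0" "c - b = 0" "- (c - b) * (e + f) - \<delta> = 0"
    "(c - b) * e * f + (k * e' - l * f') / 2 + \<delta> * (e + f) = 0"
    unfolding U_def V_def pCons_eq_0_iff by blast+
  then show ?thesis using assms(2) by auto
qed

text \<open>Every class contains a cover with a pole at 0, hence a normal form, which is unique by
  \<open>cover_of_inj\<close>. For \<open>k = 0\<close> the normal form would have degree 3 only,
  hence the assumption.\<close>

theorem N4_eq_card_sols:
  assumes nz: "\<And>e e' b k. (e, e', b, k) \<in> sols \<Longrightarrow> k \<noteq> 0"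
  shows "N4 \<tau> = card sols"
proof -
  let ?cls = "\<lambda>f. {g. good_cover \<tau> g \<and> moebius_equiv f g}"
  have good: "good_cover \<tau> (cover_of t)" if "t \<in> sols" for t
    using good_cover_cover_of nz that by (cases t) auto
  have ncg: "nonconst f" if "good_cover \<tau> f" for f
    by (rule good_coverE[OF that]; blast)
  have "inj_on (\<lambda>t. ?cls (cover_of t)) sols"
  proof (rule inj_onI)
    fix t t' assume t: "t \<in> sols" "t' \<in> sols" and eq: "?cls (cover_of t) = ?cls (cover_of t')"
    have "cover_of t' \<in> ?cls (cover_of t')" using good[OF t(2)] moebius_equiv_refl by blast
    then have "moebius_equiv (cover_of t) (cover_of t')" unfolding eq[symmetric] by blast
    then show "t = t'" using cover_of_inj nz t by (cases t; cases t') auto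
  qed
  moreover have "{?cls f | f. good_cover \<tau> f} = (\<lambda>t. ?cls (cover_of t)) ` sols"
  proof (intro equalityI subsetI)
    fix X assume "X \<in> {?cls f | f. good_cover \<tau> f}"
    then obtain f where f: "good_cover \<tau> f" "X = ?cls f" by blast
    obtain g where g: "good_cover \<tau> g" "is_pole g 0" "moebius_equiv f g"
      using good_cover_invert[OF f(1)] f(1) moebius_equiv_refl by metis
    obtain e e' b k al de where n: "(e, e', b, k) \<in> sols" "al \<noteq> 0"
      "eventually (\<lambda>z. g z = al * cover_fun e e' b k z + de) (cosparse UNIV)"
      by (rule good_cover_normal_form[OF g(1,2)]; blast)
    let ?t = "(e, e', b, k)"
    have "moebius_equiv (cover_of ?t) g"
      unfolding moebius_equiv_iff
      by (rule exI[of _ al], rule exI[of _ de], rule exI[of _ 0], rule exI[of _ 1])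
         (use n in \<open>simp add: cover_of_def\<close>)
    then have tf: "moebius_equiv (cover_of ?t) f"
      using moebius_equiv_trans[OF nonconst_cover_of _ moebius_equiv_sym[OF ncg[OF f(1)] g(3)]] by blast
    have ft: "moebius_equiv f (cover_of ?t)" by (rule moebius_equiv_sym[OF nonconst_cover_of tf])
    have "?cls f = ?cls (cover_of ?t)"
      using moebius_equiv_trans[OF nonconst_cover_of tf] moebius_equiv_trans[OF ncg[OF f(1)] ft] by blast
    then show "X \<in> (\<lambda>t. ?cls (cover_of t)) ` sols" using n(1) f(2) by blast
  next
    fix X assume "X \<in> (\<lambda>t. ?cls (cover_of t)) ` sols"
    then show "X \<in> {?cls f | f. good_cover \<tau> f}" using good by blast
  qed
  ultimately show ?thesis unfolding N4_def by (simp add: card_image)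
qed

lemma discriminant_nz: "g2 ^ 3 \<noteq> 27 * g3\<^sup>2"
proof -
  have e3: "e3 = - e1 - e2" using e_sum by algebra
  have "g2 ^ 3 - 27 * g3\<^sup>2 = 16 * ((e1 - e2) * (e1 - e3) * (e2 - e3))\<^sup>2"
    unfolding g2_def g3_def e3 by algebra
  then show ?thesis using e_distinct by auto
qed

theorem N4_generic:
  assumes "g2 \<noteq> 0" and nd: "\<And>r s t. (r, s, t) \<in> root_triples \<Longrightarrow> 2 * r + 7 * s \<noteq> 0 \<and> 2 * r + 7 * t \<noteq> 0"
  shows "N4 \<tau> = 16"
proof -
  have half: "card (sols_half r s t) = 4" "\<And>e e' b k. (e, e', b, k) \<in> sols_half r s t \<Longrightarrow> k \<noteq> 0"
    if "(r, s, t) \<in> root_triples" for r s t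
    using card_sols_half[of r s t] root_triples_facts(1-4)[OF that] nd[OF that] by blast+
  note triv = card_sols_trivial[OF assms(1) discriminant_nz]
  have N: "N4 \<tau> = card sols"
    by (rule N4_eq_card_sols) (use half(2) triv(2) in \<open>unfold sols_def, blast\<close>)
  have T: "(e1, e2, e3) \<in> root_triples" "(e2, e1, e3) \<in> root_triples" "(e3, e1, e2) \<in> root_triples"
    by (auto simp: root_triples_def)
  have sols: "sols = ((sols_trivial g2 g3 \<union> sols_half e1 e2 e3) \<union> sols_half e2 e1 e3) \<union> sols_half e3 e1 e2"
    by (auto simp: sols_def root_triples_def)
  have fin: "finite (sols_trivial g2 g3)" "finite (sols_half e1 e2 e3)" "finite (sols_half e2 e1 e3)" "finite (sols_half e3 e1 e2)"
    using triv(1) half(1)[OF T(1)] half(1)[OF T(2)] half(1)[OF T(3)] by (auto intro: card_ge_0_finite)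
  have dt: "sols_trivial g2 g3 \<inter> sols_half r s t = {}" if "(r, s, t) \<in> root_triples" for r s t
    using sols_trivial_half_disjoint[of r s t] root_triples_facts(1-4)[OF that] by blast
  \<comment> \<open>\<open>k = (e - r) / 9\<close> recovers \<open>r\<close> from a
    solution.\<close>
  have dh: "sols_half e1 e2 e3 \<inter> sols_half e2 e1 e3 = {}" "sols_half e1 e2 e3 \<inter> sols_half e3 e1 e2 = {}"
    "sols_half e2 e1 e3 \<inter> sols_half e3 e1 e2 = {}"
    using e_distinct by (auto simp: sols_half_def)
  let ?A = "sols_trivial g2 g3" and ?B1 = "sols_half e1 e2 e3" and ?B2 = "sols_half e2 e1 e3" and ?B3 = "sols_half e3 e1 e2"
  have "card sols = card (?A \<union> ?B1 \<union> ?B2) + card ?B3"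
    unfolding sols by (rule card_Un_disjoint) (use fin dt[OF T(3)] dh in auto)
  also have "card (?A \<union> ?B1 \<union> ?B2) = card (?A \<union> ?B1) + card ?B2"
    by (rule card_Un_disjoint) (use fin dt[OF T(2)] dh in auto)
  also have "card (?A \<union> ?B1) = card ?A + card ?B1"
    by (rule card_Un_disjoint) (use fin dt[OF T(1)] in auto)
  finally have "card sols = 16" using triv(1) half(1)[OF T(1)] half(1)[OF T(2)] half(1)[OF T(3)] by simp
  then show ?thesis using N by simp
qed

end

subsection \<open>The lattice is determined by its invariants\<close>

text \<open>The limit is the order of vanishing of \<open>d\<close> at 0, computed from
  \<open>d w = g w * w ^ k\<close> with \<open>g\<close> free of zeros.\<close>

lemma log_deriv_limit:
  fixes d :: "complex \<Rightarrow> complex"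
  assumes d: "d holomorphic_on ball 0 \<rho>" and w: "w \<in> ball 0 \<rho>" "d w \<noteq> 0" and \<rho>: "\<rho> > 0"
  obtains s k where "s > 0" "ball (0 :: complex) s \<subseteq> ball 0 \<rho>" "\<And>z. z \<in> ball 0 s - {0} \<Longrightarrow> d z \<noteq> 0"
    "((\<lambda>z. z * deriv d z / d z) \<longlongrightarrow> of_nat k) (at 0)"
proof -
  define k where "k = nat (zorder d 0)"
  define g where "g = zor_poly d 0"
  have 0: "0 \<in> ball (0 :: complex) \<rho>" using \<rho> by simp
  have ex: "\<exists>w\<in>ball 0 \<rho>. d w \<noteq> 0" using w(2,1) by (rule bexI)
  have "\<exists>s>0. cball (0 :: complex) s \<subseteq> ball 0 \<rho> \<and> g holomorphic_on cball 0 s \<and>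
      (\<forall>w\<in>cball 0 s. d w = g w * (w - 0) ^ k \<and> g w \<noteq> 0)"
    using zorder_exist_zero[OF d open_ball connected_ball 0 ex] unfolding k_def g_def
    by (elim conjE)
  then obtain s where s: "s > 0" "cball (0 :: complex) s \<subseteq> ball 0 \<rho>" "g holomorphic_on cball 0 s"
    "\<forall>w\<in>cball 0 s. d w = g w * (w - 0) ^ k \<and> g w \<noteq> 0"
    by (elim exE conjE)
  have g1: "g holomorphic_on ball 0 s" by (rule holomorphic_on_subset[OF s(3) ball_subset_cball])
  have g2: "d w = g w * w ^ k" and g3: "g w \<noteq> 0" if "w \<in> ball 0 s" for w
    using bspec[OF s(4), of w] that by simp_all
  have log: "z * deriv d z / d z = z * (deriv g z / g z) + of_nat k" if z: "z \<in> ball 0 s - {0}" for z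
  proof -
    have zb: "z \<in> ball 0 s" using z by simp
    have gd: "(g has_field_derivative deriv g z) (at z)"
      by (rule holomorphic_derivI[OF g1 open_ball zb])
    have pd: "((\<lambda>w. w ^ k) has_field_derivative of_nat k * z ^ (k - 1)) (at z)"
      using DERIV_power[OF DERIV_ident, of k z] by simp
    have "(d has_field_derivative deriv g z * z ^ k + of_nat k * z ^ (k - 1) * g z) (at z)"
      by (rule has_field_derivative_transform_within_open[OF DERIV_mult[OF gd pd] open_ball zb])
         (rule g2[symmetric])
    then have dz: "deriv d z = deriv g z * z ^ k + of_nat k * z ^ (k - 1) * g z"
      by (rule DERIV_imp_deriv)
    have "z * (of_nat k * z ^ (k - 1) * g z) = of_nat k * z ^ k * g z"
      by (cases k) (simp_all add: mult_ac)
    then have "z * deriv d z = (z * deriv g z + of_nat k * g z) * z ^ k"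
      unfolding dz by (simp add: algebra_simps)
    then have "z * deriv d z / d z = (z * deriv g z + of_nat k * g z) / g z"
      unfolding g2[OF zb] using z by simp
    then show ?thesis using g3[OF zb] by (simp add: add_divide_distrib)
  qed
  have "(\<lambda>z. z * (deriv g z / g z) + of_nat k) holomorphic_on ball 0 s"
    using g1 g3 by (intro holomorphic_intros) auto
  from holomorphic_on_imp_continuous_on[OF this]
  have "isCont (\<lambda>z. z * (deriv g z / g z) + of_nat k) 0"
    by (rule continuous_on_interior) (use s(1) in simp)
  then have "((\<lambda>z. z * (deriv g z / g z) + of_nat k) \<longlongrightarrow> of_nat k) (at 0)"
    by (simp add: isCont_def)
  then have "((\<lambda>z. z * deriv d z / d z) \<longlongrightarrow> of_nat k) (at 0)"
    by (rule Lim_transform_within_open[where s = "ball 0 s"]) (use s(1) log in simp_all)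
  moreover have "d z \<noteq> 0" if "z \<in> ball 0 s - {0}" for z
    using that g2[of z] g3[of z] by simp
  ultimately show ?thesis
    by (rule that[OF s(1) order_trans[OF ball_subset_cball s(2)], rotated])
qed

text \<open>Two solutions of the Weierstrass equation with a double pole at 0 differ by a function
  that, if it had order \<open>n \<ge> 0\<close> there, would satisfy \<open>- 4 n = 12\<close>.\<close>

lemma lattice_scale_subset:
  assumes "half_plane \<tau>" "half_plane \<sigma>" and m: "m \<noteq> 0"
    and g2: "half_plane.g2 \<tau> = m ^ 4 * half_plane.g2 \<sigma>"
    and g3: "half_plane.g3 \<tau> = m ^ 6 * half_plane.g3 \<sigma>"
    and l: "l \<in> lattice \<tau>"
  shows "m * l \<in> lattice \<sigma>"
proof -
  interpret T: half_plane \<tau> by fact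
  interpret S: half_plane \<sigma> by fact
  \<comment> \<open>The Weierstrass function of \<sigma> rescaled by \<open>m\<close>: by
    homogeneity it satisfies the differential equation with the invariants of \<tau>.\<close>
  define Y where "Y = (\<lambda>z. m ^ 2 * S.wp (m * z))"
  define Y' where "Y' = (\<lambda>z. m ^ 3 * S.wp' (m * z))"
  obtain r A where A: "r > 0" "A holomorphic_on ball 0 r"
    "\<And>z. z \<in> ball 0 r - {0} \<Longrightarrow> z \<notin> lattice \<tau>" "\<And>z. z \<in> ball 0 r - {0} \<Longrightarrow> T.wp z = 1 / z ^ 2 + A z"
    by (rule T.wp_expansion; blast)
  obtain r' B where B: "r' > 0" "B holomorphic_on ball 0 r'"
    "\<And>z. z \<in> ball 0 r' - {0} \<Longrightarrow> z \<notin> lattice \<sigma>" "\<And>z. z \<in> ball 0 r' - {0} \<Longrightarrow> S.wp z = 1 / z ^ 2 + B z"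
    by (rule S.wp_expansion; blast)
  define \<rho> where "\<rho> = min r (r' / norm m)"
  have \<rho>: "\<rho> > 0" using A(1) B(1) m by (simp add: \<rho>_def)
  have mb: "m * z \<in> ball 0 r'" if "z \<in> ball 0 \<rho>" for z
    using that m by (simp add: \<rho>_def norm_mult field_simps)
  have rb: "z \<in> ball 0 r" if "z \<in> ball 0 \<rho>" for z using that by (simp add: \<rho>_def)
  define d where "d = (\<lambda>z. A z - m ^ 2 * B (m * z))"
  have d_holo: "d holomorphic_on ball 0 \<rho>"
  proof -
    have "(\<lambda>z. B (m * z)) holomorphic_on ball 0 \<rho>"
      by (rule holomorphic_on_compose_gen[of "\<lambda>z. m * z" _ B "ball 0 r'", unfolded o_def])
         (use mb B(2) in \<open>auto intro!: holomorphic_intros\<close>)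
    moreover have "A holomorphic_on ball 0 \<rho>"
      by (rule holomorphic_on_subset[OF A(2)]) (auto simp: \<rho>_def)
    ultimately show ?thesis unfolding d_def by (intro holomorphic_intros)
  qed
  have XY: "T.wp z - Y z = d z" if "z \<in> ball 0 \<rho> - {0}" for z
  proof -
    have "S.wp (m * z) = 1 / (m * z) ^ 2 + B (m * z)" using B(4)[of "m * z"] mb[of z] that m by simp
    moreover have "T.wp z = 1 / z ^ 2 + A z" using A(4)[of z] rb[of z] that by simp
    moreover have "m ^ 2 * (1 / (m * z) ^ 2) = 1 / z ^ 2" using m by (simp add: power_mult_distrib)
    ultimately show ?thesis by (simp add: d_def Y_def ring_distribs)
  qed
  have nT: "z \<notin> lattice \<tau>" if "z \<in> ball 0 \<rho> - {0}" for z
    using A(3)[of z] rb[of z] that by simp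
  have nS: "m * z \<notin> lattice \<sigma>" if "z \<in> ball 0 \<rho> - {0}" for z
    using B(3)[of "m * z"] mb[of z] that m by simp
  have dY: "(Y has_field_derivative Y' z) (at z)" if "m * z \<notin> lattice \<sigma>" for z
  proof -
    have "((\<lambda>z. S.wp (m * z)) has_field_derivative S.wp' (m * z) * m) (at z)"
      by (rule DERIV_chain2[of S.wp _ "\<lambda>z. m * z"], rule S.wp_deriv[OF that])
         (rule DERIV_cmult_Id)
    from DERIV_cmult[OF this, of "m ^ 2"] show ?thesis
      by (simp add: Y_def Y'_def mult_ac power2_eq_square power3_eq_cube)
  qed
  have odeY: "Y' z ^ 2 = 4 * Y z ^ 3 - T.g2 * Y z - T.g3" if "m * z \<notin> lattice \<sigma>" for z
  proof -
    have "Y' z ^ 2 = m ^ 6 * S.wp' (m * z) ^ 2"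
      by (simp add: Y'_def power_mult_distrib flip: power_mult)
    also have "\<dots> = m ^ 6 * (4 * S.wp (m * z) ^ 3 - S.g2 * S.wp (m * z) - S.g3)"
      unfolding S.wp_ode'[OF that] ..
    also have "\<dots> = 4 * Y z ^ 3 - T.g2 * Y z - T.g3"
      unfolding g2 g3 Y_def by algebra
    finally show ?thesis .
  qed
  have lm: "filterlim (\<lambda>z. m * z) (at 0) (at 0)"
  proof -
    have "((\<lambda>z. m * z) \<longlongrightarrow> m * 0) (at 0)" by (intro tendsto_intros)
    then have "((\<lambda>z. m * z) \<longlongrightarrow> 0) (at 0)" by simp
    moreover have "eventually (\<lambda>z. m * z \<noteq> 0) (at 0)"
      using eventually_neq_at_within[of 0 0 UNIV] by (rule eventually_mono) (use m in simp)
    ultimately show ?thesis by (rule filterlim_atI)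
  qed
  have "((\<lambda>z. (m * z) ^ 2 * S.wp (m * z)) \<longlongrightarrow> 1) (at 0)"
    by (rule filterlim_compose[OF S.lim_wp lm])
  then have limY: "((\<lambda>z. z ^ 2 * Y z) \<longlongrightarrow> 1) (at 0)"
    by (simp add: Y_def power_mult_distrib mult_ac)
  have "((\<lambda>z. (m * z) ^ 3 * S.wp' (m * z)) \<longlongrightarrow> - 2) (at 0)"
    by (rule filterlim_compose[OF S.lim_wp' lm])
  then have limY': "((\<lambda>z. z ^ 3 * Y' z) \<longlongrightarrow> - 2) (at 0)"
    by (simp add: Y'_def power_mult_distrib mult_ac)
  have dd: "T.wp' z - Y' z = deriv d z" if z: "z \<in> ball 0 \<rho> - {0}" for z
  proof -
    have "((\<lambda>z. T.wp z - Y z) has_field_derivative T.wp' z - Y' z) (at z)"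
      by (intro DERIV_diff T.wp_deriv dY nT nS z)
    then have "(d has_field_derivative T.wp' z - Y' z) (at z)"
      by (rule has_field_derivative_transform_within_open[where S = "ball 0 \<rho> - {0}"])
         (use z XY in auto)
    then show ?thesis by (simp add: DERIV_imp_deriv)
  qed
  have "d w = 0" if w: "w \<in> ball 0 \<rho>" for w
  proof (rule ccontr)
    assume "d w \<noteq> 0"
    obtain s k where s: "s > 0" "ball (0 :: complex) s \<subseteq> ball 0 \<rho>" "\<And>z. z \<in> ball 0 s - {0} \<Longrightarrow> d z \<noteq> 0"
      and limk: "((\<lambda>z. z * deriv d z / d z) \<longlongrightarrow> of_nat k) (at 0)"
      by (rule log_deriv_limit[OF d_holo w \<open>d w \<noteq> 0\<close> \<rho>]) (rule that)
    \<comment> \<open>The difference of the two Weierstrass equations factors as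
      \<open>(wp' + Y') * d' = d * (4 * (X ^ 2 + X * Y + Y ^ 2) - g2)\<close>. Multiplied by
      \<open>z ^ 4 / d\<close>, its sides have the limits computed in 1 and 2.\<close>
    have 1: "((\<lambda>z. (z ^ 3 * T.wp' z + z ^ 3 * Y' z) * (z * deriv d z / d z)) \<longlongrightarrow>
        (- 2 + - 2) * of_nat k) (at 0)"
      by (intro tendsto_intros T.lim_wp' limY' limk)
    have 2: "((\<lambda>z. 4 * ((z ^ 2 * T.wp z) ^ 2 + (z ^ 2 * T.wp z) * (z ^ 2 * Y z) + (z ^ 2 * Y z) ^ 2) - T.g2 * z ^ 4) \<longlongrightarrow>
        4 * (1 ^ 2 + 1 * 1 + 1 ^ 2) - T.g2 * 0 ^ 4) (at 0)"
      by (intro tendsto_intros T.lim_wp limY)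
    have "((\<lambda>z. (z ^ 3 * T.wp' z + z ^ 3 * Y' z) * (z * deriv d z / d z)) \<longlongrightarrow>
        4 * (1 ^ 2 + 1 * 1 + 1 ^ 2) - T.g2 * 0 ^ 4) (at 0)"
    proof (rule Lim_transform_within_open[OF 2, where s = "ball 0 s"])
      fix z :: complex assume z: "z \<in> ball 0 s" "z \<noteq> 0"
      then have z\<rho>: "z \<in> ball 0 \<rho> - {0}" using s(2) by blast
      have d0: "d z \<noteq> 0" using s(3)[of z] z by simp
      define X where "X = T.wp z"
      have "(T.wp' z + Y' z) * deriv d z = T.wp' z ^ 2 - Y' z ^ 2"
        unfolding dd[OF z\<rho>, symmetric] by algebra
      also have "\<dots> = (4 * X ^ 3 - T.g2 * X - T.g3) - (4 * Y z ^ 3 - T.g2 * Y z - T.g3)"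
        unfolding T.wp_ode'[OF nT[OF z\<rho>]] odeY[OF nS[OF z\<rho>]] X_def ..
      also have "\<dots> = (X - Y z) * (4 * (X ^ 2 + X * Y z + Y z ^ 2) - T.g2)" by algebra
      also have "X - Y z = d z" unfolding X_def by (rule XY[OF z\<rho>])
      finally have "(T.wp' z + Y' z) * deriv d z = d z * (4 * (X ^ 2 + X * Y z + Y z ^ 2) - T.g2)" .
      then have e: "(T.wp' z + Y' z) * (deriv d z / d z) = 4 * (X ^ 2 + X * Y z + Y z ^ 2) - T.g2"
        using d0 by (simp add: field_simps)
      have "(z ^ 3 * T.wp' z + z ^ 3 * Y' z) * (z * deriv d z / d z) =
          z ^ 4 * ((T.wp' z + Y' z) * (deriv d z / d z))"
        by (simp add: algebra_simps power_numeral_reduce)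
      also have "\<dots> = 4 * ((z ^ 2 * T.wp z) ^ 2 + (z ^ 2 * T.wp z) * (z ^ 2 * Y z) + (z ^ 2 * Y z) ^ 2) - T.g2 * z ^ 4"
        unfolding e X_def by algebra
      finally show "4 * ((z ^ 2 * T.wp z) ^ 2 + (z ^ 2 * T.wp z) * (z ^ 2 * Y z) + (z ^ 2 * Y z) ^ 2) - T.g2 * z ^ 4 =
        (z ^ 3 * T.wp' z + z ^ 3 * Y' z) * (z * deriv d z / d z)" by simp
    qed (use s(1) in auto)
    then have "(- 2 + - 2) * of_nat k = 4 * (1 ^ 2 + 1 * 1 + 1 ^ 2) - T.g2 * 0 ^ 4"
      by (rule tendsto_unique[OF at_neq_bot 1])
    then have "- 4 * Re (of_nat k) = 12" by (simp add: complex_eq_iff)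
    then show False by simp
  qed
  then have "T.wp z = Y z" if "z \<in> ball 0 \<rho> - {0}" for z
    using XY[OF that] that by simp
  then have "eventually (\<lambda>z. T.wp z = Y z) (at 0)"
    unfolding eventually_at using \<rho> by (intro exI[of _ \<rho>]) simp
  then have fr: "frequently (\<lambda>z. T.wp z = Y z) (at 0)" by (intro eventually_frequently) auto
  have Ym: "Y meromorphic_on UNIV"
    unfolding Y_def
    by (intro meromorphic_intros meromorphic_on_compose[OF S.wp_mero(1)]) (auto intro!: analytic_intros)
  have eq: "eventually (\<lambda>z. T.wp z = Y z) (cosparse UNIV)"
    by (rule cosparse_mero_eq[OF T.wp_mero(1) Ym fr])
  \<comment> \<open>Having been identified with \<open>wp\<close>, the function \<open>Y\<close>
    must have a pole at \<open>l\<close>, but it is continuous wherever \<open>m * l\<close> is off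
    the lattice of \<sigma>.\<close>
  show ?thesis
  proof (rule ccontr)
    assume n: "m * l \<notin> lattice \<sigma>"
    have "isCont Y l" by (rule DERIV_isCont[OF dY[OF n]])
    then have "Y \<midarrow>l\<rightarrow> Y l" by (simp add: isCont_def)
    then have "T.wp \<midarrow>l\<rightarrow> Y l"
      by (rule Lim_transform_eventually) (use cosparse_at[OF eq, of l] in eventually_elim, simp)
    then have np: "\<not> is_pole T.wp l" by (rule lim_not_pole)
    have "zorder T.wp 0 = - 2" "eventually (\<lambda>z. T.wp z \<noteq> 0) (cosparse UNIV)"
      using zorder_of_lim[OF T.wp_mero(1) T.lim_wp] by auto
    then have "is_pole T.wp 0" using mero_pole_iff[OF T.wp_mero(1)] by simp
    then show False using T.ell_pole_shift[OF T.ell_wp l, of 0] np by simp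
  qed
qed

lemma lattice_coords_unique:
  assumes "half_plane \<tau>" "of_int p + of_int q * \<tau> = of_int p' + of_int q' * \<tau>"
  shows "p = p' \<and> q = q'"
proof -
  interpret half_plane \<tau> by fact
  have "Im (of_int p + of_int q * \<tau>) = Im (of_int p' + of_int q' * \<tau>)" using assms(2) by (rule arg_cong)
  then have "q = q'" using Im_pos by simp
  then show ?thesis using assms(2) by simp
qed

text \<open>Multiplication by \<open>m\<close> maps one lattice into the other and
  \<open>1 / m\<close> maps back, so the coefficients form mutually inverse integer
  matrices.\<close>

lemma sl2z_equiv_of_invariants:
  assumes "half_plane \<tau>" "half_plane \<sigma>" and m: "m \<noteq> 0"
    and g2: "half_plane.g2 \<tau> = m ^ 4 * half_plane.g2 \<sigma>"
    and g3: "half_plane.g3 \<tau> = m ^ 6 * half_plane.g3 \<sigma>"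
  shows "sl2z_equiv \<sigma> \<tau>"
proof -
  interpret T: half_plane \<tau> by fact
  interpret S: half_plane \<sigma> by fact
  have f: "m * l \<in> lattice \<sigma>" if "l \<in> lattice \<tau>" for l
    by (rule lattice_scale_subset[OF assms that])
  have b: "1 / m * l \<in> lattice \<tau>" if "l \<in> lattice \<sigma>" for l
    by (rule lattice_scale_subset[OF assms(2,1) _ _ _ that]) (use m g2 g3 in \<open>auto simp: power_divide\<close>)
  obtain c d where m1: "m = of_int d + of_int c * \<sigma>" using f[OF lattice_1] by (auto simp: lattice_iff)
  obtain a e where m2: "m * \<tau> = of_int e + of_int a * \<sigma>" using f[OF lattice_tau] by (auto simp: lattice_iff)
  obtain c' d' where m3: "1 / m = of_int d' + of_int c' * \<tau>" using b[OF lattice_1] by (auto simp: lattice_iff)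
  obtain a' e' where m4: "1 / m * \<sigma> = of_int e' + of_int a' * \<tau>" using b[OF lattice_tau] by (auto simp: lattice_iff)
  have "of_int 1 + of_int 0 * \<sigma> = m * (1 / m)" using m by simp
  also have "\<dots> = of_int d' * m + of_int c' * (m * \<tau>)" unfolding m3 by (simp add: algebra_simps)
  also have "\<dots> = of_int (d' * d + c' * e) + of_int (d' * c + c' * a) * \<sigma>"
    unfolding m2 by (subst m1) (simp add: algebra_simps)
  finally have 1: "1 = d' * d + c' * e" "0 = d' * c + c' * a"
    using lattice_coords_unique[OF assms(2)] by blast+
  have "of_int 0 + of_int 1 * \<sigma> = m * (1 / m * \<sigma>)" using m by simp
  also have "\<dots> = of_int e' * m + of_int a' * (m * \<tau>)" unfolding m4 by (simp add: algebra_simps)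
  also have "\<dots> = of_int (e' * d + a' * e) + of_int (e' * c + a' * a) * \<sigma>"
    unfolding m2 by (subst m1) (simp add: algebra_simps)
  finally have 2: "0 = e' * d + a' * e" "1 = e' * c + a' * a"
    using lattice_coords_unique[OF assms(2)] by blast+
  have "(a * d - e * c) * (a' * d' - e' * c') = 1" using 1 2 by algebra
  then have unit: "a * d - e * c = 1 \<or> a * d - e * c = - 1" unfolding zmult_eq_1_iff by linarith
  have t: "\<tau> = (of_int a * \<sigma> + of_int e) / (of_int c * \<sigma> + of_int d)"
    using m m1 m2 by (simp add: nonzero_eq_divide_eq mult.commute add.commute)
  \<comment> \<open>The sign of the determinant is the sign of the imaginary part of the image,
    which is positive.\<close>
  have "Im ((of_int a * \<sigma> + of_int e) / (of_int c * \<sigma> + of_int d)) > 0" using T.Im_pos t by simp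
  then have "Im ((of_int a * \<sigma> + of_int e) * cnj (of_int c * \<sigma> + of_int d)) > 0"
    by (simp only: Im_complex_div_gt_0)
  also have "Im ((of_int a * \<sigma> + of_int e) * cnj (of_int c * \<sigma> + of_int d)) = of_int (a * d - e * c) * Im \<sigma>"
    by (simp add: algebra_simps)
  finally have "0 < real_of_int (a * d - e * c)"
    using S.Im_pos by (simp only: zero_less_mult_iff) linarith
  then have "0 < a * d - e * c" by (simp only: of_int_0_less_iff)
  with unit have "a * d - e * c = 1" by linarith
  then show ?thesis unfolding sl2z_equiv_def using t by blast
qed

subsection \<open>The exceptional curves\<close>

definition excep1 :: "complex \<Rightarrow> bool" where
  "excep1 \<tau> \<longleftrightarrow> half_plane \<tau> \<and> half_plane.g2 \<tau> = 0"

text \<open>The invariants of the half-period values \<open>7 * v\<close>, \<open>- 2 * v\<close>,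
  \<open>- 5 * v\<close>: 156 is 4 times 39 and 280 is 4 times 70.\<close>

definition excep2 :: "complex \<Rightarrow> bool" where
  "excep2 \<tau> \<longleftrightarrow> half_plane \<tau> \<and> (\<exists>v. v \<noteq> 0 \<and> half_plane.g2 \<tau> = 156 * v ^ 2 \<and> half_plane.g3 \<tau> = 280 * v ^ 3)"

lemma excep1_equiv:
  assumes "excep1 \<sigma>" "excep1 \<tau>"
  shows "sl2z_equiv \<sigma> \<tau>"
proof -
  have h: "half_plane \<tau>" "half_plane \<sigma>" "half_plane.g2 \<tau> = 0" "half_plane.g2 \<sigma> = 0"
    using assms by (auto simp: excep1_def)
  have nz: "half_plane.g3 \<tau> \<noteq> 0" "half_plane.g3 \<sigma> \<noteq> 0"
    using half_plane.discriminant_nz[OF h(1)] half_plane.discriminant_nz[OF h(2)] h(3,4) by auto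
  \<comment> \<open>A sixth root of the quotient of the \<open>g3\<close>, which have weight
    6.\<close>
  define m where "m = exp (Ln (half_plane.g3 \<tau> / half_plane.g3 \<sigma>) / 6)"
  have "m ^ 6 = exp (of_nat 6 * (Ln (half_plane.g3 \<tau> / half_plane.g3 \<sigma>) / 6))"
    unfolding m_def exp_of_nat_mult ..
  also have "\<dots> = half_plane.g3 \<tau> / half_plane.g3 \<sigma>" using nz by simp
  finally have "half_plane.g3 \<tau> = m ^ 6 * half_plane.g3 \<sigma>" using nz by simp
  moreover have "m \<noteq> 0" by (simp add: m_def)
  ultimately show ?thesis using sl2z_equiv_of_invariants[OF h(1,2), of m] h(3,4) by simp
qed

lemma excep2_equiv:
  assumes "excep2 \<sigma>" "excep2 \<tau>"
  shows "sl2z_equiv \<sigma> \<tau>"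
proof -
  obtain v where v: "half_plane \<tau>" "v \<noteq> 0" "half_plane.g2 \<tau> = 156 * v ^ 2" "half_plane.g3 \<tau> = 280 * v ^ 3"
    using assms(2) by (auto simp: excep2_def)
  obtain w where w: "half_plane \<sigma>" "w \<noteq> 0" "half_plane.g2 \<sigma> = 156 * w ^ 2" "half_plane.g3 \<sigma> = 280 * w ^ 3"
    using assms(1) by (auto simp: excep2_def)
  \<comment> \<open>Both invariants depend on \<open>m\<close> only through its square, which has to
    scale \<open>w\<close> to \<open>v\<close>.\<close>
  define m where "m = csqrt (v / w)"
  have m2: "m ^ 2 = v / w" by (simp add: m_def)
  then have "m \<noteq> 0" using v(2) w(2) by auto
  have vw: "v = m ^ 2 * w" using m2 w(2) by simp
  show ?thesis
    by (rule sl2z_equiv_of_invariants[OF v(1) w(1) \<open>m \<noteq> 0\<close>]) (unfold v w vw, algebra+)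
qed

text \<open>Together with \<open>r + s + t = 0\<close> the linear relation leaves one free
  parameter, namely the \<open>v\<close> of \<open>excep2\<close>.\<close>

lemma (in half_plane) excep2I:
  assumes "(r, s, t) \<in> root_triples" "2 * r + 7 * s = 0 \<or> 2 * r + 7 * t = 0"
  shows "excep2 \<tau>"
proof -
  note f = root_triples_facts[OF assms(1)]
  have main: "excep2 \<tau>" if h: "2 * r + 7 * s = 0" and g: "g2 = - 4 * (r * s + r * t + s * t)" "g3 = 4 * r * s * t"
    and sum: "r + s + t = 0" and ne: "r \<noteq> s" for s t
  proof -
    define v where "v = - s / 2"
    have s: "s = - 2 * v" by (simp add: v_def)
    have "2 * (r - 7 * v) = 0" using h s by algebra
    then have r: "r = 7 * v" by simp
    have t: "t = - 5 * v" using sum r s by algebra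
    have "v \<noteq> 0" using ne r s by auto
    moreover have "g2 = 156 * v ^ 2" "g3 = 280 * v ^ 3" unfolding g r s t by algebra+
    ultimately show ?thesis unfolding excep2_def using half_plane_axioms by blast
  qed
  from assms(2) show ?thesis
  proof
    assume "2 * r + 7 * s = 0"
    then show ?thesis using main[of s t] f by blast
  next
    assume "2 * r + 7 * t = 0"
    moreover have "g2 = - 4 * (r * t + r * s + t * s)" "g3 = 4 * r * t * s" "r + t + s = 0"
      using f(1,5,6) by algebra+
    ultimately show ?thesis using main[of t s] f(3) by blast
  qed
qed

text \<open>All points satisfying \<open>P\<close> are equivalent, so any one of them, if there is
  one, represents them all.\<close>

lemma finite_representatives:
  assumes "\<And>\<sigma> \<tau>. P \<sigma> \<Longrightarrow> P \<tau> \<Longrightarrow> sl2z_equiv \<sigma> \<tau>" "\<And>\<tau>. P \<tau> \<Longrightarrow> Im \<tau> > 0"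
  shows "\<exists>F. finite F \<and> F \<subseteq> {\<tau>. Im \<tau> > 0} \<and> (\<forall>\<tau>. P \<tau> \<longrightarrow> (\<exists>\<sigma>\<in>F. sl2z_equiv \<sigma> \<tau>))"
proof (cases "\<exists>\<sigma>. P \<sigma>")
  case True
  then obtain \<sigma> where "P \<sigma>" by blast
  then show ?thesis using assms by (intro exI[of _ "{\<sigma>}"]) auto
next
  case False
  then show ?thesis by (intro exI[of _ "{}"]) auto
qed

text \<open>The general curves are those outside finitely many isomorphism classes; \<open>F\<close>
  lists representatives of the excluded ones.\<close>

theorem theorem4p1:
  shows "\<exists>F. finite F \<and> F \<subseteq> {\<tau>. Im \<tau> > 0} \<and>
     (\<forall>\<tau>. Im \<tau> > 0 \<longrightarrow> (\<forall>\<sigma>\<in>F. \<not> sl2z_equiv \<sigma> \<tau>) \<longrightarrow> N4 \<tau> = 16)"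
proof -
  have "Im \<tau> > 0" if "excep1 \<tau>" for \<tau>
    using that half_plane.Im_pos by (simp add: excep1_def)
  from finite_representatives[of excep1, OF excep1_equiv this]
  obtain F1 where F1: "finite F1" "F1 \<subseteq> {\<tau>. Im \<tau> > 0}" "\<And>\<tau>. excep1 \<tau> \<Longrightarrow> \<exists>\<sigma>\<in>F1. sl2z_equiv \<sigma> \<tau>"
    by metis
  have "Im \<tau> > 0" if "excep2 \<tau>" for \<tau>
    using that half_plane.Im_pos by (simp add: excep2_def)
  from finite_representatives[of excep2, OF excep2_equiv this]
  obtain F2 where F2: "finite F2" "F2 \<subseteq> {\<tau>. Im \<tau> > 0}" "\<And>\<tau>. excep2 \<tau> \<Longrightarrow> \<exists>\<sigma>\<in>F2. sl2z_equiv \<sigma> \<tau>"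
    by metis
  have "N4 \<tau> = 16" if "Im \<tau> > 0" and n: "\<forall>\<sigma>\<in>F1 \<union> F2. \<not> sl2z_equiv \<sigma> \<tau>" for \<tau>
  proof -
    interpret half_plane \<tau> by unfold_locales fact
    have ne: "\<not> excep1 \<tau>" "\<not> excep2 \<tau>" using F1(3)[of \<tau>] F2(3)[of \<tau>] n by blast+
    show ?thesis
    proof (rule N4_generic)
      show "g2 \<noteq> 0" using ne(1) half_plane_axioms by (simp add: excep1_def)
    qed (use ne(2) excep2I in metis)
  qed
  then show ?thesis using F1(1,2) F2(1,2) by (intro exI[of _ "F1 \<union> F2"]) auto
qed

end
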